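(* Let $\pi_1:V_1\to X_1$ and $\pi_2:V_2\to X_2$ be two finite-dimensional diffeological vector pseudo-bundles, and let $(\tilde f,f)$ be a gluing between them given by a smooth invertible $f:X_1\supset Y\to X_2$ (a diffeomorphism with its image) and its smooth fibrewise linear lift $\tilde f:\pi_1^{-1}(Y)\to\pi_2^{-1}(f(Y))$. Suppose that the gluing-dual commutativity condition is satisfied, via a diffeomorphism $\psi_{\cup\leftrightarrow *}$, and that $(\pi_2^{-1}(f(Y)))^*$ and $(\pi_1^{-1}(Y))^*$ are fibrewise diffeomorphic. Finally, assume that for $i=1,2$ there exists a pseudo-metric $g_i$ on $\pi_i:V_i\to X_i$ such that $g_1$ and $g_2$ are compatible. Then the map $$\tilde g=\Psi_{\cup,*}\circ\bigl(g_2\cup_{(f^{-1},\tilde f^*\otimes\tilde f^* )}g_1\bigr)\circ\varphi_{X_1\leftrightarrow X_2}$$ is a pseudo-metric on the pseudo-bundle $\pi_1\cup_{(\tilde f,f)}\pi_2:V_1\cup_{\tilde f}V_2\to X_1\cup_fX_2$.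
   Context: A diffeological space is a set with a collection of maps (plots) from open subsets of the $\mathbb{R}^n$'s, containing constant maps, closed under precomposition with usual smooth maps, and satisfying the sheaf condition. A map is smooth if it carries plots to plots; a diffeomorphism is a smooth bijection with smooth inverse. Subsets, quotients, products and disjoint unions carry the subset, quotient, product and disjoint union diffeologies. A diffeological vector pseudo-bundle is a smooth surjection $\pi:V\to X$ with real vector space structures on fibres such that fibrewise addition $V\times_XV\to V$, scalar multiplication $\mathbb{R}\times V\to V$ and the zero section are smooth; it is finite-dimensional if its fibres are. Gluing: $X_1\cup_fX_2=(X_1\sqcup X_2)/\sim$, $\sim$ generated by $y\sim f(y)$ for $y\in Y$, with the quotient diffeology. If $\tilde f$ is a smooth fibrewise linear lift of $f$, the induced projection $\pi_1\cup_{(\tilde f,f)}\pi_2:V_1\cup_{\tilde f}V_2\to X_1\cup_fX_2$ is a pseudo-bundle, with fibre that of $V_1$ over points from $X_1\setminus Y$ and that of $V_2$ over points from $X_2$. Dual pseudo-bundle $\pi^*:V^*\to X$: $V^*=\bigcup_x(\pi^{-1}(x))^*$, with $(\pi^{-1}(x))^*$ the space of smooth linear maps $\pi^{-1}(x)\to\mathbb{R}$; $p:U\to V^*$ is a plot iff for every plot $q:U'\to V$ the map $(u,u')\mapsto p(u)(q(u'))$ on $\{\pi^*(p(u))=\pi(q(u'))\}\subset U\times U'$ is smooth for the subset diffeology. Tensor product of pseudo-bundles over $X$: fibrewise tensor product with the smallest pseudo-bundle diffeology making $V\times_XV'\to V\otimes V'$ smooth. Elements of $V^*\otimes V^*$ are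 regarded as bilinear forms on fibres of $V$. Pseudo-metric on $\pi:V\to X$: a smooth section $g:X\to V^*\otimes V^*$ such that each $g(x)$ is symmetric, positive semi-definite, of rank $\dim((\pi^{-1}(x))^* )$. Pseudo-metrics $g_1,g_2$ on $V_1,V_2$ are compatible (with respect to the gluing) if $g_1(y)(v_1,v_2)=g_2(f(y))(\tilde f(v_1),\tilde f(v_2))$ for all $y\in Y$ and $v_1,v_2\in\pi_1^{-1}(y)$. The switch map $\varphi_{X_1\leftrightarrow X_2}:X_1\cup_fX_2\to X_2\cup_{f^{-1}}X_1$ is the canonical diffeomorphism sending the class of each point of $X_1$ or $X_2$ to the class of the same point. The dual map $\tilde f^*$ sends $\ell\in(\pi_2^{-1}(f(y)))^*$ to $\ell\circ\tilde f|_{\pi_1^{-1}(y)}\in(\pi_1^{-1}(y))^*$; $V_2^*$ is glued to $V_1^*$ along $(\tilde f^*,f^{-1})$, giving $V_2^*\cup_{\tilde f^*}V_1^*\to X_2\cup_{f^{-1}}X_1$. The gluing-dual commutativity condition says that there is a (fibrewise linear) diffeomorphism $\psi_{\cup\leftrightarrow *}:(V_1\cup_{\tilde f}V_2)^*\to V_2^*\cup_{\tilde f^*}V_1^*$ covering $\varphi_{X_1\leftrightarrow X_2}$. The map $g_2\cup_{(f^{-1},\tilde f^*\otimes\tilde f^* )}g_1:X_2\cup_{f^{-1}}X_1\to(V_2^*\otimes V_2^* )\cup_{\tilde f^*\otimes\tilde f^*}(V_1^*\otimes V_1^* )$ sends the class of $x\in X_2\setminus f(Y)$ to the class of $g_2(x)$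 and the class of $x\in X_1$ to the class of $g_1(x)$. The diffeomorphism $\Psi_{\cup,*}:(V_2^*\otimes V_2^* )\cup_{\tilde f^*\otimes\tilde f^*}(V_1^*\otimes V_1^* )\to(V_1\cup_{\tilde f}V_2)^*\otimes(V_1\cup_{\tilde f}V_2)^*$ is the composition of the canonical fibrewise identification of its domain with $(V_2^*\cup_{\tilde f^*}V_1^* )\otimes(V_2^*\cup_{\tilde f^*}V_1^* )$ with $\psi_{\cup\leftrightarrow *}^{-1}\otimes\psi_{\cup\leftrightarrow *}^{-1}$.
   Formalization: A plot p of the dual pseudo-bundle is also required to have smooth base point (π*∘p a plot of X); with the evaluation condition alone, zero functionals over arbitrary base points would be plots, so π* would not be smooth and the tensor product would be undefined. *)

theory Defs
  imports
    "HOL-Analysis.Analysis"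
    "HOL-Library.Function_Algebras"
    "HOL-Library.Poly_Mapping"
begin

section \<open>Diffeological spaces\<close>

text \<open>
  \<^term>\<open>Euclidean_space n\<close> is the library's \<open>R^n\<close>: the functions \<^typ>\<open>nat \<Rightarrow> real\<close> vanishing from
  \<^term>\<open>n\<close> on. Open subsets of the various \<open>R^n\<close> thus live in one type. The partial derivatives below
  are taken at points of an open set \<open>U\<close>, so they depend on the values of the function on \<open>U\<close> only.
\<close>

fun Ck_on :: "nat \<Rightarrow> nat \<Rightarrow> (nat \<Rightarrow> real) set \<Rightarrow> ((nat \<Rightarrow> real) \<Rightarrow> real) \<Rightarrow> bool" where
  "Ck_on 0 n U h \<longleftrightarrow>
     continuous_map (subtopology (Euclidean_space n) U) euclideanreal h"
| "Ck_on (Suc k) n U h \<longleftrightarrow>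
     continuous_map (subtopology (Euclidean_space n) U) euclideanreal h \<and>
     (\<forall>i<n. \<exists>d. (\<forall>x\<in>U. ((\<lambda>t. h (x(i := t))) has_real_derivative d x) (at (x i))) \<and> Ck_on k n U d)"

definition Cinf_real :: "nat \<Rightarrow> (nat \<Rightarrow> real) set \<Rightarrow> ((nat \<Rightarrow> real) \<Rightarrow> real) \<Rightarrow> bool" where
  "Cinf_real n U h \<longleftrightarrow> (\<forall>k. Ck_on k n U h)"

definition Cinf :: "nat \<Rightarrow> (nat \<Rightarrow> real) set \<Rightarrow> nat \<Rightarrow> ((nat \<Rightarrow> real) \<Rightarrow> (nat \<Rightarrow> real)) \<Rightarrow> bool" where
  "Cinf n U m h \<longleftrightarrow>
     h ` U \<subseteq> topspace (Euclidean_space m) \<and> (\<forall>j<m. Cinf_real n U (\<lambda>x. h x j))"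

text \<open>
  \<open>plots X n U\<close> are the plots of \<open>X\<close> with domain the open set \<open>U\<close> of \<open>R^n\<close>. They are represented by
  total functions whose values outside \<open>U\<close> are irrelevant (axiom \<open>plot_cong\<close>).
\<close>

record 'a diffeology =
  points :: "'a set"
  plots :: "nat \<Rightarrow> (nat \<Rightarrow> real) set \<Rightarrow> ((nat \<Rightarrow> real) \<Rightarrow> 'a) set"

locale diffeological_space =
  fixes X :: "'a diffeology"
  assumes plot_domain: "p \<in> plots X n U \<Longrightarrow> openin (Euclidean_space n) U"
    and plot_range: "p \<in> plots X n U \<Longrightarrow> p ` U \<subseteq> points X"
    and plot_cong: "p \<in> plots X n U \<Longrightarrow> (\<And>u. u \<in> U \<Longrightarrow> q u = p u) \<Longrightarrow> q \<in> plots X n U"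
    and plot_const: "openin (Euclidean_space n) U \<Longrightarrow> x \<in> points X \<Longrightarrow> (\<lambda>_. x) \<in> plots X n U"
    and plot_compose: "p \<in> plots X n U \<Longrightarrow> openin (Euclidean_space m) W \<Longrightarrow> Cinf m W n h \<Longrightarrow>
      h ` W \<subseteq> U \<Longrightarrow> p \<circ> h \<in> plots X m W"
    and plot_sheaf: "openin (Euclidean_space n) U \<Longrightarrow>
      (\<And>u. u \<in> U \<Longrightarrow> \<exists>W. u \<in> W \<and> W \<subseteq> U \<and> p \<in> plots X n W) \<Longrightarrow> p \<in> plots X n U"

definition smooth_map :: "'a diffeology \<Rightarrow> 'b diffeology \<Rightarrow> ('a \<Rightarrow> 'b) \<Rightarrow> bool" where
  "smooth_map X Y h \<longleftrightarrow>
     h ` points X \<subseteq> points Y \<and> (\<forall>n U. \<forall>p\<in>plots X n U. h \<circ> p \<in> plots Y n U)"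

definition diffeomorphism :: "'a diffeology \<Rightarrow> 'b diffeology \<Rightarrow> ('a \<Rightarrow> 'b) \<Rightarrow> bool" where
  "diffeomorphism X Y h \<longleftrightarrow>
     bij_betw h (points X) (points Y) \<and> smooth_map X Y h \<and>
     smooth_map Y X (inv_into (points X) h)"

definition real_diffeology :: "real diffeology" where
  "real_diffeology =
     \<lparr>points = UNIV, plots = (\<lambda>n U. {p. openin (Euclidean_space n) U \<and> Cinf_real n U p})\<rparr>"

definition Rn_diffeology :: "nat \<Rightarrow> (nat \<Rightarrow> real) diffeology" where
  "Rn_diffeology m =
     \<lparr>points = topspace (Euclidean_space m),
      plots = (\<lambda>n U. {p. openin (Euclidean_space n) U \<and> Cinf n U m p})\<rparr>"

definition subset_diffeology :: "'a diffeology \<Rightarrow> 'a set \<Rightarrow> 'a diffeology" where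
  "subset_diffeology X A =
     \<lparr>points = points X \<inter> A, plots = (\<lambda>n U. {p \<in> plots X n U. p ` U \<subseteq> A})\<rparr>"

definition quotient_diffeology :: "'a diffeology \<Rightarrow> ('a \<times> 'a) set \<Rightarrow> 'a set diffeology" where
  "quotient_diffeology X R =
     \<lparr>points = points X // R,
      plots = (\<lambda>n U. {p. openin (Euclidean_space n) U \<and>
        (\<forall>u\<in>U. \<exists>W. u \<in> W \<and> W \<subseteq> U \<and> (\<exists>q\<in>plots X n W. \<forall>w\<in>W. p w = R `` {q w}))})\<rparr>"

definition prod_diffeology :: "'a diffeology \<Rightarrow> 'b diffeology \<Rightarrow> ('a \<times> 'b) diffeology" where
  "prod_diffeology X Y =
     \<lparr>points = points X \<times> points Y,
      plots = (\<lambda>n U. {p. fst \<circ> p \<in> plots X n U \<and> snd \<circ> p \<in> plots Y n U})\<rparr>"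

definition sum_diffeology :: "'a diffeology \<Rightarrow> 'b diffeology \<Rightarrow> ('a + 'b) diffeology" where
  "sum_diffeology X Y =
     \<lparr>points = points X <+> points Y,
      plots = (\<lambda>n U. {p. openin (Euclidean_space n) U \<and>
        (\<forall>u\<in>U. \<exists>W. u \<in> W \<and> W \<subseteq> U \<and>
          ((\<exists>q\<in>plots X n W. \<forall>w\<in>W. p w = Inl (q w)) \<or>
           (\<exists>q\<in>plots Y n W. \<forall>w\<in>W. p w = Inr (q w))))})\<rparr>"


section \<open>Diffeological vector pseudo-bundles\<close>

text \<open>
  The fibres are vector spaces on varying carriers inside one type, so the type-class based
  vector spaces of the library do not apply to them.
\<close>

locale real_vector_space_on =
  fixes S :: "'v set" and add :: "'v \<Rightarrow> 'v \<Rightarrow> 'v" and scale :: "real \<Rightarrow> 'v \<Rightarrow> 'v" and zero :: 'v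
  assumes zero_closed: "zero \<in> S"
    and add_closed: "v \<in> S \<Longrightarrow> w \<in> S \<Longrightarrow> add v w \<in> S"
    and scale_closed: "v \<in> S \<Longrightarrow> scale r v \<in> S"
    and add_assoc: "u \<in> S \<Longrightarrow> v \<in> S \<Longrightarrow> w \<in> S \<Longrightarrow> add (add u v) w = add u (add v w)"
    and add_commute: "v \<in> S \<Longrightarrow> w \<in> S \<Longrightarrow> add v w = add w v"
    and add_zero: "v \<in> S \<Longrightarrow> add zero v = v"
    and add_inverse: "v \<in> S \<Longrightarrow> \<exists>w\<in>S. add v w = zero"
    and scale_add_right: "v \<in> S \<Longrightarrow> w \<in> S \<Longrightarrow> scale r (add v w) = add (scale r v) (scale r w)"
    and scale_add_left: "v \<in> S \<Longrightarrow> scale (r + s) v = add (scale r v) (scale s v)"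
    and scale_scale: "v \<in> S \<Longrightarrow> scale r (scale s v) = scale (r * s) v"
    and scale_one: "v \<in> S \<Longrightarrow> scale 1 v = v"

record ('v, 'x) bundle_data =
  tot_space :: "'v diffeology"
  base_space :: "'x diffeology"
  bproj :: "'v \<Rightarrow> 'x"
  vadd :: "'v \<Rightarrow> 'v \<Rightarrow> 'v"
  vscale :: "real \<Rightarrow> 'v \<Rightarrow> 'v"
  vzero :: "'x \<Rightarrow> 'v"

definition over :: "('v, 'x) bundle_data \<Rightarrow> 'x set \<Rightarrow> 'v set" where
  "over B Z = {v \<in> points (tot_space B). bproj B v \<in> Z}"

definition fibre :: "('v, 'x) bundle_data \<Rightarrow> 'x \<Rightarrow> 'v set" where
  "fibre B x = over B {x}"

definition fibre_product ::
  "('v, 'x) bundle_data \<Rightarrow> ('w, 'x) bundle_data \<Rightarrow> ('v \<times> 'w) diffeology" where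
  "fibre_product B C =
     subset_diffeology (prod_diffeology (tot_space B) (tot_space C))
       {(v, w). bproj B v = bproj C w}"

locale vector_pseudo_bundle =
  fixes B :: "('v, 'x) bundle_data"
  assumes tot_diffeological: "diffeological_space (tot_space B)"
    and base_diffeological: "diffeological_space (base_space B)"
    and proj_smooth: "smooth_map (tot_space B) (base_space B) (bproj B)"
    and proj_surj: "bproj B ` points (tot_space B) = points (base_space B)"
    and fibre_vector_space: "x \<in> points (base_space B) \<Longrightarrow>
      real_vector_space_on (fibre B x) (vadd B) (vscale B) (vzero B x)"
    and add_smooth: "smooth_map (fibre_product B B) (tot_space B) (\<lambda>(v, w). vadd B v w)"
    and scale_smooth:
      "smooth_map (prod_diffeology real_diffeology (tot_space B)) (tot_space B) (\<lambda>(r, v). vscale B r v)"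
    and zero_smooth: "smooth_map (base_space B) (tot_space B) (vzero B)"

definition fibre_subspace :: "('v, 'x) bundle_data \<Rightarrow> 'x \<Rightarrow> 'v set \<Rightarrow> bool" where
  "fibre_subspace B x S \<longleftrightarrow>
     S \<subseteq> fibre B x \<and> vzero B x \<in> S \<and>
     (\<forall>v\<in>S. \<forall>w\<in>S. vadd B v w \<in> S) \<and> (\<forall>r. \<forall>v\<in>S. vscale B r v \<in> S)"

locale finite_dim_pseudo_bundle = vector_pseudo_bundle +
  assumes fibre_finite_dim: "x \<in> points (base_space B) \<Longrightarrow>
    \<exists>C. finite C \<and> C \<subseteq> fibre B x \<and> fibre_subspace B x hull C = fibre B x"

definition restrict_bundle :: "('v, 'x) bundle_data \<Rightarrow> 'x set \<Rightarrow> ('v, 'x) bundle_data" where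
  "restrict_bundle B Z =
     B\<lparr>tot_space := subset_diffeology (tot_space B) (over B Z),
       base_space := subset_diffeology (base_space B) Z\<rparr>"

text \<open>\<open>F\<close> covers \<open>h\<close> and is linear on the fibres over \<open>Z\<close>.\<close>

definition fibrewise_linear ::
  "('v, 'x) bundle_data \<Rightarrow> ('w, 'y) bundle_data \<Rightarrow> 'x set \<Rightarrow> ('x \<Rightarrow> 'y) \<Rightarrow> ('v \<Rightarrow> 'w) \<Rightarrow> bool" where
  "fibrewise_linear B C Z h F \<longleftrightarrow>
     (\<forall>x\<in>Z. \<forall>v\<in>fibre B x. F v \<in> fibre C (h x) \<and>
        (\<forall>w\<in>fibre B x. F (vadd B v w) = vadd C (F v) (F w)) \<and>
        (\<forall>r. F (vscale B r v) = vscale C r (F v)))"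

definition fibrewise_diffeomorphic ::
  "('v, 'x) bundle_data \<Rightarrow> ('w, 'y) bundle_data \<Rightarrow> bool" where
  "fibrewise_diffeomorphic B C \<longleftrightarrow>
     (\<exists>\<Theta>. diffeomorphism (tot_space B) (tot_space C) \<Theta> \<and>
        (\<forall>v\<in>points (tot_space B). \<forall>w\<in>points (tot_space B).
           bproj B v = bproj B w \<longleftrightarrow> bproj C (\<Theta> v) = bproj C (\<Theta> w)))"


section \<open>Gluing\<close>

definition glue_rel ::
  "'a diffeology \<Rightarrow> 'b diffeology \<Rightarrow> 'a set \<Rightarrow> ('a \<Rightarrow> 'b) \<Rightarrow> (('a + 'b) \<times> ('a + 'b)) set" where
  "glue_rel X1 X2 Y f =
     {(z, z') \<in> (points X1 <+> points X2) \<times> (points X1 <+> points X2).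
        equivclp (\<lambda>a b. \<exists>y\<in>Y. a = Inl y \<and> b = Inr (f y)) z z'}"

definition glue ::
  "'a diffeology \<Rightarrow> 'b diffeology \<Rightarrow> 'a set \<Rightarrow> ('a \<Rightarrow> 'b) \<Rightarrow> ('a + 'b) set diffeology" where
  "glue X1 X2 Y f = quotient_diffeology (sum_diffeology X1 X2) (glue_rel X1 X2 Y f)"

text \<open>
  A class of a gluing contains at most one point of the second space, and only one point of the
  first space if it contains none of the second. The operations of a glued pseudo-bundle are
  evaluated at the representative chosen below, so that its fibre is that of the second
  pseudo-bundle over all points of \<open>X2\<close> and that of the first one over \<open>X1 - Y\<close>.
\<close>

definition glue_rep :: "('a + 'b) set \<Rightarrow> 'a + 'b" where
  "glue_rep c =
     (if \<exists>b. Inr b \<in> c then Inr (THE b. Inr b \<in> c) else Inl (THE a. Inl a \<in> c))"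

fun sum_add ::
  "('v \<Rightarrow> 'v \<Rightarrow> 'v) \<Rightarrow> ('w \<Rightarrow> 'w \<Rightarrow> 'w) \<Rightarrow> 'v + 'w \<Rightarrow> 'v + 'w \<Rightarrow> 'v + 'w" where
  "sum_add add1 add2 (Inl a) (Inl b) = Inl (add1 a b)"
| "sum_add add1 add2 (Inr a) (Inr b) = Inr (add2 a b)"
| "sum_add add1 add2 _ _ = undefined"

definition glue_bundle ::
  "('v, 'a) bundle_data \<Rightarrow> ('w, 'b) bundle_data \<Rightarrow> 'a set \<Rightarrow> ('a \<Rightarrow> 'b) \<Rightarrow> ('v \<Rightarrow> 'w) \<Rightarrow>
   (('v + 'w) set, ('a + 'b) set) bundle_data" where
  "glue_bundle B1 B2 Y f F =
     (let RX = glue_rel (base_space B1) (base_space B2) Y f;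
          RV = glue_rel (tot_space B1) (tot_space B2) (over B1 Y) F
      in \<lparr>tot_space = glue (tot_space B1) (tot_space B2) (over B1 Y) F,
          base_space = glue (base_space B1) (base_space B2) Y f,
          bproj = (\<lambda>c. RX `` {map_sum (bproj B1) (bproj B2) (glue_rep c)}),
          vadd = (\<lambda>c d. RV `` {sum_add (vadd B1) (vadd B2) (glue_rep c) (glue_rep d)}),
          vscale = (\<lambda>r c. RV `` {map_sum (vscale B1 r) (vscale B2 r) (glue_rep c)}),
          vzero = (\<lambda>x. RV `` {map_sum (vzero B1) (vzero B2) (glue_rep x)})\<rparr>)"

definition gluing_data ::
  "('v, 'a) bundle_data \<Rightarrow> ('w, 'b) bundle_data \<Rightarrow> 'a set \<Rightarrow> ('a \<Rightarrow> 'b) \<Rightarrow> ('v \<Rightarrow> 'w) \<Rightarrow> bool" where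
  "gluing_data B1 B2 Y f F \<longleftrightarrow>
     Y \<subseteq> points (base_space B1) \<and> f ` Y \<subseteq> points (base_space B2) \<and>
     diffeomorphism (subset_diffeology (base_space B1) Y)
       (subset_diffeology (base_space B2) (f ` Y)) f \<and>
     smooth_map (subset_diffeology (tot_space B1) (over B1 Y))
       (subset_diffeology (tot_space B2) (over B2 (f ` Y))) F \<and>
     fibrewise_linear B1 B2 Y f F"

definition switch_map :: "('a + 'b) set \<Rightarrow> ('b + 'a) set" where
  "switch_map c = case_sum Inr Inl ` c"


section \<open>Dual pseudo-bundles\<close>

text \<open>
  A functional on a fibre is represented by its extension by zero to the whole type, so that the
  functionals on one fibre form a linear subspace of a function space. The points of the dual
  carry their base point, which keeps the fibres disjoint.
\<close>

definition dual_fibre :: "('v, 'x) bundle_data \<Rightarrow> 'x \<Rightarrow> ('v \<Rightarrow> real) set" where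
  "dual_fibre B x =
     {l. smooth_map (subset_diffeology (tot_space B) (fibre B x)) real_diffeology l \<and>
         (\<forall>v\<in>fibre B x. \<forall>w\<in>fibre B x. l (vadd B v w) = l v + l w) \<and>
         (\<forall>r. \<forall>v\<in>fibre B x. l (vscale B r v) = r * l v) \<and>
         (\<forall>v. v \<notin> fibre B x \<longrightarrow> l v = 0)}"

text \<open>
  The first condition on a plot \<open>p\<close>, that its base point varies smoothly, is what makes the
  projection of the dual smooth; the evaluation condition alone does not imply it, since it says
  nothing about base points that vary too wildly to be matched by plots of the total space.
\<close>

definition dual_plots :: "('v, 'x) bundle_data \<Rightarrow> nat \<Rightarrow> (nat \<Rightarrow> real) set \<Rightarrow>
    ((nat \<Rightarrow> real) \<Rightarrow> 'x \<times> ('v \<Rightarrow> real)) set" where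
  "dual_plots B n U =
     {p. fst \<circ> p \<in> plots (base_space B) n U \<and>
         (\<forall>u\<in>U. snd (p u) \<in> dual_fibre B (fst (p u))) \<and>
         (\<forall>m U'. \<forall>q\<in>plots (tot_space B) m U'.
            smooth_map
              (subset_diffeology (prod_diffeology (Rn_diffeology n) (Rn_diffeology m))
                 {(u, u'). u \<in> U \<and> u' \<in> U' \<and> fst (p u) = bproj B (q u')})
              real_diffeology
              (\<lambda>(u, u'). snd (p u) (q u')))}"

definition dual_bundle :: "('v, 'x) bundle_data \<Rightarrow> ('x \<times> ('v \<Rightarrow> real), 'x) bundle_data" where
  "dual_bundle B =
     \<lparr>tot_space =
        \<lparr>points = Sigma (points (base_space B)) (dual_fibre B), plots = dual_plots B\<rparr>,
      base_space = base_space B,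
      bproj = fst,
      vadd = (\<lambda>(x, l) (_, m). (x, \<lambda>v. l v + m v)),
      vscale = (\<lambda>r (x, l). (x, \<lambda>v. r * l v)),
      vzero = (\<lambda>x. (x, \<lambda>_. 0))\<rparr>"

text \<open>The dual map goes from the part of the dual of \<open>B2\<close> over \<open>f ` Y\<close> to the dual of \<open>B1\<close>.\<close>

definition dual_map ::
  "('v, 'a) bundle_data \<Rightarrow> 'a set \<Rightarrow> ('a \<Rightarrow> 'b) \<Rightarrow> ('v \<Rightarrow> 'w) \<Rightarrow>
   'b \<times> ('w \<Rightarrow> real) \<Rightarrow> 'a \<times> ('v \<Rightarrow> real)" where
  "dual_map B1 Y f F =
     (\<lambda>(x, l). let y = inv_into Y f x in (y, \<lambda>v. if v \<in> fibre B1 y then l (F v) else 0))"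


section \<open>Tensor products\<close>

text \<open>
  The fibre of the tensor product is the free vector space on pairs of vectors (finitely
  supported functions) modulo the bilinearity relations; its elements are cosets, tagged with
  their base point.
\<close>

lemma lookup_map_times:
  "Poly_Mapping.lookup (Poly_Mapping.map ((*) r) u) k = (r::real) * Poly_Mapping.lookup u k"
  by (simp add: Poly_Mapping.map.rep_eq when_def)

global_interpretation free: vector_space "\<lambda>(r::real) (u::'k \<Rightarrow>\<^sub>0 real). Poly_Mapping.map ((*) r) u"
  by unfold_locales
    (auto intro!: poly_mapping_eqI simp: lookup_map_times lookup_add algebra_simps)

definition tensor_null ::
  "('v, 'x) bundle_data \<Rightarrow> ('w, 'x) bundle_data \<Rightarrow> 'x \<Rightarrow> ('v \<times> 'w \<Rightarrow>\<^sub>0 real) set" where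
  "tensor_null B C x = free.span
     ({Poly_Mapping.single (vadd B v v', w) 1 - Poly_Mapping.single (v, w) 1
         - Poly_Mapping.single (v', w) 1
        | v v' w. v \<in> fibre B x \<and> v' \<in> fibre B x \<and> w \<in> fibre C x} \<union>
      {Poly_Mapping.single (v, vadd C w w') 1 - Poly_Mapping.single (v, w) 1
         - Poly_Mapping.single (v, w') 1
        | v w w'. v \<in> fibre B x \<and> w \<in> fibre C x \<and> w' \<in> fibre C x} \<union>
      {Poly_Mapping.single (vscale B r v, w) 1 - Poly_Mapping.single (v, w) r
        | r v w. v \<in> fibre B x \<and> w \<in> fibre C x} \<union>
      {Poly_Mapping.single (v, vscale C r w) 1 - Poly_Mapping.single (v, w) r
        | r v w. v \<in> fibre B x \<and> w \<in> fibre C x})"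

definition tensor_class ::
  "('v, 'x) bundle_data \<Rightarrow> ('w, 'x) bundle_data \<Rightarrow> 'x \<Rightarrow> ('v \<times> 'w \<Rightarrow>\<^sub>0 real) \<Rightarrow>
   ('v \<times> 'w \<Rightarrow>\<^sub>0 real) set" where
  "tensor_class B C x u = (+) u ` tensor_null B C x"

definition tensor_elem ::
  "('v, 'x) bundle_data \<Rightarrow> ('w, 'x) bundle_data \<Rightarrow> 'v \<times> 'w \<Rightarrow>
   'x \<times> ('v \<times> 'w \<Rightarrow>\<^sub>0 real) set" where
  "tensor_elem B C = (\<lambda>(v, w).
     (bproj B v, tensor_class B C (bproj B v) (Poly_Mapping.single (v, w) 1)))"

text \<open>The tensor product with an unspecified diffeology \<open>D\<close> on its total space.\<close>

definition tensor_with ::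
  "('v, 'x) bundle_data \<Rightarrow> ('w, 'x) bundle_data \<Rightarrow>
   ('x \<times> ('v \<times> 'w \<Rightarrow>\<^sub>0 real) set) diffeology \<Rightarrow>
   ('x \<times> ('v \<times> 'w \<Rightarrow>\<^sub>0 real) set, 'x) bundle_data" where
  "tensor_with B C D =
     \<lparr>tot_space = D,
      base_space = base_space B,
      bproj = fst,
      vadd = (\<lambda>(x, s) (_, t). (x, \<Union>a\<in>s. \<Union>b\<in>t. tensor_class B C x (a + b))),
      vscale = (\<lambda>r (x, s). (x, \<Union>a\<in>s. tensor_class B C x (Poly_Mapping.map ((*) r) a))),
      vzero = (\<lambda>x. (x, tensor_class B C x 0))\<rparr>"

definition tensor_points ::
  "('v, 'x) bundle_data \<Rightarrow> ('w, 'x) bundle_data \<Rightarrow> ('x \<times> ('v \<times> 'w \<Rightarrow>\<^sub>0 real) set) set" where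
  "tensor_points B C =
     {(x, tensor_class B C x u) | x u.
        x \<in> points (base_space B) \<and> Poly_Mapping.keys u \<subseteq> fibre B x \<times> fibre C x}"

text \<open>
  Pseudo-bundle diffeologies making the tensor map smooth are closed under intersection, and at
  least one exists (all maps with smooth base point), so the smallest one is their intersection.
\<close>

definition tensor_bundle ::
  "('v, 'x) bundle_data \<Rightarrow> ('w, 'x) bundle_data \<Rightarrow>
   ('x \<times> ('v \<times> 'w \<Rightarrow>\<^sub>0 real) set, 'x) bundle_data" where
  "tensor_bundle B C = tensor_with B C
     \<lparr>points = tensor_points B C,
      plots = (\<lambda>n U. \<Inter>{plots D n U | D.
        points D = tensor_points B C \<and>
        vector_pseudo_bundle (tensor_with B C D) \<and>
        smooth_map (fibre_product B C) D (tensor_elem B C)})\<rparr>"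

text \<open>
  \<open>tensor_map B' C' h F G\<close> is the tensor product of the maps \<open>F\<close> and \<open>G\<close> covering \<open>h\<close>, with values in
  the tensor product of \<open>B'\<close> and \<open>C'\<close>.
\<close>

definition free_map :: "('k \<Rightarrow> 'j) \<Rightarrow> ('k \<Rightarrow>\<^sub>0 real) \<Rightarrow> ('j \<Rightarrow>\<^sub>0 real)" where
  "free_map F u = (\<Sum>k\<in>Poly_Mapping.keys u. Poly_Mapping.single (F k) (Poly_Mapping.lookup u k))"

definition tensor_map ::
  "('v', 'y) bundle_data \<Rightarrow> ('w', 'y) bundle_data \<Rightarrow> ('x \<Rightarrow> 'y) \<Rightarrow> ('v \<Rightarrow> 'v') \<Rightarrow> ('w \<Rightarrow> 'w') \<Rightarrow>
   'x \<times> ('v \<times> 'w \<Rightarrow>\<^sub>0 real) set \<Rightarrow> 'y \<times> ('v' \<times> 'w' \<Rightarrow>\<^sub>0 real) set" where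
  "tensor_map B' C' h F G =
     (\<lambda>(x, s). (h x, \<Union>u\<in>s. tensor_class B' C' (h x) (free_map (map_prod F G) u)))"


section \<open>Pseudo-metrics\<close>

abbreviation cotensor_bundle ::
  "('v, 'x) bundle_data \<Rightarrow>
   ('x \<times> (('x \<times> ('v \<Rightarrow> real)) \<times> ('x \<times> ('v \<Rightarrow> real)) \<Rightarrow>\<^sub>0 real) set, 'x) bundle_data" where
  "cotensor_bundle B \<equiv> tensor_bundle (dual_bundle B) (dual_bundle B)"

text \<open>An element of the tensor square of the dual as a bilinear form on a fibre.\<close>

definition bilinear_form ::
  "'x \<times> (('x \<times> ('v \<Rightarrow> real)) \<times> ('x \<times> ('v \<Rightarrow> real)) \<Rightarrow>\<^sub>0 real) set \<Rightarrow> 'v \<Rightarrow> 'v \<Rightarrow> real" where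
  "bilinear_form t v w =
     (let u = (SOME u. u \<in> snd t) in
      \<Sum>(l, m)\<in>Poly_Mapping.keys u. Poly_Mapping.lookup u (l, m) * snd l v * snd m w)"

global_interpretation functional: vector_space "\<lambda>(r::real) (l::'v \<Rightarrow> real) v. r * l v"
  by unfold_locales (auto simp: fun_eq_iff algebra_simps)

text \<open>The rank of a bilinear form is the dimension of the image of the fibre in its dual.\<close>

definition form_rank :: "'v set \<Rightarrow> ('v \<Rightarrow> 'v \<Rightarrow> real) \<Rightarrow> nat" where
  "form_rank S b = functional.dim (b ` S)"

locale pseudo_metric = finite_dim_pseudo_bundle B
  for B :: "('v, 'x) bundle_data"
    and g :: "'x \<Rightarrow> 'x \<times> (('x \<times> ('v \<Rightarrow> real)) \<times> ('x \<times> ('v \<Rightarrow> real)) \<Rightarrow>\<^sub>0 real) set" +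
  assumes metric_smooth: "smooth_map (base_space B) (tot_space (cotensor_bundle B)) g"
    and metric_section: "x \<in> points (base_space B) \<Longrightarrow> bproj (cotensor_bundle B) (g x) = x"
    and metric_symmetric: "x \<in> points (base_space B) \<Longrightarrow> v \<in> fibre B x \<Longrightarrow> w \<in> fibre B x \<Longrightarrow>
      bilinear_form (g x) v w = bilinear_form (g x) w v"
    and metric_nonneg: "x \<in> points (base_space B) \<Longrightarrow> v \<in> fibre B x \<Longrightarrow>
      0 \<le> bilinear_form (g x) v v"
    and metric_rank: "x \<in> points (base_space B) \<Longrightarrow>
      form_rank (fibre B x) (bilinear_form (g x)) = functional.dim (dual_fibre B x)"

definition compatible_metrics where
  "compatible_metrics B1 Y f F g1 g2 \<longleftrightarrow>
     (\<forall>y\<in>Y. \<forall>v\<in>fibre B1 y. \<forall>w\<in>fibre B1 y.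
        bilinear_form (g1 y) v w = bilinear_form (g2 (f y)) (F v) (F w))"


section \<open>Gluing, duals and pseudo-metrics\<close>

text \<open>
  The dual and cotensor pseudo-bundles are glued in the reverse order, the second along \<open>f ` Y\<close>
  to the first.
\<close>

definition glued_duals ::
  "('v, 'a) bundle_data \<Rightarrow> ('w, 'b) bundle_data \<Rightarrow> 'a set \<Rightarrow> ('a \<Rightarrow> 'b) \<Rightarrow> ('v \<Rightarrow> 'w) \<Rightarrow>
   (('b \<times> ('w \<Rightarrow> real) + 'a \<times> ('v \<Rightarrow> real)) set, ('b + 'a) set) bundle_data" where
  "glued_duals B1 B2 Y f F =
     glue_bundle (dual_bundle B2) (dual_bundle B1) (f ` Y) (inv_into Y f) (dual_map B1 Y f F)"

definition glued_cotensors where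
  "glued_cotensors B1 B2 Y f F =
     glue_bundle (cotensor_bundle B2) (cotensor_bundle B1) (f ` Y) (inv_into Y f)
       (tensor_map (dual_bundle B1) (dual_bundle B1) (inv_into Y f)
          (dual_map B1 Y f F) (dual_map B1 Y f F))"

definition gluing_dual_commutativity where
  "gluing_dual_commutativity B1 B2 Y f F \<psi> \<longleftrightarrow>
     diffeomorphism (tot_space (dual_bundle (glue_bundle B1 B2 Y f F)))
       (tot_space (glued_duals B1 B2 Y f F)) \<psi> \<and>
     fibrewise_linear (dual_bundle (glue_bundle B1 B2 Y f F)) (glued_duals B1 B2 Y f F)
       (points (base_space (glue_bundle B1 B2 Y f F))) switch_map \<psi>"

definition glued_section where
  "glued_section B1 B2 Y f F g1 g2 c =
     glue_rel (tot_space (cotensor_bundle B2)) (tot_space (cotensor_bundle B1))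
       (over (cotensor_bundle B2) (f ` Y))
       (tensor_map (dual_bundle B1) (dual_bundle B1) (inv_into Y f)
          (dual_map B1 Y f F) (dual_map B1 Y f F))
     `` {map_sum g2 g1 (glue_rep c)}"

text \<open>
  The canonical identification of the glued cotensor pseudo-bundles with the tensor square of the
  glued duals, induced by the tensor squares of the maps of the two duals into their gluing.
\<close>

definition cotensor_gluing_id where
  "cotensor_gluing_id B1 B2 Y f F c =
     (let E = glued_duals B1 B2 Y f F;
          RX = glue_rel (base_space B2) (base_space B1) (f ` Y) (inv_into Y f);
          RV = glue_rel (tot_space (dual_bundle B2)) (tot_space (dual_bundle B1))
                 (over (dual_bundle B2) (f ` Y)) (dual_map B1 Y f F);
          i2 = (\<lambda>l. RV `` {Inl l});
          i1 = (\<lambda>l. RV `` {Inr l})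
      in case glue_rep c of
           Inl t \<Rightarrow> tensor_map E E (\<lambda>x. RX `` {Inl x}) i2 i2 t
         | Inr t \<Rightarrow> tensor_map E E (\<lambda>x. RX `` {Inr x}) i1 i1 t)"

definition Psi_map where
  "Psi_map B1 B2 Y f F \<psi> =
     (let V = glue_bundle B1 B2 Y f F;
          \<psi>_inv = inv_into (points (tot_space (dual_bundle V))) \<psi>;
          \<phi>_inv = inv_into (points (base_space V)) switch_map
      in tensor_map (dual_bundle V) (dual_bundle V) \<phi>_inv \<psi>_inv \<psi>_inv
         \<circ> cotensor_gluing_id B1 B2 Y f F)"

end

theory Submission
  imports Defs
begin

text \<open>
  Write \<open>V\<close> for the glued pseudo-bundle, \<open>i1\<close> and \<open>i2\<close> for the maps of the duals of \<open>B1\<close> and \<open>B2\<close>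
  into their gluing, and \<open>k1\<close>, \<open>k2\<close> for these maps followed by the inverse of \<open>\<psi>\<close>. They are smooth,
  fibrewise linear maps into the dual of \<open>V\<close>, covering the inclusions of the two bases into the
  glued base. Unfolding the three factors of the map \<open>g\<close> of the theorem shows that, on each of
  the two parts, it is \<open>g1\<close> or \<open>g2\<close> followed by a tensor square:

    \<open>g = (k1 \<otimes> k1) \<circ> g1\<close> on \<open>X1\<close>,  and  \<open>g = (k2 \<otimes> k2) \<circ> g2\<close> on \<open>X2\<close>.

  The first formula, and the second one off \<open>f ` Y\<close>, only express which representative of a class
  is used. Over \<open>f ` Y\<close> the second formula is where compatibility enters. The dual map \<open>D\<close> satisfies
  \<open>k2 = k1 \<circ> D\<close>, and the compatibility of the pseudo-metrics says that \<open>(D \<otimes> D) (g2 (f y))\<close> and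
  \<open>g1 y\<close> have the same bilinear form; an element of the tensor square of a finite-dimensional dual
  is determined by its form (\<open>tensor_class_eqI_bilinear_form\<close>), so the two elements agree.

  Smoothness of \<open>g\<close> follows because a map out of a gluing is smooth as soon as it is smooth on both
  parts (\<open>smooth_map_from_glue\<close>) and because the tensor product of smooth fibrewise linear maps is
  smooth (\<open>tensor_map_smooth\<close>).

  The remaining properties are pointwise. Every point of the glued base comes from \<open>X1\<close> or from
  \<open>X2 - f ` Y\<close>, and there \<open>k1\<close>, respectively \<open>k2\<close>, is a linear isomorphism of dual fibres. It need
  not be induced by a map of the fibres themselves, since \<open>\<psi>\<close> is any fibrewise linear
  diffeomorphism. But by the reflexivity of finite-dimensional spaces (\<open>dual_fibre_reflexive\<close>)
  every vector of one fibre has a counterpart in the other with the same values on corresponding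
  functionals. Hence the form of \<open>(k \<otimes> k) t\<close> takes the same values as that of \<open>t\<close>, and symmetry,
  positivity and rank carry over (\<open>transported_form\<close>).

  That \<open>V\<close> is itself a finite-dimensional pseudo-bundle is \<open>glue_bundle_finite_dim\<close>.
\<close>

section \<open>Smooth functions and diffeologies\<close>

lemma Ck_on_continuous:
  "Ck_on k n U h \<Longrightarrow> continuous_map (subtopology (Euclidean_space n) U) euclideanreal h"
  by (cases k) auto

lemma Ck_on_subset: "Ck_on k n U h \<Longrightarrow> W \<subseteq> U \<Longrightarrow> Ck_on k n W h"
proof (induction k arbitrary: h)
  case 0
  then show ?case by (simp add: continuous_map_from_subtopology_mono)
next
  case (Suc k)
  then show ?case
    by (auto simp: continuous_map_from_subtopology_mono) blast
qed

lemma Ck_on_const: "Ck_on k n U (\<lambda>_. c)"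
proof (induction k arbitrary: c)
  case (Suc k)
  then show ?case by (auto intro!: exI[of _ "\<lambda>_. 0"])
qed auto

lemma Ck_on_coordinate: "Ck_on k n U (\<lambda>x. x j)"
proof -
  have cont: "continuous_map (subtopology (Euclidean_space n) U) euclideanreal (\<lambda>x. x j)"
    unfolding Euclidean_space_def subtopology_subtopology
    by (rule continuous_map_from_subtopology[OF continuous_map_product_projection]) simp
  show ?thesis
  proof (cases k)
    case (Suc l)
    have "((\<lambda>t. (x(i := t)) j) has_real_derivative (if i = j then 1 else 0)) (at (x i))"
      for x :: "nat \<Rightarrow> real" and i
      by auto
    with cont Suc show ?thesis
      by (auto intro!: exI[of _ "\<lambda>_. if _ = j then 1 else 0"] Ck_on_const)
  qed (use cont in auto)
qed

lemma Ck_on_add: "Ck_on k n U g \<Longrightarrow> Ck_on k n U h \<Longrightarrow> Ck_on k n U (\<lambda>x. g x + h x)"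
proof (induction k arbitrary: g h)
  case 0
  then show ?case by (auto intro: continuous_map_add)
next
  case (Suc k)
  have "\<exists>d. (\<forall>x\<in>U. ((\<lambda>t. g (x(i := t)) + h (x(i := t))) has_real_derivative d x) (at (x i))) \<and>
      Ck_on k n U d" if "i < n" for i
  proof -
    obtain d where d: "\<forall>x\<in>U. ((\<lambda>t. g (x(i := t))) has_real_derivative d x) (at (x i))" "Ck_on k n U d"
      using Suc.prems(1) \<open>i < n\<close> by auto
    obtain e where e: "\<forall>x\<in>U. ((\<lambda>t. h (x(i := t))) has_real_derivative e x) (at (x i))" "Ck_on k n U e"
      using Suc.prems(2) \<open>i < n\<close> by auto
    from d e show ?thesis
      by (intro exI[of _ "\<lambda>x. d x + e x"]) (auto intro: DERIV_add Suc.IH)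
  qed
  with Suc.prems show ?case by (auto intro: continuous_map_add)
qed

lemma Ck_on_cmult: "Ck_on k n U h \<Longrightarrow> Ck_on k n U (\<lambda>x. r * h x)"
proof (induction k arbitrary: h)
  case 0
  then show ?case by (auto intro: continuous_map_real_mult)
next
  case (Suc k)
  have "\<exists>d. (\<forall>x\<in>U. ((\<lambda>t. r * h (x(i := t))) has_real_derivative d x) (at (x i))) \<and>
      Ck_on k n U d" if "i < n" for i
  proof -
    obtain d where
      "\<forall>x\<in>U. ((\<lambda>t. h (x(i := t))) has_real_derivative d x) (at (x i))" "Ck_on k n U d"
      using Suc.prems \<open>i < n\<close> by auto
    then show ?thesis
      by (intro exI[of _ "\<lambda>x. r * d x"]) (auto intro: DERIV_cmult Suc.IH)
  qed
  with Suc.prems show ?case by (auto intro: continuous_map_real_mult)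
qed

lemma Cinf_real_subset: "Cinf_real n U h \<Longrightarrow> W \<subseteq> U \<Longrightarrow> Cinf_real n W h"
  unfolding Cinf_real_def using Ck_on_subset by blast

lemma Cinf_subset: "Cinf n U m h \<Longrightarrow> W \<subseteq> U \<Longrightarrow> Cinf n W m h"
  unfolding Cinf_def using Cinf_real_subset by blast

lemma Cinf_id: "openin (Euclidean_space n) W \<Longrightarrow> Cinf n W n (\<lambda>x. x)"
  using openin_subset unfolding Cinf_def Cinf_real_def by (auto intro: Ck_on_coordinate)

lemma Cinf_preimage_open:
  assumes "openin (Euclidean_space n) U" "Cinf n U m h" "openin (Euclidean_space m) W"
  shows "openin (Euclidean_space n) {u \<in> U. h u \<in> W}"
proof -
  let ?T = "subtopology (Euclidean_space n) U"
  have top: "topspace ?T = U" using openin_subset[OF assms(1)] by auto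
  have "continuous_map ?T (powertop_real UNIV) h"
    unfolding continuous_map_componentwise_UNIV
  proof
    fix j
    show "continuous_map ?T euclideanreal (\<lambda>x. h x j)"
    proof (cases "j < m")
      case True
      then show ?thesis using assms(2) unfolding Cinf_def Cinf_real_def
        by (meson Ck_on_continuous)
    next
      case False
      then have "0 = h x j" if "x \<in> topspace ?T" for x
        using assms(2) that unfolding Cinf_def topspace_Euclidean_space by auto
      then show ?thesis
        by (rule continuous_map_eq[of ?T euclideanreal "\<lambda>_. 0", rotated]) auto
    qed
  qed
  moreover have "h \<in> topspace ?T \<rightarrow> {x. \<forall>i\<ge>m. x i = 0}"
    using assms(2) unfolding Cinf_def topspace_Euclidean_space by auto
  ultimately have "continuous_map ?T (Euclidean_space m) h"
    unfolding Euclidean_space_def by (simp add: continuous_map_in_subtopology)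
  from openin_continuous_map_preimage[OF this assms(3)] show ?thesis
    unfolding top using assms(1) openin_trans_full by blast
qed

lemma line_preimage_open:
  assumes U: "openin (Euclidean_space n) U" and x: "x \<in> U" and i: "i < n"
  shows "open {t. x(i := t) \<in> U}"
proof -
  have top: "\<forall>j\<ge>n. x j = 0"
    using openin_subset[OF U] x unfolding topspace_Euclidean_space by blast
  have "continuous_map euclideanreal (powertop_real UNIV) (\<lambda>t. x(i := t))"
    unfolding continuous_map_componentwise_UNIV
  proof
    fix j
    show "continuous_map euclideanreal euclideanreal (\<lambda>t. (x(i := t)) j)" by (cases "j = i") auto
  qed
  then have "continuous_map euclideanreal (Euclidean_space n) (\<lambda>t. x(i := t))"
    unfolding Euclidean_space_def continuous_map_in_subtopology using top i by auto
  from openin_continuous_map_preimage[OF this U] show ?thesis by simp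
qed

text \<open>At a point of an open set \<open>U\<close>, the difference quotients of \<open>h\<close> eventually involve values of
  \<open>h\<close> on \<open>U\<close> only.\<close>

lemma Ck_on_cong:
  assumes U: "openin (Euclidean_space n) U"
  shows "Ck_on k n U h \<Longrightarrow> (\<And>u. u \<in> U \<Longrightarrow> h' u = h u) \<Longrightarrow> Ck_on k n U h'"
proof (cases k)
  have cont: "continuous_map (subtopology (Euclidean_space n) U) euclideanreal h'"
    if "continuous_map (subtopology (Euclidean_space n) U) euclideanreal h" "\<And>u. u \<in> U \<Longrightarrow> h' u = h u"
    using that(1) by (rule continuous_map_eq) (use that(2) in simp)
  {
    assume "Ck_on k n U h" "\<And>u. u \<in> U \<Longrightarrow> h' u = h u" "k = 0"
    then show ?thesis using cont by simp
  }
  fix l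
  assume h: "Ck_on k n U h" and eq: "\<And>u. u \<in> U \<Longrightarrow> h' u = h u" and k: "k = Suc l"
  have "\<exists>d. (\<forall>x\<in>U. ((\<lambda>t. h' (x(i := t))) has_real_derivative d x) (at (x i))) \<and> Ck_on l n U d"
    if i: "i < n" for i
  proof -
    obtain d where d: "\<forall>x\<in>U. ((\<lambda>t. h (x(i := t))) has_real_derivative d x) (at (x i))" "Ck_on l n U d"
      using h i unfolding k by auto
    have "((\<lambda>t. h' (x(i := t))) has_real_derivative d x) (at (x i))" if x: "x \<in> U" for x
    proof (rule has_field_derivative_transform_within_open)
      show "((\<lambda>t. h (x(i := t))) has_real_derivative d x) (at (x i))" using d x by blast
      show "open {t. x(i := t) \<in> U}" by (rule line_preimage_open[OF U x i])
    qed (use x eq in auto)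
    with d(2) show ?thesis by blast
  qed
  then show ?thesis unfolding k using cont[OF Ck_on_continuous[OF h] eq] by simp
qed

lemma (in diffeological_space) plot_restrict:
  assumes "p \<in> plots X n U" "openin (Euclidean_space n) W" "W \<subseteq> U"
  shows "p \<in> plots X n W"
  using plot_compose[OF assms(1,2) Cinf_id[OF assms(2)]] assms(3) by (auto simp: comp_def)

lemma smooth_mapD:
  assumes "smooth_map X Z h"
  shows "x \<in> points X \<Longrightarrow> h x \<in> points Z"
    and "p \<in> plots X n U \<Longrightarrow> (\<lambda>u. h (p u)) \<in> plots Z n U"
  using assms unfolding smooth_map_def comp_def by blast+

lemma smooth_mapI:
  assumes "\<And>x. x \<in> points X \<Longrightarrow> h x \<in> points Z"
    and "\<And>n U p. p \<in> plots X n U \<Longrightarrow> (\<lambda>u. h (p u)) \<in> plots Z n U"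
  shows "smooth_map X Z h"
  using assms unfolding smooth_map_def comp_def by blast

lemma smooth_map_comp:
  assumes g: "smooth_map X Y g" and h: "smooth_map Y Z h"
  shows "smooth_map X Z (\<lambda>x. h (g x))"
  by (rule smooth_mapI; rule smooth_mapD[OF h]; rule smooth_mapD[OF g])

text \<open>
  The locality of plots, in a form that allows the local plots to be replaced by others with the
  same values. Tensor products of pseudo-bundles have it regardless of whether their family of
  admissible diffeologies is inhabited.
\<close>

definition local_plots :: "'a diffeology \<Rightarrow> bool" where
  "local_plots X \<longleftrightarrow> (\<forall>n U p. openin (Euclidean_space n) U \<longrightarrow>
     (\<forall>u\<in>U. \<exists>W q. u \<in> W \<and> W \<subseteq> U \<and> q \<in> plots X n W \<and> (\<forall>w\<in>W. p w = q w)) \<longrightarrow>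
     p \<in> plots X n U)"

lemma local_plotsD:
  assumes "local_plots X" "openin (Euclidean_space n) U"
    and "\<And>u. u \<in> U \<Longrightarrow> \<exists>W q. u \<in> W \<and> W \<subseteq> U \<and> q \<in> plots X n W \<and> (\<forall>w\<in>W. p w = q w)"
  shows "p \<in> plots X n U"
  using assms unfolding local_plots_def by simp

lemma (in diffeological_space) local_plots: "local_plots X"
  unfolding local_plots_def
proof (intro allI impI)
  fix n U p
  assume U: "openin (Euclidean_space n) U"
    and loc: "\<forall>u\<in>U. \<exists>W q. u \<in> W \<and> W \<subseteq> U \<and> q \<in> plots X n W \<and> (\<forall>w\<in>W. p w = q w)"
  show "p \<in> plots X n U"
  proof (rule plot_sheaf[OF U])
    fix u assume "u \<in> U"
    obtain W q where W: "u \<in> W" "W \<subseteq> U" "q \<in> plots X n W" "\<forall>w\<in>W. p w = q w"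
      using bspec[OF loc \<open>u \<in> U\<close>] by (elim exE conjE) (rule that)
    have "p \<in> plots X n W" by (rule plot_cong[OF W(3)]) (use W(4) in simp)
    with W show "\<exists>W. u \<in> W \<and> W \<subseteq> U \<and> p \<in> plots X n W" by blast
  qed
qed

lemma smooth_map_cong:
  assumes X: "diffeological_space X" and Z: "local_plots Z" and g: "smooth_map X Z g"
    and eq: "\<And>x. x \<in> points X \<Longrightarrow> h x = g x"
  shows "smooth_map X Z h"
proof (rule smooth_mapI)
  show "h x \<in> points Z" if "x \<in> points X" for x
    using smooth_mapD(1)[OF g that] eq[OF that] by simp
  fix n U p assume p: "p \<in> plots X n U"
  show "(\<lambda>u. h (p u)) \<in> plots Z n U"
  proof (rule local_plotsD[OF Z diffeological_space.plot_domain[OF X p]])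
    fix u assume "u \<in> U"
    have "\<forall>w\<in>U. h (p w) = g (p w)"
      using diffeological_space.plot_range[OF X p] eq by blast
    with \<open>u \<in> U\<close> smooth_mapD(2)[OF g p]
    show "\<exists>W q. u \<in> W \<and> W \<subseteq> U \<and> q \<in> plots Z n W \<and> (\<forall>w\<in>W. h (p w) = q w)"
      by (intro exI[of _ U] exI[of _ "\<lambda>w. g (p w)"]) simp
  qed
qed

lemma smooth_map_add_real:
  assumes "smooth_map X real_diffeology g" "smooth_map X real_diffeology h"
  shows "smooth_map X real_diffeology (\<lambda>x. g x + h x)"
  using assms unfolding smooth_map_def real_diffeology_def Cinf_real_def comp_def
  by (auto intro: Ck_on_add)

lemma smooth_map_cmult_real:
  assumes "smooth_map X real_diffeology h"
  shows "smooth_map X real_diffeology (\<lambda>x. r * h x)"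
  using assms unfolding smooth_map_def real_diffeology_def Cinf_real_def comp_def
  by (auto intro: Ck_on_cmult)

text \<open>
  The diffeology of a gluing is generated in this way: a map is a plot when it agrees near every
  point with one of a class \<open>P\<close> of maps that is stable under smooth reparametrisation.
\<close>

lemma diffeological_space_locally:
  assumes plots: "\<And>n U p. p \<in> plots X n U \<longleftrightarrow> openin (Euclidean_space n) U \<and>
      (\<forall>u\<in>U. \<exists>W q. u \<in> W \<and> W \<subseteq> U \<and> q \<in> P n W \<and> (\<forall>w\<in>W. p w = q w))"
    and dom: "\<And>n W q. q \<in> P n W \<Longrightarrow> openin (Euclidean_space n) W"
    and ran: "\<And>n W q. q \<in> P n W \<Longrightarrow> q ` W \<subseteq> points X"
    and const: "\<And>n U x. openin (Euclidean_space n) U \<Longrightarrow> x \<in> points X \<Longrightarrow> (\<lambda>_. x) \<in> P n U"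
    and comp: "\<And>n m U W q h. q \<in> P n U \<Longrightarrow> openin (Euclidean_space m) W \<Longrightarrow> Cinf m W n h \<Longrightarrow>
      h ` W \<subseteq> U \<Longrightarrow> (\<lambda>w. q (h w)) \<in> P m W"
  shows "diffeological_space X"
proof
  fix p n U assume p: "p \<in> plots X n U"
  show "openin (Euclidean_space n) U" using p plots by blast
  show "p ` U \<subseteq> points X"
  proof
    fix y assume "y \<in> p ` U"
    then obtain u where u: "u \<in> U" "y = p u" by blast
    with p obtain W q where "u \<in> W" "q \<in> P n W" "\<forall>w\<in>W. p w = q w"
      unfolding plots by blast
    with ran u show "y \<in> points X" by (metis image_subset_iff)
  qed
  show "q \<in> plots X n U" if "\<And>u. u \<in> U \<Longrightarrow> q u = p u" for q
    using p that unfolding plots by (metis (no_types, lifting) subsetD)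
next
  fix n U x assume "openin (Euclidean_space n) U" "x \<in> points X"
  then show "(\<lambda>_. x) \<in> plots X n U" unfolding plots using const by blast
next
  fix p n U m W h
  assume p: "p \<in> plots X n U" and W: "openin (Euclidean_space m) W"
    and h: "Cinf m W n h" "h ` W \<subseteq> U"
  show "p \<circ> h \<in> plots X m W"
    unfolding plots
  proof (intro conjI ballI W)
    fix w assume w: "w \<in> W"
    with h p obtain W' q where W': "h w \<in> W'" "q \<in> P n W'" "\<forall>w\<in>W'. p w = q w"
      unfolding plots by blast
    let ?N = "{u \<in> W. h u \<in> W'}"
    have N: "openin (Euclidean_space m) ?N" using Cinf_preimage_open[OF W h(1) dom[OF W'(2)]] .
    have "(\<lambda>w. q (h w)) \<in> P m ?N"
      by (rule comp[OF W'(2) N Cinf_subset[OF h(1)]]) auto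
    then show "\<exists>N q. w \<in> N \<and> N \<subseteq> W \<and> q \<in> P m N \<and> (\<forall>v\<in>N. (p \<circ> h) v = q v)"
      using w W' by (intro exI[of _ ?N] exI[of _ "\<lambda>w. q (h w)"]) auto
  qed
next
  fix n U p
  assume U: "openin (Euclidean_space n) U"
    and loc: "\<And>u. u \<in> U \<Longrightarrow> \<exists>W. u \<in> W \<and> W \<subseteq> U \<and> p \<in> plots X n W"
  show "p \<in> plots X n U"
    unfolding plots
  proof (intro conjI ballI U)
    fix u assume "u \<in> U"
    then obtain W where W: "u \<in> W" "W \<subseteq> U" "p \<in> plots X n W" using loc by blast
    then obtain W' q where "u \<in> W'" "W' \<subseteq> W" "q \<in> P n W'" "\<forall>w\<in>W'. p w = q w"
      unfolding plots by blast
    with W show "\<exists>W q. u \<in> W \<and> W \<subseteq> U \<and> q \<in> P n W \<and> (\<forall>w\<in>W. p w = q w)" by blast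
  qed
qed

section \<open>Tensor products and the maps between them\<close>

abbreviation free_scale :: "real \<Rightarrow> ('k \<Rightarrow>\<^sub>0 real) \<Rightarrow> ('k \<Rightarrow>\<^sub>0 real)" where
  "free_scale r u \<equiv> Poly_Mapping.map ((*) r) u"

lemma free_scale_single: "free_scale r (Poly_Mapping.single k s) = Poly_Mapping.single k (r * s)"
  by (rule poly_mapping_eqI) (simp add: lookup_map_times lookup_single when_def)

lemma free_map_superset:
  assumes "finite K" "Poly_Mapping.keys u \<subseteq> K"
  shows "free_map F u = (\<Sum>k\<in>K. Poly_Mapping.single (F k) (Poly_Mapping.lookup u k))"
  unfolding free_map_def
  by (rule sum.mono_neutral_left) (use assms in \<open>auto simp: in_keys_iff\<close>)

lemma free_map_add: "free_map F (u + v) = free_map F u + free_map F v"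
proof -
  let ?K = "Poly_Mapping.keys u \<union> Poly_Mapping.keys v"
  have "free_map F (u + v) = (\<Sum>k\<in>?K. Poly_Mapping.single (F k) (Poly_Mapping.lookup (u + v) k))"
    by (rule free_map_superset) (auto simp: keys_add)
  also have "\<dots> = free_map F u + free_map F v"
    by (simp add: lookup_add single_add sum.distrib free_map_superset[of ?K])
  finally show ?thesis .
qed

lemma free_map_scale: "free_map F (free_scale r u) = free_scale r (free_map F u)"
proof -
  have "free_map F (free_scale r u) =
      (\<Sum>k\<in>Poly_Mapping.keys u. Poly_Mapping.single (F k) (Poly_Mapping.lookup (free_scale r u) k))"
    by (rule free_map_superset) (auto simp: in_keys_iff lookup_map_times)
  also have "\<dots> = free_scale r (free_map F u)"
    unfolding free_map_def free.scale_sum_right by (simp add: lookup_map_times free_scale_single)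
  finally show ?thesis .
qed

lemma free_map_single: "free_map F (Poly_Mapping.single k r) = Poly_Mapping.single (F k) r"
  by (subst free_map_superset[of "{k}"]) auto

lemma free_map_zero: "free_map F 0 = 0"
  by (simp add: free_map_def)

lemma free_map_diff: "free_map F (u - v) = free_map F u - free_map F v"
  using free_map_add[of F "u - v" v] by (simp add: algebra_simps)

lemma free_map_sum: "free_map F (sum u I) = (\<Sum>i\<in>I. free_map F (u i))"
  by (induction I rule: infinite_finite_induct) (auto simp: free_map_add free_map_zero)

lemma free_map_comp: "free_map F (free_map G u) = free_map (F \<circ> G) u"
  by (simp add: free_map_def[of G] free_map_sum free_map_single) (simp add: free_map_def)

lemma free_map_cong:
  assumes "\<And>k. k \<in> Poly_Mapping.keys u \<Longrightarrow> F k = G k"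
  shows "free_map F u = free_map G u"
  unfolding free_map_def by (rule sum.cong) (use assms in auto)

lemma keys_free_map: "Poly_Mapping.keys (free_map F u) \<subseteq> F ` Poly_Mapping.keys u"
proof -
  have "Poly_Mapping.keys (free_map F u) \<subseteq>
      (\<Union>k\<in>Poly_Mapping.keys u. Poly_Mapping.keys (Poly_Mapping.single (F k) (Poly_Mapping.lookup u k)))"
    unfolding free_map_def by (rule keys_sum)
  also have "\<dots> \<subseteq> F ` Poly_Mapping.keys u" by (auto split: if_splits)
  finally show ?thesis .
qed

lemma free_scale_keys: "Poly_Mapping.keys (free_scale r u) \<subseteq> Poly_Mapping.keys u"
  by (auto simp: in_keys_iff lookup_map_times)

text \<open>The linear form on a free vector space with prescribed values on the generators.\<close>

definition free_form :: "('k \<Rightarrow> real) \<Rightarrow> ('k \<Rightarrow>\<^sub>0 real) \<Rightarrow> real" where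
  "free_form \<phi> u = (\<Sum>k\<in>Poly_Mapping.keys u. Poly_Mapping.lookup u k * \<phi> k)"

lemma free_form_superset:
  assumes "finite K" "Poly_Mapping.keys u \<subseteq> K"
  shows "free_form \<phi> u = (\<Sum>k\<in>K. Poly_Mapping.lookup u k * \<phi> k)"
  unfolding free_form_def
  by (rule sum.mono_neutral_left) (use assms in \<open>auto simp: in_keys_iff\<close>)

lemma free_form_add: "free_form \<phi> (u + v) = free_form \<phi> u + free_form \<phi> v"
proof -
  let ?K = "Poly_Mapping.keys u \<union> Poly_Mapping.keys v"
  have "free_form \<phi> (u + v) = (\<Sum>k\<in>?K. Poly_Mapping.lookup (u + v) k * \<phi> k)"
    by (rule free_form_superset) (auto simp: keys_add)
  also have "\<dots> = free_form \<phi> u + free_form \<phi> v"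
    by (simp add: lookup_add ring_distribs sum.distrib free_form_superset[of ?K])
  finally show ?thesis .
qed

lemma free_form_zero: "free_form \<phi> 0 = 0"
  by (simp add: free_form_def)

lemma free_form_scale: "free_form \<phi> (free_scale r u) = r * free_form \<phi> u"
  by (subst free_form_superset[of "Poly_Mapping.keys u"])
    (auto simp: free_form_def lookup_map_times sum_distrib_left mult.assoc
      dest: subsetD[OF free_scale_keys])

lemma free_form_single: "free_form \<phi> (Poly_Mapping.single k r) = r * \<phi> k"
  by (subst free_form_superset[of "{k}"]) auto

lemma free_form_diff: "free_form \<phi> (u - v) = free_form \<phi> u - free_form \<phi> v"
  using free_form_add[of \<phi> "u - v" v] by (simp add: algebra_simps)

lemma free_form_sum: "free_form \<phi> (sum u I) = (\<Sum>i\<in>I. free_form \<phi> (u i))"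
  by (induction I rule: infinite_finite_induct) (auto simp: free_form_add free_form_zero)

lemma free_form_map: "free_form \<phi> (free_map F u) = free_form (\<lambda>k. \<phi> (F k)) u"
  by (simp add: free_map_def free_form_sum free_form_single) (simp add: free_form_def)

lemma free_form_cong:
  assumes "\<And>k. k \<in> Poly_Mapping.keys u \<Longrightarrow> \<phi> k = \<phi>' k"
  shows "free_form \<phi> u = free_form \<phi>' u"
  unfolding free_form_def by (rule sum.cong) (use assms in auto)

lemma tensor_null_subspace: "free.subspace (tensor_null B C x)"
  unfolding tensor_null_def by (rule free.subspace_span)

lemma tensor_class_eq_iff:
  "tensor_class B C x u = tensor_class B C x v \<longleftrightarrow> u - v \<in> tensor_null B C x"
proof
  assume "tensor_class B C x u = tensor_class B C x v"
  moreover have "u \<in> tensor_class B C x u"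
    unfolding tensor_class_def using free.subspace_0[OF tensor_null_subspace] by force
  ultimately obtain n where "n \<in> tensor_null B C x" "u = v + n" unfolding tensor_class_def by auto
  then show "u - v \<in> tensor_null B C x" by simp
next
  have *: "tensor_class B C x u \<subseteq> tensor_class B C x v" if "u - v \<in> tensor_null B C x" for u v
  proof
    fix a assume "a \<in> tensor_class B C x u"
    then obtain n where "n \<in> tensor_null B C x" "a = u + n" unfolding tensor_class_def by auto
    then have "a = v + ((u - v) + n)" "(u - v) + n \<in> tensor_null B C x"
      using free.subspace_add[OF tensor_null_subspace that] by auto
    then show "a \<in> tensor_class B C x v" unfolding tensor_class_def by blast
  qed
  assume "u - v \<in> tensor_null B C x"
  moreover from this have "v - u \<in> tensor_null B C x"
    using free.subspace_neg[OF tensor_null_subspace] by fastforce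
  ultimately show "tensor_class B C x u = tensor_class B C x v" using * by blast
qed

lemma tensor_class_self: "u \<in> tensor_class B C x u"
  unfolding tensor_class_def using free.subspace_0[OF tensor_null_subspace] by force

lemma in_tensor_class_iff: "a \<in> tensor_class B C x u \<longleftrightarrow> a - u \<in> tensor_null B C x"
proof
  assume "a - u \<in> tensor_null B C x"
  moreover have "a = u + (a - u)" by simp
  ultimately show "a \<in> tensor_class B C x u" unfolding tensor_class_def by blast
qed (auto simp: tensor_class_def)

text \<open>The operations on a tensor product, and the tensor product of two maps, are unions over the
  representatives of a coset; by this rule one representative suffices.\<close>

lemma UN_tensor_class:
  assumes "\<And>a. a - u \<in> tensor_null B C x \<Longrightarrow> H a = H u"
  shows "(\<Union>a\<in>tensor_class B C x u. H a) = H u"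
proof (rule SUP_eq_const)
  show "tensor_class B C x u \<noteq> {}" using tensor_class_self[of u B C x] by blast
qed (use assms in \<open>simp add: in_tensor_class_iff\<close>)

lemma tensor_add_class:
  "vadd (tensor_with B C D) (x, tensor_class B C x u) (x', tensor_class B C x v) =
     (x, tensor_class B C x (u + v))"
proof -
  have "(\<Union>b\<in>tensor_class B C x v. tensor_class B C x (a + b)) = tensor_class B C x (a + v)" for a
    by (rule UN_tensor_class) (simp add: tensor_class_eq_iff)
  moreover have "(\<Union>a\<in>tensor_class B C x u. tensor_class B C x (a + v)) = tensor_class B C x (u + v)"
    by (rule UN_tensor_class) (simp add: tensor_class_eq_iff)
  ultimately show ?thesis by (simp add: tensor_with_def)
qed

lemma tensor_scale_class:
  "vscale (tensor_with B C D) r (x, tensor_class B C x u) = (x, tensor_class B C x (free_scale r u))"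
proof -
  have "free_scale r a - free_scale r u \<in> tensor_null B C x" if "a - u \<in> tensor_null B C x" for a
    using free.subspace_scale[OF tensor_null_subspace that]
    by (simp add: free.scale_right_diff_distrib)
  then have "(\<Union>a\<in>tensor_class B C x u. tensor_class B C x (free_scale r a)) =
      tensor_class B C x (free_scale r u)"
    by (intro UN_tensor_class) (simp add: tensor_class_eq_iff)
  then show ?thesis by (simp add: tensor_with_def)
qed

lemma fibre_tensor_with:
  assumes "points D = tensor_points B C" "x \<in> points (base_space B)"
  shows "fibre (tensor_with B C D) x =
    {(x, tensor_class B C x u) | u. Poly_Mapping.keys u \<subseteq> fibre B x \<times> fibre C x}"
  unfolding fibre_def[of "tensor_with B C D"] over_def[of "tensor_with B C D"]
  using assms by (auto simp: tensor_with_def tensor_points_def)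

lemma tensor_vector_space:
  assumes "points D = tensor_points B C" "x \<in> points (base_space B)"
  shows "real_vector_space_on (fibre (tensor_with B C D) x) (vadd (tensor_with B C D))
    (vscale (tensor_with B C D)) (vzero (tensor_with B C D) x)"
proof -
  let ?cl = "\<lambda>u. (x, tensor_class B C x u)"
  let ?K = "{u. Poly_Mapping.keys u \<subseteq> fibre B x \<times> fibre C x}"
  have fib: "fibre (tensor_with B C D) x = ?cl ` ?K"
    using fibre_tensor_with[OF assms] by blast
  have zero: "vzero (tensor_with B C D) x = ?cl 0" by (simp add: tensor_with_def)
  have K: "0 \<in> ?K" "u \<in> ?K \<Longrightarrow> v \<in> ?K \<Longrightarrow> u + v \<in> ?K" "u \<in> ?K \<Longrightarrow> free_scale r u \<in> ?K" for u v r
    using keys_add[of u v] free_scale_keys[of r u] by auto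
  let ?p = "vadd (tensor_with B C D)" and ?s = "vscale (tensor_with B C D)"
  have add: "?p (?cl u) (?cl v) = ?cl (u + v)" for u v by (rule tensor_add_class)
  have scale: "?s r (?cl u) = ?cl (free_scale r u)" for r u by (rule tensor_scale_class)
  show ?thesis
    unfolding fib zero
  proof (rule real_vector_space_on.intro; (elim imageE)?; (hypsubst)?;
      (unfold add scale)?)
    show "?cl 0 \<in> ?cl ` ?K" using K by blast
    show "?cl (u + v) \<in> ?cl ` ?K" if "u \<in> ?K" "v \<in> ?K" for u v
      using K(2)[OF that] by blast
    show "?cl (free_scale r u) \<in> ?cl ` ?K" if "u \<in> ?K" for r u
      using K(3)[OF that] by blast
    show "?cl (u + v + w) = ?cl (u + (v + w))" for u v w by (simp add: add.assoc)
    show "?cl (u + v) = ?cl (v + u)" for u v by (simp add: add.commute)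
    show "?cl (0 + u) = ?cl u" for u by simp
    show "\<exists>w\<in>?cl ` ?K. ?p (?cl u) w = ?cl 0" if "u \<in> ?K" for u
    proof
      have "u + free_scale (-1) u = 0"
        by (rule poly_mapping_eqI) (simp only: lookup_add lookup_map_times, simp)
      then show "?p (?cl u) (?cl (free_scale (-1) u)) = ?cl 0" by (simp only: add)
      show "?cl (free_scale (-1) u) \<in> ?cl ` ?K" using K(3)[OF that] by blast
    qed
    show "?cl (free_scale r (u + v)) = ?cl (free_scale r u + free_scale r v)" for r u v
      by (simp only: free.scale_right_distrib)
    show "?cl (free_scale (r + t) u) = ?cl (free_scale r u + free_scale t u)" for r t u
      by (simp only: free.scale_left_distrib)
    show "?cl (free_scale r (free_scale t u)) = ?cl (free_scale (r * t) u)" for r t u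
      by (simp only: free.scale_scale)
    show "?cl (free_scale 1 u) = ?cl u" for u by (simp only: free.scale_one)
  qed
qed

lemma fibrewise_linearD:
  assumes "fibrewise_linear B C Z h F" "x \<in> Z" "v \<in> fibre B x"
  shows "F v \<in> fibre C (h x)"
    and "w \<in> fibre B x \<Longrightarrow> F (vadd B v w) = vadd C (F v) (F w)"
    and "F (vscale B r v) = vscale C r (F v)"
  using assms unfolding fibrewise_linear_def by blast+

lemma tensor_null_relations:
  assumes "v \<in> fibre B x" "w \<in> fibre C x"
  shows "v' \<in> fibre B x \<Longrightarrow> Poly_Mapping.single (vadd B v v', w) 1 - Poly_Mapping.single (v, w) 1
      - Poly_Mapping.single (v', w) 1 \<in> tensor_null B C x"
    and "w' \<in> fibre C x \<Longrightarrow> Poly_Mapping.single (v, vadd C w w') 1 - Poly_Mapping.single (v, w) 1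
      - Poly_Mapping.single (v, w') 1 \<in> tensor_null B C x"
    and "Poly_Mapping.single (vscale B r v, w) 1 - Poly_Mapping.single (v, w) r \<in> tensor_null B C x"
    and "Poly_Mapping.single (v, vscale C r w) 1 - Poly_Mapping.single (v, w) r \<in> tensor_null B C x"
  unfolding tensor_null_def by (rule free.span_base; use assms in blast)+

lemma tensor_null_minimal:
  assumes sub: "free.subspace M"
    and "\<And>v v' w. v \<in> fibre B x \<Longrightarrow> v' \<in> fibre B x \<Longrightarrow> w \<in> fibre C x \<Longrightarrow>
      Poly_Mapping.single (vadd B v v', w) 1 - Poly_Mapping.single (v, w) 1
        - Poly_Mapping.single (v', w) 1 \<in> M"
    and "\<And>v w w'. v \<in> fibre B x \<Longrightarrow> w \<in> fibre C x \<Longrightarrow> w' \<in> fibre C x \<Longrightarrow>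
      Poly_Mapping.single (v, vadd C w w') 1 - Poly_Mapping.single (v, w) 1
        - Poly_Mapping.single (v, w') 1 \<in> M"
    and "\<And>r v w. v \<in> fibre B x \<Longrightarrow> w \<in> fibre C x \<Longrightarrow>
      Poly_Mapping.single (vscale B r v, w) 1 - Poly_Mapping.single (v, w) r \<in> M"
    and "\<And>r v w. v \<in> fibre B x \<Longrightarrow> w \<in> fibre C x \<Longrightarrow>
      Poly_Mapping.single (v, vscale C r w) 1 - Poly_Mapping.single (v, w) r \<in> M"
  shows "tensor_null B C x \<subseteq> M"
  unfolding tensor_null_def
proof (rule free.span_minimal[OF _ sub], intro Un_least subsetI)
qed (elim CollectE exE conjE; hypsubst; use assms(2-5) in blast)+

lemma free_map_tensor_null:
  assumes F: "fibrewise_linear B B' Z h F" and G: "fibrewise_linear C C' Z h G" and x: "x \<in> Z"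
    and u: "u \<in> tensor_null B C x"
  shows "free_map (map_prod F G) u \<in> tensor_null B' C' (h x)"
proof -
  let ?N = "tensor_null B' C' (h x)"
  let ?M = "{u. free_map (map_prod F G) u \<in> ?N}"
  note N = tensor_null_subspace[of B' C' "h x"]
  note Fx = fibrewise_linearD[OF F x] and Gx = fibrewise_linearD[OF G x]
  have "tensor_null B C x \<subseteq> ?M"
  proof (rule tensor_null_minimal)
    show "free.subspace ?M"
    proof (rule free.subspaceI)
      show "0 \<in> ?M" using free.subspace_0[OF N] by (simp add: free_map_zero)
      show "u + v \<in> ?M" if "u \<in> ?M" "v \<in> ?M" for u v
        using free.subspace_add[OF N, of "free_map (map_prod F G) u"] that by (simp add: free_map_add)
      show "free_scale r u \<in> ?M" if "u \<in> ?M" for r u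
        using free.subspace_scale[OF N] that by (simp add: free_map_scale)
    qed
  qed (simp_all add: free_map_diff free_map_single Fx Gx tensor_null_relations)
  with u show ?thesis by blast
qed

lemma tensor_map_class:
  assumes "fibrewise_linear B B' Z h F" "fibrewise_linear C C' Z h G" "x \<in> Z"
  shows "tensor_map B' C' h F G (x, tensor_class B C x u) =
    (h x, tensor_class B' C' (h x) (free_map (map_prod F G) u))"
proof -
  have "(\<Union>a\<in>tensor_class B C x u. tensor_class B' C' (h x) (free_map (map_prod F G) a)) =
      tensor_class B' C' (h x) (free_map (map_prod F G) u)"
    by (rule UN_tensor_class)
      (simp add: tensor_class_eq_iff free_map_diff[symmetric] free_map_tensor_null[OF assms])
  then show ?thesis by (simp add: tensor_map_def)
qed

lemma free_map_keys_fibre: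
  assumes "fibrewise_linear B B' Z h F" "fibrewise_linear C C' Z h G" "x \<in> Z"
    and "Poly_Mapping.keys u \<subseteq> fibre B x \<times> fibre C x"
  shows "Poly_Mapping.keys (free_map (map_prod F G) u) \<subseteq> fibre B' (h x) \<times> fibre C' (h x)"
proof
  fix k assume "k \<in> Poly_Mapping.keys (free_map (map_prod F G) u)"
  then obtain v w where "(v, w) \<in> Poly_Mapping.keys u" "k = (F v, G w)"
    using keys_free_map[of "map_prod F G" u] by auto
  then show "k \<in> fibre B' (h x) \<times> fibre C' (h x)"
    using assms(4) fibrewise_linearD(1)[OF assms(1,3)] fibrewise_linearD(1)[OF assms(2,3)] by auto
qed

lemma tensor_points_cases:
  assumes "t \<in> tensor_points B C"
  obtains x u where "t = (x, tensor_class B C x u)" "x \<in> points (base_space B)"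
    "Poly_Mapping.keys u \<subseteq> fibre B x \<times> fibre C x"
  using assms unfolding tensor_points_def by blast

lemma tensor_pointsI:
  "x \<in> points (base_space B) \<Longrightarrow> Poly_Mapping.keys u \<subseteq> fibre B x \<times> fibre C x \<Longrightarrow>
    (x, tensor_class B C x u) \<in> tensor_points B C"
  unfolding tensor_points_def by blast

lemma tensor_with_simps:
  "tot_space (tensor_with B C D) = D" "base_space (tensor_with B C D) = base_space B"
  "bproj (tensor_with B C D) = fst" "vzero (tensor_with B C D) x = (x, tensor_class B C x 0)"
  by (simp_all add: tensor_with_def)

lemma fibre_product_plots:
  "p \<in> plots (fibre_product B C) n U \<longleftrightarrow>
     (\<lambda>u. fst (p u)) \<in> plots (tot_space B) n U \<and> (\<lambda>u. snd (p u)) \<in> plots (tot_space C) n U \<and>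
     (\<forall>u\<in>U. bproj B (fst (p u)) = bproj C (snd (p u)))"
  by (auto simp: fibre_product_def subset_diffeology_def prod_diffeology_def comp_def
      image_subset_iff case_prod_unfold)

lemma fibre_product_points:
  "z \<in> points (fibre_product B C) \<longleftrightarrow>
     fst z \<in> points (tot_space B) \<and> snd z \<in> points (tot_space C) \<and> bproj B (fst z) = bproj C (snd z)"
  by (auto simp: fibre_product_def subset_diffeology_def prod_diffeology_def mem_Times_iff
      case_prod_unfold)

lemma scale_plots:
  "p \<in> plots (prod_diffeology real_diffeology X) n U \<longleftrightarrow>
     openin (Euclidean_space n) U \<and> Cinf_real n U (\<lambda>u. fst (p u)) \<and> (\<lambda>u. snd (p u)) \<in> plots X n U"
  by (auto simp: prod_diffeology_def real_diffeology_def comp_def)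

lemma fibreI: "v \<in> points (tot_space B) \<Longrightarrow> v \<in> fibre B (bproj B v)"
  by (simp add: fibre_def over_def)

lemma fibreD: "v \<in> fibre B x \<Longrightarrow> v \<in> points (tot_space B)" "v \<in> fibre B x \<Longrightarrow> bproj B v = x"
  by (auto simp: fibre_def over_def)

text \<open>
  The smallest diffeology is used through its universal property: the plots that a fibrewise
  tensor map carries into a given admissible diffeology of the target form an admissible
  diffeology of the source, hence contain all plots of the tensor product. The range
  conditions on plots stand in for the axioms of a diffeology, so that duals can be factors.
\<close>

lemma tensor_map_smooth:
  assumes base: "diffeological_space (base_space B)"
    and proj: "smooth_map (tot_space B) (base_space B) (bproj B)"
    and ranB: "\<And>n U p. p \<in> plots (tot_space B) n U \<Longrightarrow> p ` U \<subseteq> points (tot_space B)"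
    and ranC: "\<And>n U p. p \<in> plots (tot_space C) n U \<Longrightarrow> p ` U \<subseteq> points (tot_space C)"
    and h: "smooth_map (base_space B) (base_space B') h"
    and F: "smooth_map (tot_space B) (tot_space B') F"
    and G: "smooth_map (tot_space C) (tot_space C') G"
    and linF: "fibrewise_linear B B' (points (base_space B)) h F"
    and linG: "fibrewise_linear C C' (points (base_space B)) h G"
  shows "smooth_map (tot_space (tensor_bundle B C)) (tot_space (tensor_bundle B' C'))
    (tensor_map B' C' h F G)"
proof (rule smooth_mapI)
  let ?T = "tensor_map B' C' h F G"
  note T = tensor_map_class[OF linF linG]
  have pts: "?T t \<in> tensor_points B' C'" if "t \<in> tensor_points B C" for t
    using that
  proof (rule tensor_points_cases)
    fix x u assume t: "t = (x, tensor_class B C x u)" and x: "x \<in> points (base_space B)"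
      and u: "Poly_Mapping.keys u \<subseteq> fibre B x \<times> fibre C x"
    show ?thesis
      unfolding t T[OF x]
      by (rule tensor_pointsI[OF smooth_mapD(1)[OF h x] free_map_keys_fibre[OF linF linG x u]])
  qed
  then show "?T t \<in> points (tot_space (tensor_bundle B' C'))"
    if "t \<in> points (tot_space (tensor_bundle B C))" for t
    using that by (simp add: tensor_bundle_def tensor_with_simps)
  fix n U p assume p: "p \<in> plots (tot_space (tensor_bundle B C)) n U"
  show "(\<lambda>u. ?T (p u)) \<in> plots (tot_space (tensor_bundle B' C')) n U"
    unfolding tensor_bundle_def tensor_with_simps
  proof (simp, intro allI impI, elim exE conjE, hypsubst)
    fix D' assume ptsD': "points D' = tensor_points B' C'"
      and bD': "vector_pseudo_bundle (tensor_with B' C' D')"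
      and elD': "smooth_map (fibre_product B' C') D' (tensor_elem B' C')"
    interpret b: diffeological_space "base_space B" by (rule base)
    interpret D': vector_pseudo_bundle "tensor_with B' C' D'" by (rule bD')
    interpret d: diffeological_space D'
      using D'.tot_diffeological by (simp add: tensor_with_simps)
    define D where "D = \<lparr>points = tensor_points B C, plots = (\<lambda>n U. {p.
      (\<lambda>u. fst (p u)) \<in> plots (base_space B) n U \<and> p ` U \<subseteq> tensor_points B C \<and>
      (\<lambda>u. ?T (p u)) \<in> plots D' n U})\<rparr>"
    have Dp: "points D = tensor_points B C" by (simp add: D_def)
    have Dplots: "p \<in> plots D n U \<longleftrightarrow> (\<lambda>u. fst (p u)) \<in> plots (base_space B) n U \<and>
        p ` U \<subseteq> tensor_points B C \<and> (\<lambda>u. ?T (p u)) \<in> plots D' n U" for p n U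
      by (simp add: D_def)
    have diffD: "diffeological_space D"
    proof (unfold_locales, goal_cases)
      case (1 p n U) then show ?case using b.plot_domain Dplots by blast
    next
      case (2 p n U) then show ?case using Dplots Dp by blast
    next
      case (3 p n U q)
      have "(\<lambda>u. fst (q u)) \<in> plots (base_space B) n U"
        by (rule b.plot_cong[of "\<lambda>u. fst (p u)"]) (use 3 Dplots in auto)
      moreover have "(\<lambda>u. ?T (q u)) \<in> plots D' n U"
        by (rule d.plot_cong[of "\<lambda>u. ?T (p u)"]) (use 3 Dplots in auto)
      ultimately show ?case using 3 unfolding Dplots by (simp add: image_subset_iff)
    next
      case (4 n U t)
      then have t: "t \<in> tensor_points B C" by (simp add: Dp)
      then have "fst t \<in> points (base_space B)" by (auto simp: tensor_points_def)
      moreover have "?T t \<in> points D'" using pts[OF t] ptsD' by simp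
      ultimately show ?case unfolding Dplots
        using t b.plot_const[OF 4(1)] d.plot_const[OF 4(1)] by auto
    next
      case (5 p n U m W h)
      then show ?case unfolding Dplots
        using b.plot_compose[of "\<lambda>u. fst (p u)", OF _ 5(2-4)]
          d.plot_compose[of "\<lambda>u. ?T (p u)", OF _ 5(2-4)]
        by (auto simp: comp_def)
    next
      case (6 n U p)
      note loc = 6(2)[unfolded Dplots]
      have "(\<lambda>u. fst (p u)) \<in> plots (base_space B) n U"
      proof (rule b.plot_sheaf[OF 6(1)])
        show "\<exists>W. u \<in> W \<and> W \<subseteq> U \<and> (\<lambda>u. fst (p u)) \<in> plots (base_space B) n W" if "u \<in> U" for u
          using loc[OF that] by (elim exE conjE) (intro exI conjI)
      qed
      moreover have "(\<lambda>u. ?T (p u)) \<in> plots D' n U"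
      proof (rule d.plot_sheaf[OF 6(1)])
        show "\<exists>W. u \<in> W \<and> W \<subseteq> U \<and> (\<lambda>u. ?T (p u)) \<in> plots D' n W" if "u \<in> U" for u
          using loc[OF that] by (elim exE conjE) (intro exI conjI)
      qed
      moreover have "p u \<in> tensor_points B C" if "u \<in> U" for u
        using loc[OF that] by (elim exE conjE) (simp add: image_subset_iff)
      then have "p ` U \<subseteq> tensor_points B C" by blast
      ultimately show ?case unfolding Dplots by blast
    qed
    have T_add: "?T (vadd (tensor_with B C D) s t) = vadd (tensor_with B' C' D') (?T s) (?T t)"
      and add_pts: "vadd (tensor_with B C D) s t \<in> tensor_points B C"
      and add_fst: "fst (vadd (tensor_with B C D) s t) = fst s"
      if st: "s \<in> tensor_points B C" "t \<in> tensor_points B C" "fst s = fst t" for s t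
    proof -
      obtain x u where s: "s = (x, tensor_class B C x u)" "x \<in> points (base_space B)"
        "Poly_Mapping.keys u \<subseteq> fibre B x \<times> fibre C x" using st(1) by (rule tensor_points_cases)
      obtain y v where t: "t = (y, tensor_class B C y v)" 
        "Poly_Mapping.keys v \<subseteq> fibre B y \<times> fibre C y" using st(2) by (rule tensor_points_cases)
      have y: "y = x" using st(3) s(1) t(1) by simp
      show "?T (vadd (tensor_with B C D) s t) = vadd (tensor_with B' C' D') (?T s) (?T t)"
        unfolding s t y by (simp add: tensor_add_class T[OF s(2)] free_map_add)
      show "fst (vadd (tensor_with B C D) s t) = fst s"
        unfolding s t y by (simp add: tensor_add_class)
      show "vadd (tensor_with B C D) s t \<in> tensor_points B C"
        unfolding s t y tensor_add_class
        by (rule tensor_pointsI[OF s(2)]) (use s(3) t(2) y keys_add[of u v] in auto)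
    qed
    have T_scale: "?T (vscale (tensor_with B C D) r s) = vscale (tensor_with B' C' D') r (?T s)"
      and scale_pts: "vscale (tensor_with B C D) r s \<in> tensor_points B C"
      and scale_fst: "fst (vscale (tensor_with B C D) r s) = fst s"
      if s: "s \<in> tensor_points B C" for s r
    proof -
      obtain x u where s: "s = (x, tensor_class B C x u)" "x \<in> points (base_space B)"
        "Poly_Mapping.keys u \<subseteq> fibre B x \<times> fibre C x" using s by (rule tensor_points_cases)
      show "?T (vscale (tensor_with B C D) r s) = vscale (tensor_with B' C' D') r (?T s)"
        unfolding s by (simp add: tensor_scale_class T[OF s(2)] free_map_scale)
      show "fst (vscale (tensor_with B C D) r s) = fst s"
        unfolding s by (simp add: tensor_scale_class)
      show "vscale (tensor_with B C D) r s \<in> tensor_points B C"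
        unfolding s tensor_scale_class
        by (rule tensor_pointsI[OF s(2)]) (use s(3) free_scale_keys[of r u] in auto)
    qed
    have T_fst: "fst (?T s) = h (fst s)" for s
      by (simp add: tensor_map_def split: prod.split)
    have bD: "vector_pseudo_bundle (tensor_with B C D)"
    proof (rule vector_pseudo_bundle.intro, unfold tensor_with_simps, goal_cases)
      case 1 show ?case by (rule diffD)
    next
      case 2 show ?case by (rule base)
    next
      case 3
      show ?case
      proof (rule smooth_mapI)
        show "fst t \<in> points (base_space B)" if "t \<in> points D" for t
          using that by (auto simp: Dp tensor_points_def)
        show "(\<lambda>u. fst (p u)) \<in> plots (base_space B) n U" if "p \<in> plots D n U" for p n U
          using that unfolding Dplots by blast
      qed
    next
      case 4
      have "x \<in> fst ` tensor_points B C" if "x \<in> points (base_space B)" for x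
        using tensor_pointsI[OF that, of 0] by force
      then show ?case by (auto simp: Dp tensor_points_def)
    next
      case (5 x)
      from tensor_vector_space[OF Dp 5] show ?case by (simp add: tensor_with_simps)
    next
      case 6
      show ?case
      proof (rule smooth_mapI)
        fix z assume "z \<in> points (fibre_product (tensor_with B C D) (tensor_with B C D))"
        then show "(\<lambda>(v, w). vadd (tensor_with B C D) v w) z \<in> points D"
          by (cases z) (simp add: fibre_product_points tensor_with_simps Dp add_pts)
      next
        fix n U p assume "p \<in> plots (fibre_product (tensor_with B C D) (tensor_with B C D)) n U"
        then have p1: "(\<lambda>u. fst (p u)) \<in> plots D n U" and p2: "(\<lambda>u. snd (p u)) \<in> plots D n U"
          and eq: "\<And>u. u \<in> U \<Longrightarrow> fst (fst (p u)) = fst (snd (p u))"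
          by (auto simp: fibre_product_plots tensor_with_simps)
        note P = p1[unfolded Dplots] p2[unfolded Dplots]
        have in1: "fst (p u) \<in> tensor_points B C" and in2: "snd (p u) \<in> tensor_points B C"
          if "u \<in> U" for u using P that by auto
        let ?s = "\<lambda>u. vadd (tensor_with B C D) (fst (p u)) (snd (p u))"
        have "(\<lambda>u. (?T (fst (p u)), ?T (snd (p u)))) \<in>
            plots (fibre_product (tensor_with B' C' D') (tensor_with B' C' D')) n U"
          using P eq by (simp add: fibre_product_plots tensor_with_simps T_fst)
        from smooth_mapD(2)[OF D'.add_smooth[unfolded tensor_with_simps] this]
        have a: "(\<lambda>u. vadd (tensor_with B' C' D') (?T (fst (p u))) (?T (snd (p u)))) \<in> plots D' n U"
          by (simp add: tensor_with_simps)
        have "(\<lambda>u. ?T (?s u)) \<in> plots D' n U"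
          by (rule d.plot_cong[OF a]) (simp add: T_add[OF in1 in2 eq])
        moreover have "(\<lambda>u. fst (?s u)) \<in> plots (base_space B) n U"
          by (rule b.plot_cong[OF P(1)[THEN conjunct1]]) (simp add: add_fst[OF in1 in2 eq])
        ultimately have "?s \<in> plots D n U"
          unfolding Dplots using add_pts[OF in1 in2 eq] by auto
        then show "(\<lambda>u. (\<lambda>(v, w). vadd (tensor_with B C D) v w) (p u)) \<in> plots D n U"
          by (simp add: case_prod_unfold)
      qed
    next
      case 7
      show ?case
      proof (rule smooth_mapI)
        fix z assume "z \<in> points (prod_diffeology real_diffeology D)"
        then show "(\<lambda>(r, v). vscale (tensor_with B C D) r v) z \<in> points D"
          by (auto simp: prod_diffeology_def Dp scale_pts)
      next
        fix n U p assume "p \<in> plots (prod_diffeology real_diffeology D) n U"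
        then have U: "openin (Euclidean_space n) U" and p1: "Cinf_real n U (\<lambda>u. fst (p u))"
          and p2: "(\<lambda>u. snd (p u)) \<in> plots D n U"
          by (auto simp: scale_plots)
        note P = p2[unfolded Dplots]
        have in2: "snd (p u) \<in> tensor_points B C" if "u \<in> U" for u using P that by auto
        let ?s = "\<lambda>u. vscale (tensor_with B C D) (fst (p u)) (snd (p u))"
        have "(\<lambda>u. (fst (p u), ?T (snd (p u)))) \<in> plots (prod_diffeology real_diffeology D') n U"
          using P p1 U by (simp add: scale_plots)
        from smooth_mapD(2)[OF D'.scale_smooth[unfolded tensor_with_simps] this]
        have a: "(\<lambda>u. vscale (tensor_with B' C' D') (fst (p u)) (?T (snd (p u)))) \<in> plots D' n U"
          by simp
        have "(\<lambda>u. ?T (?s u)) \<in> plots D' n U"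
          by (rule d.plot_cong[OF a]) (simp add: T_scale[OF in2])
        moreover have "(\<lambda>u. fst (?s u)) \<in> plots (base_space B) n U"
          by (rule b.plot_cong[OF P[THEN conjunct1]]) (simp add: scale_fst[OF in2])
        ultimately have "?s \<in> plots D n U"
          unfolding Dplots using scale_pts[OF in2] by auto
        then show "(\<lambda>u. (\<lambda>(r, v). vscale (tensor_with B C D) r v) (p u)) \<in> plots D n U"
          by (simp add: case_prod_unfold)
      qed
    next
      case 8
      show ?case
      proof (rule smooth_mapI)
        fix x assume "x \<in> points (base_space B)"
        then show "(x, tensor_class B C x 0) \<in> points D"
          unfolding Dp by (rule tensor_pointsI) simp
      next
        fix n U p assume p: "p \<in> plots (base_space B) n U"
        then have in_base: "p u \<in> points (base_space B)" if "u \<in> U" for u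
          using b.plot_range that by blast
        have a: "(\<lambda>u. (h (p u), tensor_class B' C' (h (p u)) 0)) \<in> plots D' n U"
          using smooth_mapD(2)[OF D'.zero_smooth[unfolded tensor_with_simps] smooth_mapD(2)[OF h p]]
          by (simp add: tensor_with_simps)
        have "(\<lambda>u. ?T (p u, tensor_class B C (p u) 0)) \<in> plots D' n U"
          by (rule d.plot_cong[OF a]) (simp add: T[OF in_base] free_map_zero)
        then show "(\<lambda>u. (p u, tensor_class B C (p u) 0)) \<in> plots D n U"
          unfolding Dplots using p by (auto simp: tensor_with_simps intro!: tensor_pointsI in_base)
      qed
    qed
    have elD: "smooth_map (fibre_product B C) D (tensor_elem B C)"
    proof (rule smooth_mapI)
      have el_pts: "tensor_elem B C z \<in> tensor_points B C"
        and T_el: "?T (tensor_elem B C z) = tensor_elem B' C' (F (fst z), G (snd z))"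
        and el_proj: "bproj B' (F (fst z)) = bproj C' (G (snd z))"
        if z: "z \<in> points (fibre_product B C)" for z
      proof -
        let ?x = "bproj B (fst z)"
        have z: "fst z \<in> fibre B ?x" "snd z \<in> fibre C ?x" "?x \<in> points (base_space B)"
          using z smooth_mapD(1)[OF proj] fibreI unfolding fibre_product_points by fastforce+
        have el: "tensor_elem B C z = (?x, tensor_class B C ?x (Poly_Mapping.single z 1))"
          by (simp add: tensor_elem_def case_prod_unfold)
        show "tensor_elem B C z \<in> tensor_points B C"
          unfolding el by (rule tensor_pointsI[OF z(3)]) (use z in \<open>auto simp: mem_Times_iff\<close>)
        have FG: "bproj B' (F (fst z)) = h ?x" "bproj C' (G (snd z)) = h ?x"
          using fibrewise_linearD(1)[OF linF z(3,1)] fibrewise_linearD(1)[OF linG z(3,2)]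
          by (auto dest: fibreD)
        then show "?T (tensor_elem B C z) = tensor_elem B' C' (F (fst z), G (snd z))"
          unfolding el T[OF z(3)]
          by (simp add: free_map_single tensor_elem_def map_prod_def case_prod_unfold)
        from FG show "bproj B' (F (fst z)) = bproj C' (G (snd z))" by simp
      qed
      show "tensor_elem B C z \<in> points D" if "z \<in> points (fibre_product B C)" for z
        using el_pts[OF that] by (simp add: Dp)
      fix n U p assume p: "p \<in> plots (fibre_product B C) n U"
      then have p12: "(\<lambda>u. fst (p u)) \<in> plots (tot_space B) n U"
        "(\<lambda>u. snd (p u)) \<in> plots (tot_space C) n U"
        and eq: "\<And>u. u \<in> U \<Longrightarrow> bproj B (fst (p u)) = bproj C (snd (p u))"
        by (auto simp: fibre_product_plots)
      have in_fp: "p u \<in> points (fibre_product B C)" if "u \<in> U" for u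
        using that eq ranB[OF p12(1)] ranC[OF p12(2)] by (auto simp: fibre_product_points)
      have "(\<lambda>u. fst (tensor_elem B C (p u))) \<in> plots (base_space B) n U"
        using smooth_mapD(2)[OF proj p12(1)] by (simp add: tensor_elem_def case_prod_unfold)
      moreover have "(\<lambda>u. (F (fst (p u)), G (snd (p u)))) \<in> plots (fibre_product B' C') n U"
        unfolding fibre_product_plots
        using smooth_mapD(2)[OF F p12(1)] smooth_mapD(2)[OF G p12(2)] el_proj[OF in_fp] by simp
      from smooth_mapD(2)[OF elD' this]
      have "(\<lambda>u. ?T (tensor_elem B C (p u))) \<in> plots D' n U"
        by (rule d.plot_cong) (simp add: T_el[OF in_fp])
      ultimately show "(\<lambda>u. tensor_elem B C (p u)) \<in> plots D n U"
        unfolding Dplots using el_pts[OF in_fp] by auto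
    qed
    have "p \<in> plots D n U"
      using p bD elD Dp unfolding tensor_bundle_def tensor_with_simps by auto
    then show "(\<lambda>u. ?T (p u)) \<in> plots D' n U" unfolding Dplots by blast
  qed
qed

lemma tensor_local_plots: "local_plots (tot_space (tensor_bundle B C))"
  unfolding local_plots_def
proof (intro allI impI)
  fix n U p
  assume U: "openin (Euclidean_space n) U"
    and loc: "\<forall>u\<in>U. \<exists>W q. u \<in> W \<and> W \<subseteq> U \<and>
      q \<in> plots (tot_space (tensor_bundle B C)) n W \<and> (\<forall>w\<in>W. p w = q w)"
  have "p \<in> plots D n U"
    if D: "points D = tensor_points B C" "vector_pseudo_bundle (tensor_with B C D)"
      "smooth_map (fibre_product B C) D (tensor_elem B C)" for D
  proof -
    interpret D: diffeological_space D
      using vector_pseudo_bundle.tot_diffeological[OF D(2)] by (simp add: tensor_with_simps)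
    show ?thesis
    proof (rule local_plotsD[OF D.local_plots U])
      fix u assume "u \<in> U"
      obtain W q where W: "u \<in> W" "W \<subseteq> U" "\<forall>w\<in>W. p w = q w"
        and q: "q \<in> plots (tot_space (tensor_bundle B C)) n W"
        using bspec[OF loc \<open>u \<in> U\<close>] by (elim exE conjE) (rule that)
      have "q \<in> plots D n W" using q D by (auto simp: tensor_bundle_def tensor_with_simps)
      with W show "\<exists>W q. u \<in> W \<and> W \<subseteq> U \<and> q \<in> plots D n W \<and> (\<forall>w\<in>W. p w = q w)"
        by (intro exI conjI)
    qed
  qed
  then show "p \<in> plots (tot_space (tensor_bundle B C)) n U"
    by (auto simp: tensor_bundle_def tensor_with_simps)
qed

lemma fibrewise_linear_comp:
  assumes "fibrewise_linear B C Z h F" "fibrewise_linear C D Z' h' G" "\<And>x. x \<in> Z \<Longrightarrow> h x \<in> Z'"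
    and "\<And>x. x \<in> Z \<Longrightarrow> k x = h' (h x)"
  shows "fibrewise_linear B D Z k (\<lambda>v. G (F v))"
  unfolding fibrewise_linear_def
proof (intro ballI conjI allI)
  fix x v assume x: "x \<in> Z" and v: "v \<in> fibre B x"
  note F = fibrewise_linearD[OF assms(1) x v]
  note G = fibrewise_linearD[OF assms(2) assms(3)[OF x] F(1)]
  show "G (F v) \<in> fibre D (k x)" using G(1) assms(4)[OF x] by simp
  show "G (F (vadd B v w)) = vadd D (G (F v)) (G (F w))" if "w \<in> fibre B x" for w
    using F(2)[OF that] G(2)[OF fibrewise_linearD(1)[OF assms(1) x that]] by simp
  show "G (F (vscale B r v)) = vscale D r (G (F v))" for r
    using F(3) G(3) by simp
qed

lemma tensor_map_comp:
  assumes F: "fibrewise_linear B B' Z h F" and G: "fibrewise_linear B' B'' Z' h' G"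
    and x: "x \<in> Z" "h x \<in> Z'"
  shows "tensor_map B'' B'' h' G G (tensor_map B' B' h F F (x, tensor_class B B x u)) =
    (h' (h x), tensor_class B'' B'' (h' (h x)) (free_map (map_prod (\<lambda>v. G (F v)) (\<lambda>v. G (F v))) u))"
proof -
  have "map_prod G G \<circ> map_prod F F = map_prod (\<lambda>v. G (F v)) (\<lambda>v. G (F v))" by (rule ext) auto
  then show ?thesis
    by (simp only: tensor_map_class[OF F F x(1)] tensor_map_class[OF G G x(2)] free_map_comp)
qed

section \<open>Bilinear forms on finite-dimensional fibres\<close>

lemma dual_bundle_simps:
  "base_space (dual_bundle B) = base_space B" "bproj (dual_bundle B) = fst"
  "vadd (dual_bundle B) (x, l) (y, m) = (x, \<lambda>v. l v + m v)"
  "vscale (dual_bundle B) r (x, l) = (x, \<lambda>v. r * l v)"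
  "plots (tot_space (dual_bundle B)) = dual_plots B"
  by (simp_all add: dual_bundle_def)

lemma dual_points:
  "t \<in> points (tot_space (dual_bundle B)) \<longleftrightarrow>
    fst t \<in> points (base_space B) \<and> snd t \<in> dual_fibre B (fst t)"
  by (cases t) (auto simp: dual_bundle_def)

lemma fibre_dual:
  "t \<in> fibre (dual_bundle B) x \<longleftrightarrow>
    fst t = x \<and> x \<in> points (base_space B) \<and> snd t \<in> dual_fibre B x"
  by (cases t) (auto simp: fibre_def over_def dual_bundle_def)

lemma dual_fibreD:
  assumes "l \<in> dual_fibre B x"
  shows "v \<in> fibre B x \<Longrightarrow> w \<in> fibre B x \<Longrightarrow> l (vadd B v w) = l v + l w"
    and "v \<in> fibre B x \<Longrightarrow> l (vscale B r v) = r * l v"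
    and "v \<notin> fibre B x \<Longrightarrow> l v = 0"
  using assms by (auto simp: dual_fibre_def)

lemma dual_fibre_add:
  "l \<in> dual_fibre B x \<Longrightarrow> m \<in> dual_fibre B x \<Longrightarrow> (\<lambda>v. l v + m v) \<in> dual_fibre B x"
  unfolding dual_fibre_def by (auto intro: smooth_map_add_real simp: algebra_simps)

lemma dual_fibre_scale: "l \<in> dual_fibre B x \<Longrightarrow> (\<lambda>v. r * l v) \<in> dual_fibre B x"
  unfolding dual_fibre_def by (auto intro: smooth_map_cmult_real simp: algebra_simps)

lemma fibre_dual_add:
  "s \<in> fibre (dual_bundle B) x \<Longrightarrow> t \<in> fibre (dual_bundle B) x \<Longrightarrow>
    vadd (dual_bundle B) s t \<in> fibre (dual_bundle B) x"
  by (cases s; cases t) (auto simp: fibre_dual dual_bundle_simps dual_fibre_add)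

lemma fibre_dual_scale:
  "s \<in> fibre (dual_bundle B) x \<Longrightarrow> vscale (dual_bundle B) r s \<in> fibre (dual_bundle B) x"
  by (cases s) (auto simp: fibre_dual dual_bundle_simps dual_fibre_scale)

lemma (in vector_pseudo_bundle) dual_fibre_zero: "(\<lambda>_. 0) \<in> dual_fibre B x"
proof -
  interpret t: diffeological_space "tot_space B" by (rule tot_diffeological)
  have "smooth_map (subset_diffeology (tot_space B) (fibre B x)) real_diffeology (\<lambda>_. 0)"
    by (rule smooth_mapI)
      (auto simp: subset_diffeology_def real_diffeology_def Cinf_real_def
        intro: Ck_on_const t.plot_domain)
  then show ?thesis by (simp add: dual_fibre_def)
qed

lemma (in vector_pseudo_bundle) dual_fibre_sum:
  assumes "\<And>i. i \<in> I \<Longrightarrow> l i \<in> dual_fibre B x"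
  shows "(\<lambda>v. \<Sum>i\<in>I. r i * l i v) \<in> dual_fibre B x"
  using assms
proof (induction I rule: infinite_finite_induct)
  case (insert i I)
  have "(\<lambda>v. r i * l i v + (\<Sum>i\<in>I. r i * l i v)) \<in> dual_fibre B x"
    by (intro dual_fibre_add dual_fibre_scale insert.IH insert.prems) auto
  with insert.hyps show ?case by simp
qed (use dual_fibre_zero in auto)

text \<open>
  Over a finite set \<open>C\<close> on which its members are determined, a vector space of functions is
  spanned by finitely many of them with the values on \<open>C\<close> as coefficients; no basis has to be
  extracted from \<open>C\<close>, so the spanning functions may be dependent.
\<close>

lemma functions_determined_on_finite_set:
  fixes A :: "('v \<Rightarrow> real) set"
  assumes "finite C" and zero: "(\<lambda>_. 0) \<in> A"
    and add: "\<And>l m. l \<in> A \<Longrightarrow> m \<in> A \<Longrightarrow> (\<lambda>v. l v + m v) \<in> A"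
    and scale: "\<And>r l. l \<in> A \<Longrightarrow> (\<lambda>v. r * l v) \<in> A"
    and det: "\<And>l. l \<in> A \<Longrightarrow> (\<And>c. c \<in> C \<Longrightarrow> l c = 0) \<Longrightarrow> l = (\<lambda>_. 0)"
  obtains e where "\<And>c. c \<in> C \<Longrightarrow> e c \<in> A" "\<And>l v. l \<in> A \<Longrightarrow> l v = (\<Sum>c\<in>C. l c * e c v)"
proof -
  have "\<exists>e. (\<forall>c\<in>C. e c \<in> A) \<and> (\<forall>l\<in>A. \<forall>v. l v = (\<Sum>c\<in>C. l c * e c v))"
    using assms
  proof (induction C arbitrary: A rule: finite_induct)
    case empty
    have "l v = 0" if "l \<in> A" for l v
      using empty.prems(4)[OF that] by simp
    then show ?case by simp
  next
    case (insert c C)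
    note zero = insert.prems(1) and add = insert.prems(2) and scale = insert.prems(3)
    have lincomb: "(\<lambda>v. l v + r * m v) \<in> A" if "l \<in> A" "m \<in> A" for l m r
      using add[OF that(1) scale[OF that(2)]] .
    \<comment> \<open>The functions vanishing at \<open>c\<close> are determined on the smaller set. If there are others,
      one of them, \<open>b\<close>, normalised at \<open>c\<close>, splits off the value at \<open>c\<close>.\<close>
    define A' where "A' = {l \<in> A. l c = 0}"
    have "\<exists>e. (\<forall>d\<in>C. e d \<in> A') \<and> (\<forall>l\<in>A'. \<forall>v. l v = (\<Sum>d\<in>C. l d * e d v))"
    proof (rule insert.IH)
      show "(\<lambda>_. 0) \<in> A'" using zero by (simp add: A'_def)
      show "(\<lambda>v. l v + m v) \<in> A'" if "l \<in> A'" "m \<in> A'" for l m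
        using add[of l m] that by (simp add: A'_def)
      show "(\<lambda>v. r * l v) \<in> A'" if "l \<in> A'" for r l
        using scale[of l r] that by (simp add: A'_def)
      show "l = (\<lambda>_. 0)" if "l \<in> A'" "\<And>d. d \<in> C \<Longrightarrow> l d = 0" for l
        by (rule insert.prems(4)) (use that in \<open>auto simp: A'_def\<close>)
    qed
    then obtain e where e: "\<And>d. d \<in> C \<Longrightarrow> e d \<in> A'"
      "\<And>l v. l \<in> A' \<Longrightarrow> l v = (\<Sum>d\<in>C. l d * e d v)" by blast
    show ?case
    proof (cases "A' = A")
      case True
      let ?e = "e(c := \<lambda>_. 0)"
      have "\<forall>d\<in>insert c C. ?e d \<in> A" using e(1) zero True insert.hyps by auto
      moreover have "l v = (\<Sum>d\<in>insert c C. l d * ?e d v)" if "l \<in> A" for l v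
      proof -
        have "(\<Sum>d\<in>C. l d * ?e d v) = (\<Sum>d\<in>C. l d * e d v)"
          by (rule sum.cong) (use insert.hyps in auto)
        then show ?thesis using e(2)[of l v] that True insert.hyps by simp
      qed
      ultimately show ?thesis by blast
    next
      case False
      then obtain b' where b': "b' \<in> A" "b' c \<noteq> 0" unfolding A'_def by blast
      define b where "b = (\<lambda>v. (1 / b' c) * b' v)"
      have b: "b \<in> A" "b c = 1"
        using scale[OF b'(1), of "1 / b' c"] b'(2) unfolding b_def by simp_all
      let ?e = "e(c := \<lambda>v. b v + (-1) * (\<Sum>d\<in>C. b d * e d v))"
      have sumA: "(\<lambda>v. \<Sum>d\<in>D. b d * e d v) \<in> A" if "D \<subseteq> C" for D
        using finite_subset[OF that insert.hyps(1)] that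
      proof (induction D rule: finite_induct)
        case empty
        show ?case using zero by simp
      next
        case (insert d D)
        have "(\<lambda>v. (\<Sum>d\<in>D. b d * e d v) + b d * e d v) \<in> A"
          by (rule lincomb) (use insert e(1)[of d] in \<open>auto simp: A'_def\<close>)
        with insert.hyps show ?case by (simp add: add.commute)
      qed
      have "?e c \<in> A" using lincomb[OF b(1) sumA[OF subset_refl], of "-1"] by simp
      then have "\<forall>d\<in>insert c C. ?e d \<in> A" using e(1) by (auto simp: A'_def)
      moreover have "l v = (\<Sum>d\<in>insert c C. l d * ?e d v)" if l: "l \<in> A" for l v
      proof -
        have "(\<lambda>v. l v + (- l c) * b v) \<in> A'"
          unfolding A'_def using lincomb[OF l b(1), of "- l c"] b(2) by simp
        from e(2)[OF this, of v]
        have "l v - l c * b v = (\<Sum>d\<in>C. (l d - l c * b d) * e d v)" by simp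
        also have "\<dots> = (\<Sum>d\<in>C. l d * e d v) - l c * (\<Sum>d\<in>C. b d * e d v)"
          by (simp add: algebra_simps sum_subtractf sum_distrib_left)
        finally have "l v = l c * ?e c v + (\<Sum>d\<in>C. l d * e d v)" by (simp add: algebra_simps)
        moreover have "(\<Sum>d\<in>C. l d * ?e d v) = (\<Sum>d\<in>C. l d * e d v)"
          by (rule sum.cong) (use insert.hyps in auto)
        ultimately show ?thesis using insert.hyps by simp
      qed
      ultimately show ?thesis by blast
    qed
  qed
  then show ?thesis using that by blast
qed

context finite_dim_pseudo_bundle
begin

text \<open>The vectors on which a functional vanishes form a subspace of the fibre, so the functionals
  are determined on any finite set that spans the fibre.\<close>

lemma dual_fibre_expansion:
  assumes x: "x \<in> points (base_space B)"
  obtains C e where "finite C" "C \<subseteq> fibre B x" "\<And>c. c \<in> C \<Longrightarrow> e c \<in> dual_fibre B x"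
    "\<And>l v. l \<in> dual_fibre B x \<Longrightarrow> l v = (\<Sum>c\<in>C. l c * e c v)"
proof -
  interpret real_vector_space_on "fibre B x" "vadd B" "vscale B" "vzero B x"
    by (rule fibre_vector_space[OF x])
  obtain C where C: "finite C" "C \<subseteq> fibre B x" "fibre_subspace B x hull C = fibre B x"
    using fibre_finite_dim[OF x] by blast
  have det: "l = (\<lambda>_. 0)" if l: "l \<in> dual_fibre B x" and "\<And>c. c \<in> C \<Longrightarrow> l c = 0" for l
  proof -
    let ?K = "{v \<in> fibre B x. l v = 0}"
    have "l (vzero B x) = l (vadd B (vzero B x) (vzero B x))"
      by (simp add: add_zero zero_closed)
    then have "l (vzero B x) = 0" using dual_fibreD(1)[OF l zero_closed zero_closed] by simp
    then have "fibre_subspace B x ?K"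
      unfolding fibre_subspace_def
      using zero_closed add_closed scale_closed dual_fibreD(1,2)[OF l] by auto
    moreover have "C \<subseteq> ?K" using C(2) that(2) by blast
    ultimately have "fibre B x \<subseteq> ?K" using C(3) hull_minimal by metis
    then show ?thesis using dual_fibreD(3)[OF l] by (intro ext) blast
  qed
  obtain e where "\<And>c. c \<in> C \<Longrightarrow> e c \<in> dual_fibre B x"
    "\<And>l v. l \<in> dual_fibre B x \<Longrightarrow> l v = (\<Sum>c\<in>C. l c * e c v)"
    using functions_determined_on_finite_set[of C "dual_fibre B x", OF C(1) dual_fibre_zero
        dual_fibre_add dual_fibre_scale det] by blast
  with C that show ?thesis by blast
qed

text \<open>The linear combination of \<open>C\<close> with coefficients \<open>r\<close>, as it is seen by functionals; this
  avoids finite sums for the addition of a fibre.\<close>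

lemma fibre_linear_combination:
  assumes x: "x \<in> points (base_space B)" and "finite C" "C \<subseteq> fibre B x"
  shows "\<exists>v\<in>fibre B x. \<forall>l\<in>dual_fibre B x. l v = (\<Sum>c\<in>C. r c * l c)"
  using assms(2,3)
proof (induction C rule: finite_induct)
  case empty
  interpret real_vector_space_on "fibre B x" "vadd B" "vscale B" "vzero B x"
    by (rule fibre_vector_space[OF x])
  have "l (vscale B 0 (vzero B x)) = 0" if "l \<in> dual_fibre B x" for l
    using dual_fibreD(2)[OF that zero_closed] by simp
  then show ?case using scale_closed[OF zero_closed] by auto
next
  case (insert c C)
  interpret real_vector_space_on "fibre B x" "vadd B" "vscale B" "vzero B x"
    by (rule fibre_vector_space[OF x])
  obtain v where v: "v \<in> fibre B x" "\<forall>l\<in>dual_fibre B x. l v = (\<Sum>c\<in>C. r c * l c)"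
    using insert by blast
  have c: "c \<in> fibre B x" using insert.prems by blast
  have "l (vadd B (vscale B (r c) c) v) = (\<Sum>c\<in>insert c C. r c * l c)"
    if l: "l \<in> dual_fibre B x" for l
    using dual_fibreD(1)[OF l scale_closed[OF c] v(1)] dual_fibreD(2)[OF l c] v(2) l insert.hyps
    by simp
  then show ?case using add_closed[OF scale_closed[OF c] v(1)] by blast
qed

text \<open>Finite-dimensional reflexivity: \<open>\<phi>\<close> is evaluation at the combination of \<open>C\<close> whose
  coefficients are the values of \<open>\<phi>\<close> on the spanning functionals. The fibre may have vectors on which every smooth functional
  vanishes, so the representing vector is not unique.\<close>

lemma dual_fibre_reflexive:
  assumes x: "x \<in> points (base_space B)"
    and add: "\<And>l m. l \<in> dual_fibre B x \<Longrightarrow> m \<in> dual_fibre B x \<Longrightarrow> \<phi> (\<lambda>v. l v + m v) = \<phi> l + \<phi> m"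
    and scale: "\<And>r l. l \<in> dual_fibre B x \<Longrightarrow> \<phi> (\<lambda>v. r * l v) = r * \<phi> l"
  shows "\<exists>v\<in>fibre B x. \<forall>l\<in>dual_fibre B x. \<phi> l = (l v :: real)"
proof -
  obtain C e where C: "finite C" "C \<subseteq> fibre B x" "\<And>c. c \<in> C \<Longrightarrow> e c \<in> dual_fibre B x"
    and exp: "\<And>l v. l \<in> dual_fibre B x \<Longrightarrow> l v = (\<Sum>c\<in>C. l c * e c v)"
    using dual_fibre_expansion[OF x] by blast
  have phi0: "\<phi> (\<lambda>_. 0) = 0" using scale[OF dual_fibre_zero, of 0] by simp
  have phi_sum: "\<phi> (\<lambda>v. \<Sum>c\<in>D. r c * e c v) = (\<Sum>c\<in>D. r c * \<phi> (e c))" if "D \<subseteq> C" for D r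
    using finite_subset[OF that C(1)] that
  proof (induction D rule: finite_induct)
    case empty
    then show ?case using phi0 by simp
  next
    case (insert d D)
    have "\<phi> (\<lambda>v. r d * e d v + (\<Sum>c\<in>D. r c * e c v)) =
        r d * \<phi> (e d) + \<phi> (\<lambda>v. \<Sum>c\<in>D. r c * e c v)"
      by (subst add) (use insert.prems C(3) in \<open>auto intro!: dual_fibre_sum dual_fibre_scale scale\<close>)
    with insert show ?case by simp
  qed
  obtain v where v: "v \<in> fibre B x" "\<forall>l\<in>dual_fibre B x. l v = (\<Sum>c\<in>C. \<phi> (e c) * l c)"
    using fibre_linear_combination[OF x C(1,2), of "\<lambda>c. \<phi> (e c)"] by blast
  have "\<phi> l = l v" if l: "l \<in> dual_fibre B x" for l
  proof -
    have "\<phi> l = \<phi> (\<lambda>v. \<Sum>c\<in>C. l c * e c v)"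
      by (rule arg_cong[of _ _ \<phi>]) (rule ext, rule exp[OF l])
    also have "\<dots> = l v" using v(2) l phi_sum[OF subset_refl] by (simp add: mult.commute)
    finally show ?thesis .
  qed
  with v(1) show ?thesis by blast
qed

end

text \<open>The value on \<open>v\<close> and \<open>w\<close> of the bilinear form of a decomposable element \<open>l \<otimes> m\<close>.\<close>

abbreviation eval_pair :: "'v \<Rightarrow> 'v \<Rightarrow> ('x \<times> ('v \<Rightarrow> real)) \<times> ('x \<times> ('v \<Rightarrow> real)) \<Rightarrow> real" where
  "eval_pair v w k \<equiv> snd (fst k) v * snd (snd k) w"

lemma free_form_tensor_null:
  assumes "u \<in> tensor_null (dual_bundle B) (dual_bundle B) x"
  shows "free_form (eval_pair v w) u = 0"
proof -
  have "tensor_null (dual_bundle B) (dual_bundle B) x \<subseteq> {u. free_form (eval_pair v w) u = 0}"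
  proof (rule tensor_null_minimal)
    show "free.subspace {u. free_form (eval_pair v w) u = 0}"
      by (rule free.subspaceI; unfold mem_Collect_eq free_form_zero free_form_add free_form_scale;
          simp)
  qed (auto simp: free_form_diff free_form_add free_form_single fibre_dual dual_bundle_simps
      algebra_simps)
  with assms show ?thesis by blast
qed

lemma bilinear_form_class:
  "bilinear_form (y, tensor_class (dual_bundle B) (dual_bundle B) x u) v w =
    free_form (eval_pair v w) u"
proof -
  let ?cl = "tensor_class (dual_bundle B) (dual_bundle B) x u"
  define a where "a = (SOME a. a \<in> ?cl)"
  have "a \<in> ?cl" unfolding a_def by (rule someI[of _ u]) (rule tensor_class_self)
  then have "a - u \<in> tensor_null (dual_bundle B) (dual_bundle B) x" by (simp add: in_tensor_class_iff)
  from free_form_tensor_null[OF this, of v w]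
  have "free_form (eval_pair v w) a = free_form (eval_pair v w) u" by (simp add: free_form_diff)
  then show ?thesis
    by (simp add: bilinear_form_def a_def[symmetric] free_form_def case_prod_unfold mult.assoc)
qed

context finite_dim_pseudo_bundle
begin

text \<open>Applied below to \<open>L l = l \<otimes> m\<close> and \<open>L l = m \<otimes> l\<close>, which are linear modulo the bilinearity
  relations only.\<close>

lemma linear_modulo_subspace_sum:
  fixes L :: "('a \<Rightarrow> real) \<Rightarrow> ('c \<Rightarrow>\<^sub>0 real)"
  assumes N: "free.subspace N" and "finite C" and e: "\<And>c. c \<in> C \<Longrightarrow> e c \<in> dual_fibre B x"
    and add: "\<And>l m. l \<in> dual_fibre B x \<Longrightarrow> m \<in> dual_fibre B x \<Longrightarrow>
      L (\<lambda>v. l v + m v) - L l - L m \<in> N"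
    and scale: "\<And>r l. l \<in> dual_fibre B x \<Longrightarrow> L (\<lambda>v. r * l v) - free_scale r (L l) \<in> N"
  shows "L (\<lambda>v. \<Sum>c\<in>C. r c * e c v) - (\<Sum>c\<in>C. free_scale (r c) (L (e c))) \<in> N"
  using assms(2) e
proof (induction C rule: finite_induct)
  case empty
  have "L (\<lambda>_. 0) \<in> N"
    using scale[OF dual_fibre_zero, of 0] unfolding free.scale_zero_left by simp
  then show ?case by simp
next
  case (insert c C)
  let ?r = "\<lambda>v. \<Sum>c\<in>C. r c * e c v"
  have 1: "L (\<lambda>v. r c * e c v + ?r v) - L (\<lambda>v. r c * e c v) - L ?r \<in> N"
    by (rule add) (use insert.prems in \<open>auto intro!: dual_fibre_sum dual_fibre_scale\<close>)
  have 2: "L (\<lambda>v. r c * e c v) - free_scale (r c) (L (e c)) \<in> N"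
    by (rule scale) (use insert.prems in auto)
  have 3: "L ?r - (\<Sum>c\<in>C. free_scale (r c) (L (e c))) \<in> N"
    by (rule insert.IH) (use insert.prems in auto)
  from free.subspace_add[OF N free.subspace_add[OF N 1 2] 3] insert.hyps show ?case
    by (simp add: diff_diff_eq)
qed

lemma tensor_null_sum:
  assumes "finite C" and x: "x \<in> points (base_space B)"
    and e: "\<And>c. c \<in> C \<Longrightarrow> e c \<in> dual_fibre B x" and m: "m \<in> dual_fibre B x"
  shows "Poly_Mapping.single ((x, \<lambda>v. \<Sum>c\<in>C. r c * e c v), (x, m)) 1
      - (\<Sum>c\<in>C. Poly_Mapping.single ((x, e c), (x, m)) (r c))
      \<in> tensor_null (dual_bundle B) (dual_bundle B) x" (is "_ \<in> ?N")
    and "Poly_Mapping.single ((x, m), (x, \<lambda>v. \<Sum>c\<in>C. r c * e c v)) 1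
      - (\<Sum>c\<in>C. Poly_Mapping.single ((x, m), (x, e c)) (r c))
      \<in> tensor_null (dual_bundle B) (dual_bundle B) x"
proof -
  have f: "(x, l) \<in> fibre (dual_bundle B) x" if "l \<in> dual_fibre B x" for l
    using that x by (simp add: fibre_dual)
  note rel = tensor_null_relations[where B = "dual_bundle B" and C = "dual_bundle B" and x = x,
      OF f f]
  show "Poly_Mapping.single ((x, \<lambda>v. \<Sum>c\<in>C. r c * e c v), (x, m)) 1
      - (\<Sum>c\<in>C. Poly_Mapping.single ((x, e c), (x, m)) (r c)) \<in> ?N"
    using linear_modulo_subspace_sum[where e = e and r = r and
        L = "\<lambda>l. Poly_Mapping.single ((x, l), (x, m)) 1",
        OF tensor_null_subspace[of "dual_bundle B" "dual_bundle B" x] assms(1) e]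
      rel(1)[OF _ m f] rel(3)[OF _ m]
    by (simp add: free_scale_single dual_bundle_simps)
  show "Poly_Mapping.single ((x, m), (x, \<lambda>v. \<Sum>c\<in>C. r c * e c v)) 1
      - (\<Sum>c\<in>C. Poly_Mapping.single ((x, m), (x, e c)) (r c)) \<in> ?N"
    using linear_modulo_subspace_sum[where e = e and r = r and
        L = "\<lambda>l. Poly_Mapping.single ((x, m), (x, l)) 1",
        OF tensor_null_subspace[of "dual_bundle B" "dual_bundle B" x] assms(1) e]
      rel(2)[OF m _ f] rel(4)[OF m]
    by (simp add: free_scale_single dual_bundle_simps)
qed

text \<open>
  An element of the tensor square of the dual is determined by its bilinear form: expanding both
  factors as in \<open>dual_fibre_expansion\<close> makes it a combination of the \<open>e c \<otimes> e d\<close> whose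
  coefficients are the values of the form on the finite set \<open>C\<close>.
\<close>

lemma tensor_class_eqI_bilinear_form:
  assumes x: "x \<in> points (base_space B)"
    and u: "Poly_Mapping.keys u \<subseteq> fibre (dual_bundle B) x \<times> fibre (dual_bundle B) x"
    and u': "Poly_Mapping.keys u' \<subseteq> fibre (dual_bundle B) x \<times> fibre (dual_bundle B) x"
    and eq: "\<And>v w. v \<in> fibre B x \<Longrightarrow> w \<in> fibre B x \<Longrightarrow>
      free_form (eval_pair v w) u = free_form (eval_pair v w) u'"
  shows "tensor_class (dual_bundle B) (dual_bundle B) x u =
    tensor_class (dual_bundle B) (dual_bundle B) x u'"
proof -
  let ?N = "tensor_null (dual_bundle B) (dual_bundle B) x"
  note N = tensor_null_subspace[of "dual_bundle B" "dual_bundle B" x]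
  obtain C e where C: "finite C" "C \<subseteq> fibre B x" "\<And>c. c \<in> C \<Longrightarrow> e c \<in> dual_fibre B x"
    and exp: "\<And>l v. l \<in> dual_fibre B x \<Longrightarrow> l v = (\<Sum>c\<in>C. l c * e c v)"
    using dual_fibre_expansion[OF x] by blast
  \<comment> \<open>\<open>\<Phi>\<close> rebuilds an element from the values of its form on \<open>C\<close>; it is the identity modulo \<open>?N\<close>.\<close>
  define E where "E c d r = Poly_Mapping.single ((x, e c), (x, e d)) (r :: real)" for c d r
  define \<Phi> where "\<Phi> u = (\<Sum>c\<in>C. \<Sum>d\<in>C. E c d (free_form (eval_pair c d) u))"
    for u :: "('b \<times> ('a \<Rightarrow> real)) \<times> ('b \<times> ('a \<Rightarrow> real)) \<Rightarrow>\<^sub>0 real"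
  have \<Phi>_add: "\<Phi> (u + v) = \<Phi> u + \<Phi> v" for u v
    by (simp add: \<Phi>_def E_def free_form_add single_add sum.distrib)
  have \<Phi>_scale: "\<Phi> (free_scale r u) = free_scale r (\<Phi> u)" for r u
    unfolding \<Phi>_def free.scale_sum_right by (simp add: E_def free_form_scale free_scale_single)
  have gen: "Poly_Mapping.single k 1 - \<Phi> (Poly_Mapping.single k 1) \<in> ?N"
    if k: "k \<in> fibre (dual_bundle B) x \<times> fibre (dual_bundle B) x" for k
  proof -
    obtain l m where km: "k = ((x, l), (x, m))" "l \<in> dual_fibre B x" "m \<in> dual_fibre B x"
      using k by (cases k) (auto simp: fibre_dual)
    have lexp: "(\<lambda>v. \<Sum>c\<in>C. l c * e c v) = l" and mexp: "(\<lambda>v. \<Sum>c\<in>C. m c * e c v) = m"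
      using exp km by auto
    have 1: "Poly_Mapping.single k 1 - (\<Sum>c\<in>C. Poly_Mapping.single ((x, e c), (x, m)) (l c)) \<in> ?N"
      using tensor_null_sum(1)[where e = e and r = l, OF C(1) x C(3) km(3)] unfolding lexp km(1) .
    have "free_scale (l c) (Poly_Mapping.single ((x, e c), (x, m)) 1
        - (\<Sum>d\<in>C. E c d (m d))) \<in> ?N" if "c \<in> C" for c
      using tensor_null_sum(2)[where e = e and r = m, OF C(1) x C(3) C(3)[OF that]] unfolding mexp E_def
      by (rule free.subspace_scale[OF N])
    then have "Poly_Mapping.single ((x, e c), (x, m)) (l c) - (\<Sum>d\<in>C. E c d (l c * m d)) \<in> ?N"
      if "c \<in> C" for c
      using that by (simp add: free.scale_right_diff_distrib free.scale_sum_right free_scale_single E_def)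
    from free.subspace_sum[OF N this]
    have 2: "(\<Sum>c\<in>C. Poly_Mapping.single ((x, e c), (x, m)) (l c)) - \<Phi> (Poly_Mapping.single k 1) \<in> ?N"
      by (simp add: sum_subtractf \<Phi>_def free_form_single km(1))
    from free.subspace_add[OF N 1 2] show ?thesis by simp
  qed
  have all: "u - \<Phi> u \<in> ?N"
    if "Poly_Mapping.keys u \<subseteq> fibre (dual_bundle B) x \<times> fibre (dual_bundle B) x" for u
  proof -
    have *: "(\<Sum>k\<in>K. Poly_Mapping.single k (r k)) - \<Phi> (\<Sum>k\<in>K. Poly_Mapping.single k (r k)) \<in> ?N"
      if "finite K" "K \<subseteq> fibre (dual_bundle B) x \<times> fibre (dual_bundle B) x" for K r
      using that
    proof (induction K rule: finite_induct)
      case empty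
      have "\<Phi> 0 = 0" by (simp add: \<Phi>_def E_def free_form_zero)
      then show ?case using free.subspace_0[OF N] by simp
    next
      case (insert k K)
      have "free_scale (r k) (Poly_Mapping.single k 1 - \<Phi> (Poly_Mapping.single k 1)) \<in> ?N"
        by (rule free.subspace_scale[OF N gen]) (use insert.prems in auto)
      also have "free_scale (r k) (Poly_Mapping.single k 1 - \<Phi> (Poly_Mapping.single k 1)) =
          Poly_Mapping.single k (r k) - \<Phi> (Poly_Mapping.single k (r k))"
        by (simp add: free.scale_right_diff_distrib \<Phi>_scale[symmetric] free_scale_single)
      finally have "Poly_Mapping.single k (r k) - \<Phi> (Poly_Mapping.single k (r k)) \<in> ?N" .
      from free.subspace_add[OF N this insert.IH] insert show ?case
        by (simp add: \<Phi>_add algebra_simps)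
    qed
    have "(\<Sum>k\<in>Poly_Mapping.keys u. Poly_Mapping.single k (Poly_Mapping.lookup u k)) = u"
      by (rule poly_mapping_eqI) (simp add: lookup_sum lookup_single when_def sum.delta in_keys_iff)
    with *[OF finite_keys that, of "Poly_Mapping.lookup u"] show ?thesis by simp
  qed
  have "\<Phi> u = \<Phi> u'" unfolding \<Phi>_def 
    using eq[OF subsetD[OF C(2)] subsetD[OF C(2)]] by simp
  with free.subspace_diff[OF N all[OF u] all[OF u']] show ?thesis
    by (simp add: tensor_class_eq_iff)
qed

lemma bilinear_form_in_dual:
  assumes "Poly_Mapping.keys u \<subseteq> fibre (dual_bundle B) x \<times> fibre (dual_bundle B) x"
  shows "(\<lambda>w. free_form (eval_pair v w) u) \<in> dual_fibre B x"
proof -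
  have "(\<lambda>w. \<Sum>k\<in>Poly_Mapping.keys u. (Poly_Mapping.lookup u k * snd (fst k) v) * snd (snd k) w)
      \<in> dual_fibre B x"
    by (rule dual_fibre_sum) (use assms in \<open>auto simp: fibre_dual\<close>)
  then show ?thesis by (simp add: free_form_def mult.assoc)
qed

end

text \<open>As \<open>\<kappa>\<close> is linear on the subspace \<open>A\<close> only, the proof works with a linear map \<open>g\<close> of the whole
  function space that agrees with \<open>\<kappa>\<close> on the span of \<open>Z\<close>.\<close>

lemma dim_linear_image_on:
  fixes A :: "('v \<Rightarrow> real) set" and \<kappa> :: "('v \<Rightarrow> real) \<Rightarrow> ('w \<Rightarrow> real)"
  assumes A: "functional.subspace A" and Z: "Z \<subseteq> A" and inj: "inj_on \<kappa> A"
    and add: "\<And>l m. l \<in> A \<Longrightarrow> m \<in> A \<Longrightarrow> \<kappa> (l + m) = \<kappa> l + \<kappa> m"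
    and scale: "\<And>r l. l \<in> A \<Longrightarrow> \<kappa> (\<lambda>v. r * l v) = (\<lambda>w. r * \<kappa> l w)"
  shows "functional.dim (\<kappa> ` Z) = functional.dim Z"
proof -
  interpret vp: vector_space_pair "\<lambda>r (l::'v \<Rightarrow> real) v. r * l v" "\<lambda>r (l::'w \<Rightarrow> real) v. r * l v"
    by unfold_locales
  obtain b where b: "b \<subseteq> Z" "functional.independent b" "Z \<subseteq> functional.span b"
    "card b = functional.dim Z"
    using functional.basis_exists by blast
  obtain g where g: "Vector_Spaces.linear (\<lambda>r l v. r * l v) (\<lambda>r l v. r * l v) g"
    and gb: "\<forall>l\<in>b. g l = \<kappa> l"
    using vp.linear_independent_extend[OF b(2), of \<kappa>] by blast
  interpret g: Vector_Spaces.linear "\<lambda>r (l::'v \<Rightarrow> real) v. r * l v" "\<lambda>r (l::'w \<Rightarrow> real) v. r * l v" g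
    by (rule g)
  have span_A: "functional.span b \<subseteq> A"
    using b(1) Z by (intro functional.span_minimal[OF _ A]) blast
  have "functional.span b \<subseteq> {l \<in> A. g l = \<kappa> l}"
  proof (rule functional.span_minimal)
    show "b \<subseteq> {l \<in> A. g l = \<kappa> l}" using gb b(1) Z by blast
    have "\<kappa> 0 = 0" using scale[OF functional.subspace_0[OF A], of 0] by (simp add: zero_fun_def)
    then show "functional.subspace {l \<in> A. g l = \<kappa> l}"
      by (intro functional.subspaceI)
        (simp_all add: functional.subspace_0[OF A] functional.subspace_add[OF A]
          functional.subspace_scale[OF A] g.zero g.add g.scale add scale)
  qed
  then have gk: "g l = \<kappa> l" if "l \<in> functional.span b" for l using that by blast
  have inj_g: "inj_on g (functional.span b)"
    using inj_on_subset[OF inj span_A] gk by (simp add: inj_on_def)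
  have im: "\<kappa> ` Z = g ` Z" using b(3) gk by (intro image_cong) auto
  show ?thesis
    unfolding im
  proof (rule functional.dim_unique)
    show "g ` b \<subseteq> g ` Z" using b(1) by blast
    show "g ` Z \<subseteq> functional.span (g ` b)" using b(3) g.span_image by blast
    show "functional.independent (g ` b)" by (rule g.independent_injective_image[OF b(2) inj_g])
    show "card (g ` b) = functional.dim Z"
      using b(4) card_image inj_on_subset[OF inj_g functional.span_superset] by metis
  qed
qed

text \<open>
  Forms are transported by an arbitrary linear isomorphism \<open>k\<close> of the dual fibres. By reflexivity
  the vectors of the two fibres correspond to each other through \<open>k\<close>, up to vectors on which all
  functionals vanish, and under this correspondence the transported form takes the values of the
  original one. Symmetry, positivity and the rank are therefore preserved.
\<close>

lemma transported_form:
  assumes B: "finite_dim_pseudo_bundle B" and B': "finite_dim_pseudo_bundle B'"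
    and x: "x \<in> points (base_space B)" and x': "h x \<in> points (base_space B')"
    and bij: "bij_betw k (fibre (dual_bundle B) x) (fibre (dual_bundle B') (h x))"
    and lin: "fibrewise_linear (dual_bundle B) (dual_bundle B') {x} h k"
    and u: "Poly_Mapping.keys u \<subseteq> fibre (dual_bundle B) x \<times> fibre (dual_bundle B) x"
  defines "b \<equiv> \<lambda>v w. free_form (eval_pair v w) u"
    and "b' \<equiv> \<lambda>v w. free_form (eval_pair v w) (free_map (map_prod k k) u)"
  shows "(\<And>v w. v \<in> fibre B x \<Longrightarrow> w \<in> fibre B x \<Longrightarrow> b v w = b w v) \<Longrightarrow>
      v' \<in> fibre B' (h x) \<Longrightarrow> w' \<in> fibre B' (h x) \<Longrightarrow> b' v' w' = b' w' v'" (is "PROP ?sym")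
    and "(\<And>v. v \<in> fibre B x \<Longrightarrow> 0 \<le> b v v) \<Longrightarrow> v' \<in> fibre B' (h x) \<Longrightarrow> 0 \<le> b' v' v'" (is "PROP ?pos")
    and "form_rank (fibre B x) b = functional.dim (dual_fibre B x) \<Longrightarrow>
      form_rank (fibre B' (h x)) b' = functional.dim (dual_fibre B' (h x))" (is "PROP ?rank")
proof -
  interpret B: finite_dim_pseudo_bundle B by (rule B)
  interpret B': finite_dim_pseudo_bundle B' by (rule B')
  let ?A = "dual_fibre B x" and ?A' = "dual_fibre B' (h x)"
  define \<kappa> where "\<kappa> l = snd (k (x, l))" for l
  have Ax: "(x, l) \<in> fibre (dual_bundle B) x" if "l \<in> ?A" for l
    using that x by (simp add: fibre_dual)
  have k: "k (x, l) = (h x, \<kappa> l)" and \<kappa>_in: "\<kappa> l \<in> ?A'" if "l \<in> ?A" for l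
    using fibrewise_linearD(1)[OF lin _ Ax[OF that]] unfolding \<kappa>_def fibre_dual
    by (auto simp: prod_eq_iff)
  have \<kappa>_add: "\<kappa> (\<lambda>v. l v + m v) = (\<lambda>w. \<kappa> l w + \<kappa> m w)" if "l \<in> ?A" "m \<in> ?A" for l m
    using fibrewise_linearD(2)[OF lin _ Ax[OF that(1)] Ax[OF that(2)]] that k
    by (simp add: dual_bundle_simps dual_fibre_add)
  have \<kappa>_scale: "\<kappa> (\<lambda>v. r * l v) = (\<lambda>w. r * \<kappa> l w)" if "l \<in> ?A" for r l
    using fibrewise_linearD(3)[OF lin _ Ax[OF that], of r] that k
    by (simp add: dual_bundle_simps dual_fibre_scale)
  have \<kappa>_inj: "inj_on \<kappa> ?A"
  proof (rule inj_onI)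
    fix l m assume lm: "l \<in> ?A" "m \<in> ?A" "\<kappa> l = \<kappa> m"
    then have "k (x, l) = k (x, m)" by (simp add: k)
    with bij_betw_imp_inj_on[OF bij] Ax lm show "l = m" by (auto dest: inj_onD)
  qed
  have \<kappa>_im: "\<kappa> ` ?A = ?A'"
  proof
    show "\<kappa> ` ?A \<subseteq> ?A'" using \<kappa>_in by blast
    show "?A' \<subseteq> \<kappa> ` ?A"
    proof
      fix l' assume "l' \<in> ?A'"
      then have "(h x, l') \<in> fibre (dual_bundle B') (h x)" using x' by (simp add: fibre_dual)
      then obtain t where "t \<in> fibre (dual_bundle B) x" "k t = (h x, l')"
        using bij unfolding bij_betw_def by (metis imageE)
      then show "l' \<in> \<kappa> ` ?A" unfolding \<kappa>_def fibre_dual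
        by (intro image_eqI[of _ _ "snd t"]) (auto simp: prod_eq_iff)
    qed
  qed
  have A: "functional.subspace ?A"
    by (rule functional.subspaceI)
      (auto simp: plus_fun_def zero_fun_def intro: B.dual_fibre_zero dual_fibre_add dual_fibre_scale)
  let ?rel = "\<lambda>v v'. v \<in> fibre B x \<and> v' \<in> fibre B' (h x) \<and> (\<forall>l\<in>?A. \<kappa> l v' = l v)"
  have rel1: "\<exists>v. ?rel v v'" if "v' \<in> fibre B' (h x)" for v'
    using B.dual_fibre_reflexive[OF x, of "\<lambda>l. \<kappa> l v'"] that \<kappa>_add \<kappa>_scale by auto
  have rel2: "\<exists>v'. ?rel v v'" if v: "v \<in> fibre B x" for v
  proof -
    let ?i = "inv_into ?A \<kappa>"
    have i: "?i (\<kappa> l) = l" if "l \<in> ?A" for l by (rule inv_into_f_f[OF \<kappa>_inj that])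
    have "\<exists>v'\<in>fibre B' (h x). \<forall>l\<in>?A'. ?i l v = l v'"
    proof (rule B'.dual_fibre_reflexive[OF x'])
      fix l' m' assume "l' \<in> ?A'" "m' \<in> ?A'"
      then obtain l m where "l' = \<kappa> l" "m' = \<kappa> m" and lm: "l \<in> ?A" "m \<in> ?A"
        using \<kappa>_im by blast
      then show "?i (\<lambda>v. l' v + m' v) v = ?i l' v + ?i m' v"
        by (simp add: i \<kappa>_add[OF lm, symmetric] dual_fibre_add)
    next
      fix r l' assume "l' \<in> ?A'"
      then obtain l where "l' = \<kappa> l" and l: "l \<in> ?A" using \<kappa>_im by blast
      then show "?i (\<lambda>v. r * l' v) v = r * ?i l' v"
        by (simp add: i \<kappa>_scale[OF l, symmetric] dual_fibre_scale)
    qed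
    then show ?thesis using v \<kappa>_in i by metis
  qed
  have val: "b' v' w' = b v w" if "?rel v v'" "?rel w w'" for v v' w w'
    unfolding b'_def b_def free_form_map
  proof (rule free_form_cong)
    fix t assume "t \<in> Poly_Mapping.keys u"
    then have "t \<in> fibre (dual_bundle B) x \<times> fibre (dual_bundle B) x" using u by blast
    then obtain l m where "t = ((x, l), (x, m))" "l \<in> ?A" "m \<in> ?A"
      by (cases t) (auto simp: fibre_dual)
    with that show "eval_pair v' w' (map_prod k k t) = eval_pair v w t" by (simp add: k)
  qed
  show "PROP ?sym" using rel1 val by metis
  show "PROP ?pos" using rel1 val by metis
  have u': "Poly_Mapping.keys (free_map (map_prod k k) u) \<subseteq>
      fibre (dual_bundle B') (h x) \<times> fibre (dual_bundle B') (h x)"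
    by (rule free_map_keys_fibre[OF lin lin _ u]) simp
  have b_in: "b v \<in> ?A" and b'_in: "b' v' \<in> ?A'" for v v'
    unfolding b_def b'_def by (rule B.bilinear_form_in_dual[OF u] B'.bilinear_form_in_dual[OF u'])+
  have b'_\<kappa>: "b' v' = \<kappa> (b v)" if "?rel v v'" for v v'
  proof
    fix w'
    show "b' v' w' = \<kappa> (b v) w'"
    proof (cases "w' \<in> fibre B' (h x)")
      case True
      with rel1 obtain w where "?rel w w'" by blast
      with val[OF that this] b_in show ?thesis by simp
    next
      case False
      then show ?thesis using dual_fibreD(3)[OF b'_in] dual_fibreD(3)[OF \<kappa>_in[OF b_in]] by simp
    qed
  qed
  have "b' ` fibre B' (h x) = \<kappa> ` b ` fibre B x"
  proof (intro equalityI subsetI)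
    fix l assume "l \<in> b' ` fibre B' (h x)"
    then obtain v' where v': "v' \<in> fibre B' (h x)" "l = b' v'" by blast
    obtain v where "?rel v v'" using rel1[OF v'(1)] by blast
    with b'_\<kappa>[OF this] v' show "l \<in> \<kappa> ` b ` fibre B x" by auto
  next
    fix l assume "l \<in> \<kappa> ` b ` fibre B x"
    then obtain v where v: "v \<in> fibre B x" "l = \<kappa> (b v)" by blast
    obtain v' where "?rel v v'" using rel2[OF v(1)] by blast
    with b'_\<kappa>[OF this] v show "l \<in> b' ` fibre B' (h x)" by (intro image_eqI[of _ _ v']) auto
  qed
  moreover have dim: "functional.dim (\<kappa> ` Z) = functional.dim Z" if "Z \<subseteq> ?A" for Z
    by (rule dim_linear_image_on[OF A that \<kappa>_inj])
      (simp_all add: \<kappa>_add \<kappa>_scale plus_fun_def)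
  moreover have "functional.dim ?A' = functional.dim ?A"
    using dim[OF subset_refl] \<kappa>_im by simp
  ultimately show "PROP ?rank" using b_in by (simp add: form_rank_def image_subset_iff)
qed

lemma (in pseudo_metric) metric_rep:
  assumes x: "x \<in> points (base_space B)"
  obtains u where "g x = (x, tensor_class (dual_bundle B) (dual_bundle B) x u)"
    "Poly_Mapping.keys u \<subseteq> fibre (dual_bundle B) x \<times> fibre (dual_bundle B) x"
proof -
  have "g x \<in> tensor_points (dual_bundle B) (dual_bundle B)" "fst (g x) = x"
    using smooth_mapD(1)[OF metric_smooth x] metric_section[OF x]
    by (simp_all add: tensor_bundle_def tensor_with_simps)
  with that show ?thesis by (elim tensor_points_cases) auto
qed

lemma transported_metric:
  assumes g: "pseudo_metric B g" and B': "finite_dim_pseudo_bundle B'"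
    and x: "x \<in> points (base_space B)" and x': "h x \<in> points (base_space B')"
    and bij: "bij_betw k (fibre (dual_bundle B) x) (fibre (dual_bundle B') (h x))"
    and lin: "fibrewise_linear (dual_bundle B) (dual_bundle B') {x} h k"
    and t: "t = tensor_map (dual_bundle B') (dual_bundle B') h k k (g x)"
  shows "fst t = h x"
    and "v \<in> fibre B' (h x) \<Longrightarrow> w \<in> fibre B' (h x) \<Longrightarrow> bilinear_form t v w = bilinear_form t w v"
    and "v \<in> fibre B' (h x) \<Longrightarrow> 0 \<le> bilinear_form t v v"
    and "form_rank (fibre B' (h x)) (bilinear_form t) = functional.dim (dual_fibre B' (h x))"
proof -
  interpret pseudo_metric B g by (rule g)
  obtain u where u: "g x = (x, tensor_class (dual_bundle B) (dual_bundle B) x u)"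
    and keys: "Poly_Mapping.keys u \<subseteq> fibre (dual_bundle B) x \<times> fibre (dual_bundle B) x"
    using metric_rep[OF x] by blast
  let ?u = "free_map (map_prod k k) u"
  have t': "t = (h x, tensor_class (dual_bundle B') (dual_bundle B') (h x) ?u)"
    unfolding t u by (rule tensor_map_class[OF lin lin]) simp
  then show "fst t = h x" by simp
  have b: "bilinear_form (g x) = (\<lambda>v w. free_form (eval_pair v w) u)"
    unfolding u by (intro ext) (rule bilinear_form_class)
  have b': "bilinear_form t = (\<lambda>v w. free_form (eval_pair v w) ?u)"
    unfolding t' by (intro ext) (rule bilinear_form_class)
  note transported = transported_form[OF finite_dim_pseudo_bundle_axioms B' x x' bij lin keys]
  show "form_rank (fibre B' (h x)) (bilinear_form t) = functional.dim (dual_fibre B' (h x))"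
    unfolding b' by (rule transported(3)) (use metric_rank[OF x] b in simp)
  show "bilinear_form t v w = bilinear_form t w v" if "v \<in> fibre B' (h x)" "w \<in> fibre B' (h x)"
    unfolding b' by (rule transported(1)) (use metric_symmetric[OF x] b that in simp_all)
  show "0 \<le> bilinear_form t v v" if "v \<in> fibre B' (h x)"
    unfolding b' by (rule transported(2)) (use metric_nonneg[OF x] b that in simp_all)
qed

section \<open>Gluing of spaces\<close>

text \<open>Two points are identified by the gluing iff they have the same normal form, in which points
  of \<open>Y\<close> are moved to the second space; it is also the representative \<open>glue_rep\<close> of their class.\<close>

fun glue_nf :: "'a set \<Rightarrow> ('a \<Rightarrow> 'b) \<Rightarrow> 'a + 'b \<Rightarrow> 'a + 'b" where
  "glue_nf Y f (Inl a) = (if a \<in> Y then Inr (f a) else Inl a)"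
| "glue_nf Y f (Inr b) = Inr b"

abbreviation glue_class ::
  "'a diffeology \<Rightarrow> 'b diffeology \<Rightarrow> 'a set \<Rightarrow> ('a \<Rightarrow> 'b) \<Rightarrow> 'a + 'b \<Rightarrow> ('a + 'b) set" where
  "glue_class X1 X2 Y f z \<equiv> glue_rel X1 X2 Y f `` {z}"

lemma in_Plus_iff [simp]: "Inl a \<in> A <+> B \<longleftrightarrow> a \<in> A" "Inr b \<in> A <+> B \<longleftrightarrow> b \<in> B"
  by auto

lemma glue_rel_iff:
  "(z, z') \<in> glue_rel X1 X2 Y f \<longleftrightarrow>
    z \<in> points X1 <+> points X2 \<and> z' \<in> points X1 <+> points X2 \<and> glue_nf Y f z = glue_nf Y f z'"
proof -
  let ?r = "\<lambda>a b. \<exists>y\<in>Y. a = Inl y \<and> b = Inr (f y)"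
  have "glue_nf Y f z = glue_nf Y f z'" if "equivclp ?r z z'"
    using that by (induction rule: equivclp_induct) auto
  moreover have nf: "equivclp ?r z (glue_nf Y f z)" for z
  proof (cases z)
    case (Inl a)
    have "equivclp ?r (Inl a) (Inr (f a))" if "a \<in> Y"
      by (rule r_into_equivclp) (use that in blast)
    then show ?thesis using Inl by simp
  qed simp
  have "equivclp ?r z z'" if "glue_nf Y f z = glue_nf Y f z'"
    using equivclp_trans[OF nf[of z, unfolded that] equivclp_sym[OF nf[of z']]] .
  ultimately have "equivclp ?r z z' \<longleftrightarrow> glue_nf Y f z = glue_nf Y f z'" by (rule iffI)
  then show ?thesis by (simp add: glue_rel_def)
qed

lemma glue_class_iff:
  "z' \<in> glue_class X1 X2 Y f z \<longleftrightarrow>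
    z \<in> points X1 <+> points X2 \<and> z' \<in> points X1 <+> points X2 \<and> glue_nf Y f z' = glue_nf Y f z"
  by (auto simp: glue_rel_iff)

lemma glue_class_eq_iff:
  assumes "z \<in> points X1 <+> points X2" "z' \<in> points X1 <+> points X2"
  shows "glue_class X1 X2 Y f z = glue_class X1 X2 Y f z' \<longleftrightarrow> glue_nf Y f z = glue_nf Y f z'"
proof
  assume "glue_class X1 X2 Y f z = glue_class X1 X2 Y f z'"
  moreover have "z \<in> glue_class X1 X2 Y f z" using assms by (simp only: glue_class_iff)
  ultimately have "z \<in> glue_class X1 X2 Y f z'" by (rule subst)
  then show "glue_nf Y f z = glue_nf Y f z'" by (simp only: glue_class_iff)
next
  assume "glue_nf Y f z = glue_nf Y f z'"
  with assms show "glue_class X1 X2 Y f z = glue_class X1 X2 Y f z'"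
    by (intro set_eqI) (simp only: glue_class_iff)
qed

lemma glue_rep_class:
  assumes z: "z \<in> points X1 <+> points X2" and f: "f ` Y \<subseteq> points X2"
  shows "glue_rep (glue_class X1 X2 Y f z) = glue_nf Y f z"
proof (cases "glue_nf Y f z")
  case (Inr b)
  then have b: "b \<in> points X2" using z f by (cases z) (auto split: if_splits)
  then have "Inr b' \<in> glue_class X1 X2 Y f z \<longleftrightarrow> b' = b" for b'
    using z Inr by (auto simp: glue_rel_iff)
  then show ?thesis using Inr by (simp add: glue_rep_def)
next
  case (Inl a)
  then have a: "z = Inl a" "a \<notin> Y" by (cases z; auto split: if_splits)+
  then have "Inr b' \<notin> glue_class X1 X2 Y f z" "Inl a' \<in> glue_class X1 X2 Y f z \<longleftrightarrow> a' = a" for a' b'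
    using z by (auto simp: glue_rel_iff)
  then show ?thesis using Inl by (simp add: glue_rep_def)
qed

lemma glue_points:
  "c \<in> points (glue X1 X2 Y f) \<longleftrightarrow>
    (\<exists>z\<in>points X1 <+> points X2. c = glue_class X1 X2 Y f z)"
  by (auto simp: glue_def quotient_diffeology_def sum_diffeology_def quotient_def)

lemma glue_class_point:
  "z \<in> points X1 <+> points X2 \<Longrightarrow> glue_class X1 X2 Y f z \<in> points (glue X1 X2 Y f)"
  unfolding glue_points by blast

lemma glue_plotI:
  assumes "openin (Euclidean_space n) U"
    and "(\<exists>q\<in>plots X1 n U. \<forall>u\<in>U. p u = glue_class X1 X2 Y f (Inl (q u))) \<or>
      (\<exists>q\<in>plots X2 n U. \<forall>u\<in>U. p u = glue_class X1 X2 Y f (Inr (q u)))"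
  shows "p \<in> plots (glue X1 X2 Y f) n U"
proof -
  obtain q where "q \<in> plots (sum_diffeology X1 X2) n U" "\<forall>u\<in>U. p u = glue_class X1 X2 Y f (q u)"
    using assms(2)
  proof (elim disjE bexE)
    fix q assume "q \<in> plots X1 n U" "\<forall>u\<in>U. p u = glue_class X1 X2 Y f (Inl (q u))"
    then show thesis
      by (intro that[of "\<lambda>u. Inl (q u)"]) (auto simp: sum_diffeology_def assms(1))
  next
    fix q assume "q \<in> plots X2 n U" "\<forall>u\<in>U. p u = glue_class X1 X2 Y f (Inr (q u))"
    then show thesis
      by (intro that[of "\<lambda>u. Inr (q u)"]) (auto simp: sum_diffeology_def assms(1))
  qed
  then show ?thesis
    unfolding glue_def quotient_diffeology_def using assms(1) by auto
qed

lemma glue_plot_Inl: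
  assumes "openin (Euclidean_space n) U" "q \<in> plots X1 n U"
    and "\<And>u. u \<in> U \<Longrightarrow> p u = glue_class X1 X2 Y f (Inl (q u))"
  shows "p \<in> plots (glue X1 X2 Y f) n U"
  by (rule glue_plotI[OF assms(1)]) (use assms in blast)

lemma glue_plot_Inr:
  assumes "openin (Euclidean_space n) U" "q \<in> plots X2 n U"
    and "\<And>u. u \<in> U \<Longrightarrow> p u = glue_class X1 X2 Y f (Inr (q u))"
  shows "p \<in> plots (glue X1 X2 Y f) n U"
  by (rule glue_plotI[OF assms(1)]) (use assms in blast)

lemma glue_plot_cases:
  assumes "p \<in> plots (glue X1 X2 Y f) n U" "u \<in> U"
  obtains W q where "u \<in> W" "W \<subseteq> U" "q \<in> plots X1 n W"
      "\<And>w. w \<in> W \<Longrightarrow> p w = glue_class X1 X2 Y f (Inl (q w))"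
    | W q where "u \<in> W" "W \<subseteq> U" "q \<in> plots X2 n W"
      "\<And>w. w \<in> W \<Longrightarrow> p w = glue_class X1 X2 Y f (Inr (q w))"
proof -
  obtain W q where W: "u \<in> W" "W \<subseteq> U" "q \<in> plots (sum_diffeology X1 X2) n W"
    and p: "\<forall>w\<in>W. p w = glue_class X1 X2 Y f (q w)"
    using assms unfolding glue_def quotient_diffeology_def by auto
  obtain W' where W': "u \<in> W'" "W' \<subseteq> W"
    and q: "(\<exists>q'\<in>plots X1 n W'. \<forall>w\<in>W'. q w = Inl (q' w)) \<or>
      (\<exists>q'\<in>plots X2 n W'. \<forall>w\<in>W'. q w = Inr (q' w))"
  proof -
    have "\<forall>u\<in>W. \<exists>W'. u \<in> W' \<and> W' \<subseteq> W \<and> ((\<exists>q'\<in>plots X1 n W'. \<forall>w\<in>W'. q w = Inl (q' w)) \<or>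
        (\<exists>q'\<in>plots X2 n W'. \<forall>w\<in>W'. q w = Inr (q' w)))"
      using W(3) by (simp add: sum_diffeology_def)
    from bspec[OF this W(1)] show thesis by (elim exE conjE) (rule that)
  qed
  have p': "p w = glue_class X1 X2 Y f (q w)" if "w \<in> W'" for w using p W'(2) that by blast
  have W'U: "W' \<subseteq> U" using W(2) W'(2) by blast
  from q show ?thesis
    by (elim disjE bexE) (rule that(1)[OF W'(1) W'U] that(2)[OF W'(1) W'U]; simp add: p')+
qed

lemma glue_plots_open: "p \<in> plots (glue X1 X2 Y f) n U \<Longrightarrow> openin (Euclidean_space n) U"
  by (simp add: glue_def quotient_diffeology_def)

text \<open>A plot of the gluing lifts locally to a plot of one of the two parts.\<close>

lemma smooth_map_from_glue:
  assumes Z: "local_plots Z"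
    and h1: "smooth_map X1 Z (\<lambda>a. h (glue_class X1 X2 Y f (Inl a)))"
    and h2: "smooth_map X2 Z (\<lambda>b. h (glue_class X1 X2 Y f (Inr b)))"
  shows "smooth_map (glue X1 X2 Y f) Z h"
proof (rule smooth_mapI)
  fix c assume "c \<in> points (glue X1 X2 Y f)"
  then show "h c \<in> points Z"
    unfolding glue_points using smooth_mapD(1)[OF h1] smooth_mapD(1)[OF h2] by auto
next
  fix n U p assume p: "p \<in> plots (glue X1 X2 Y f) n U"
  show "(\<lambda>u. h (p u)) \<in> plots Z n U"
  proof (rule local_plotsD[OF Z glue_plots_open[OF p]])
    fix u assume "u \<in> U"
    with p show "\<exists>W q. u \<in> W \<and> W \<subseteq> U \<and> q \<in> plots Z n W \<and> (\<forall>w\<in>W. h (p w) = q w)"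
    proof (cases rule: glue_plot_cases)
      case (1 W q)
      then show ?thesis
        using smooth_mapD(2)[OF h1 1(3)]
        by (intro exI[of _ W] exI[of _ "\<lambda>w. h (glue_class X1 X2 Y f (Inl (q w)))"]) simp
    next
      case (2 W q)
      then show ?thesis
        using smooth_mapD(2)[OF h2 2(3)]
        by (intro exI[of _ W] exI[of _ "\<lambda>w. h (glue_class X1 X2 Y f (Inr (q w)))"]) simp
    qed
  qed
qed

lemma glue_Inl_smooth:
  assumes "\<And>n U q. q \<in> plots X1 n U \<Longrightarrow> openin (Euclidean_space n) U"
  shows "smooth_map X1 (glue X1 X2 Y f) (\<lambda>a. glue_class X1 X2 Y f (Inl a))"
  by (rule smooth_mapI) (auto intro: glue_class_point glue_plot_Inl assms)

lemma glue_Inr_smooth: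
  assumes "\<And>n U q. q \<in> plots X2 n U \<Longrightarrow> openin (Euclidean_space n) U"
  shows "smooth_map X2 (glue X1 X2 Y f) (\<lambda>b. glue_class X1 X2 Y f (Inr b))"
  by (rule smooth_mapI) (auto intro: glue_class_point glue_plot_Inr assms)

lemma glue_plots_iff:
  assumes X1: "diffeological_space X1" and X2: "diffeological_space X2"
  shows "p \<in> plots (glue X1 X2 Y f) n U \<longleftrightarrow> openin (Euclidean_space n) U \<and>
    (\<forall>u\<in>U. \<exists>W q. u \<in> W \<and> W \<subseteq> U \<and>
      q \<in> (\<lambda>q w. glue_class X1 X2 Y f (Inl (q w))) ` plots X1 n W \<union>
        (\<lambda>q w. glue_class X1 X2 Y f (Inr (q w))) ` plots X2 n W \<and>
      (\<forall>w\<in>W. p w = q w))"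
    (is "?l \<longleftrightarrow> ?r")
proof
  assume p: ?l
  have "\<exists>W q. u \<in> W \<and> W \<subseteq> U \<and>
      q \<in> (\<lambda>q w. glue_class X1 X2 Y f (Inl (q w))) ` plots X1 n W \<union>
        (\<lambda>q w. glue_class X1 X2 Y f (Inr (q w))) ` plots X2 n W \<and>
      (\<forall>w\<in>W. p w = q w)" if "u \<in> U" for u
    using p that
  proof (cases rule: glue_plot_cases)
    case (1 W q)
    then show ?thesis
      by (intro exI[of _ W] exI[of _ "\<lambda>w. glue_class X1 X2 Y f (Inl (q w))"]) blast
  next
    case (2 W q)
    then show ?thesis
      by (intro exI[of _ W] exI[of _ "\<lambda>w. glue_class X1 X2 Y f (Inr (q w))"]) blast
  qed
  then show ?r using glue_plots_open[OF p] by blast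
next
  assume r: ?r
  have "\<exists>W. u \<in> W \<and> W \<subseteq> U \<and> (\<exists>q\<in>plots (sum_diffeology X1 X2) n W.
      \<forall>w\<in>W. p w = glue_class X1 X2 Y f (q w))" if "u \<in> U" for u
  proof -
    obtain W q where W: "u \<in> W" "W \<subseteq> U" "\<forall>w\<in>W. p w = q w"
      and q: "q \<in> (\<lambda>q w. glue_class X1 X2 Y f (Inl (q w))) ` plots X1 n W \<union>
        (\<lambda>q w. glue_class X1 X2 Y f (Inr (q w))) ` plots X2 n W"
      using bspec[OF conjunct2[OF r] \<open>u \<in> U\<close>] by (elim exE conjE) (rule that)
    from q obtain q' where "q' \<in> plots (sum_diffeology X1 X2) n W"
      "\<And>w. q w = glue_class X1 X2 Y f (q' w)"
    proof (elim UnE imageE)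
      fix q' assume q': "q' \<in> plots X1 n W" "q = (\<lambda>w. glue_class X1 X2 Y f (Inl (q' w)))"
      then have "(\<lambda>w. Inl (q' w)) \<in> plots (sum_diffeology X1 X2) n W"
        using diffeological_space.plot_domain[OF X1 q'(1)] by (auto simp: sum_diffeology_def)
      from that[OF this] q'(2) show thesis by simp
    next
      fix q' assume q': "q' \<in> plots X2 n W" "q = (\<lambda>w. glue_class X1 X2 Y f (Inr (q' w)))"
      then have "(\<lambda>w. Inr (q' w)) \<in> plots (sum_diffeology X1 X2) n W"
        using diffeological_space.plot_domain[OF X2 q'(1)] by (auto simp: sum_diffeology_def)
      from that[OF this] q'(2) show thesis by simp
    qed
    with W show ?thesis by (intro exI[of _ W]) auto
  qed
  with r show ?l unfolding glue_def quotient_diffeology_def by simp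
qed

lemma glue_diffeological_space:
  assumes X1: "diffeological_space X1" and X2: "diffeological_space X2"
  shows "diffeological_space (glue X1 X2 Y f)"
proof (rule diffeological_space_locally[where P = "\<lambda>n W.
    (\<lambda>q w. glue_class X1 X2 Y f (Inl (q w))) ` plots X1 n W \<union>
    (\<lambda>q w. glue_class X1 X2 Y f (Inr (q w))) ` plots X2 n W"])
  interpret X1: diffeological_space X1 by (rule X1)
  interpret X2: diffeological_space X2 by (rule X2)
  let ?P = "\<lambda>n W. (\<lambda>q w. glue_class X1 X2 Y f (Inl (q w))) ` plots X1 n W \<union>
    (\<lambda>q w. glue_class X1 X2 Y f (Inr (q w))) ` plots X2 n W"
  fix n
  show "p \<in> plots (glue X1 X2 Y f) n U \<longleftrightarrow> openin (Euclidean_space n) U \<and>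
      (\<forall>u\<in>U. \<exists>W q. u \<in> W \<and> W \<subseteq> U \<and> q \<in> ?P n W \<and> (\<forall>w\<in>W. p w = q w))" for U p
    by (rule glue_plots_iff[OF X1 X2])
  fix W q assume "q \<in> ?P n W"
  then consider q1 where "q1 \<in> plots X1 n W" "q = (\<lambda>w. glue_class X1 X2 Y f (Inl (q1 w)))"
    | q2 where "q2 \<in> plots X2 n W" "q = (\<lambda>w. glue_class X1 X2 Y f (Inr (q2 w)))" by blast
  note q = this
  from q show "openin (Euclidean_space n) W"
    by cases (auto dest: X1.plot_domain X2.plot_domain)
  from q show "q ` W \<subseteq> points (glue X1 X2 Y f)"
    by cases (auto dest: X1.plot_range X2.plot_range intro!: glue_class_point)
  fix m V h assume V: "openin (Euclidean_space m) V" "Cinf m V n h" "h ` V \<subseteq> W"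
  from q show "(\<lambda>v. q (h v)) \<in> ?P m V"
  proof cases
    case 1
    then show ?thesis using X1.plot_compose[OF 1(1) V] by (auto simp: comp_def)
  next
    case 2
    then show ?thesis using X2.plot_compose[OF 2(1) V] by (auto simp: comp_def)
  qed
next
  fix n U c assume U: "openin (Euclidean_space n) U" and "c \<in> points (glue X1 X2 Y f)"
  then obtain z where "z \<in> points X1 <+> points X2" "c = glue_class X1 X2 Y f z"
    unfolding glue_points by blast
  then show "(\<lambda>_. c) \<in> (\<lambda>q w. glue_class X1 X2 Y f (Inl (q w))) ` plots X1 n U \<union>
      (\<lambda>q w. glue_class X1 X2 Y f (Inr (q w))) ` plots X2 n U"
    using diffeological_space.plot_const[OF X1 U] diffeological_space.plot_const[OF X2 U] by auto
qed

lemma inj_switch_map: "inj_on switch_map S"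
proof -
  have "inj (case_sum Inr Inl :: 'a + 'b \<Rightarrow> 'b + 'a)"
    by (rule injI) (auto split: sum.splits)
  then show ?thesis by (simp add: inj_on_def switch_map_def inj_image_eq_iff)
qed

text \<open>Injectivity of \<open>f\<close> makes the gluing along \<open>f\<close> and the one along its inverse identify the same
  points, although their normal forms differ: one prefers \<open>X2\<close>, the other \<open>X1\<close>.\<close>

lemma switch_map_class:
  assumes f: "f ` Y \<subseteq> points X2" and inj: "inj_on f Y" and z: "z \<in> points X1 <+> points X2"
  shows "switch_map (glue_class X1 X2 Y f z) =
    glue_class X2 X1 (f ` Y) (inv_into Y f) (case_sum Inr Inl z)"
proof -
  have nf: "glue_nf (f ` Y) (inv_into Y f) (case_sum Inr Inl a) =
      glue_nf (f ` Y) (inv_into Y f) (case_sum Inr Inl b) \<longleftrightarrow> glue_nf Y f a = glue_nf Y f b" for a b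
  proof -
    have inv: "inv_into Y f (f x) = x" if "x \<in> Y" for x by (rule inv_into_f_f[OF inj that])
    have mixed: "(x \<in> Y \<and> f x = b) \<longleftrightarrow> (b \<in> f ` Y \<and> x = inv_into Y f b)" for x b
    proof
      assume "b \<in> f ` Y \<and> x = inv_into Y f b"
      then show "x \<in> Y \<and> f x = b" by (simp add: inv_into_into f_inv_into_f)
    qed (auto simp: inv)
    show ?thesis
    proof (cases a; cases b)
      fix x y assume "a = Inl x" "b = Inl y"
      then show ?thesis by (auto simp: inj_on_eq_iff[OF inj])
    next
      fix x y assume ab: "a = Inr x" "b = Inr y"
      have "inv_into Y f x = inv_into Y f y \<longleftrightarrow> x = y" if "x \<in> f ` Y" "y \<in> f ` Y"
        by (rule inj_on_eq_iff[OF inj_on_inv_into[OF subset_refl] that])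
      with ab show ?thesis by (auto simp del: image_iff)
    next
      fix x y assume "a = Inl x" "b = Inr y"
      with mixed[of x y] show ?thesis by (auto simp del: image_iff)
    next
      fix x y assume "a = Inr x" "b = Inl y"
      with mixed[of y x] show ?thesis by (auto simp del: image_iff)
    qed
  qed
  have sw: "case_sum Inr Inl a \<in> points X2 <+> points X1 \<longleftrightarrow> a \<in> points X1 <+> points X2" for a
    by (cases a) auto
  have sw2: "case_sum Inr Inl (case_sum Inr Inl b) = b" for b :: "'c + 'd"
    by (cases b) auto
  show ?thesis
  proof (intro set_eqI iffI)
    fix w assume "w \<in> switch_map (glue_class X1 X2 Y f z)"
    then obtain a where "(z, a) \<in> glue_rel X1 X2 Y f" "w = case_sum Inr Inl a"
      unfolding switch_map_def by auto
    then show "w \<in> glue_class X2 X1 (f ` Y) (inv_into Y f) (case_sum Inr Inl z)"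
      by (simp add: glue_rel_iff sw nf)
  next
    fix w assume w: "w \<in> glue_class X2 X1 (f ` Y) (inv_into Y f) (case_sum Inr Inl z)"
    define a where "a = case_sum Inr Inl w"
    have wa: "w = case_sum Inr Inl a" unfolding a_def by (rule sw2[symmetric])
    from w have "(z, a) \<in> glue_rel X1 X2 Y f" unfolding wa by (simp add: glue_rel_iff sw nf)
    then show "w \<in> switch_map (glue_class X1 X2 Y f z)"
      unfolding switch_map_def wa by blast
  qed
qed

section \<open>Gluing of pseudo-bundles\<close>

lemma real_vector_space_on_image:
  assumes S: "real_vector_space_on S p sc z"
    and j: "\<And>v w. v \<in> S \<Longrightarrow> w \<in> S \<Longrightarrow> p' (j v) (j w) = j (p v w)"
      "\<And>r v. v \<in> S \<Longrightarrow> sc' r (j v) = j (sc r v)" "z' = j z"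
  shows "real_vector_space_on (j ` S) p' sc' z'"
proof -
  interpret real_vector_space_on S p sc z by (rule S)
  show ?thesis
  proof (rule real_vector_space_on.intro; (elim imageE)?; (hypsubst)?)
    fix v assume v: "v \<in> S"
    then obtain w where "w \<in> S" "p v w = z" using add_inverse by blast
    then show "\<exists>w\<in>j ` S. p' (j v) w = z'" using j v by auto
  next
    fix v w assume "v \<in> S" "w \<in> S"
    then show "p' (j v) (j w) = p' (j w) (j v)" using add_commute[of v w] by (simp add: j)
  qed (simp_all add: j zero_closed add_closed scale_closed add_assoc add_zero scale_add_right
      scale_add_left scale_scale scale_one imageI)
qed

text \<open>
  The assumptions are the algebraic part of a gluing, without any smoothness: they hold for a
  gluing of pseudo-bundles as well as for the reversed gluing of their duals.
\<close>

locale bundle_gluing =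
  fixes B1 :: "('v, 'a) bundle_data" and B2 :: "('w, 'b) bundle_data"
    and Y :: "'a set" and f :: "'a \<Rightarrow> 'b" and F :: "'v \<Rightarrow> 'w"
  assumes Y_base: "Y \<subseteq> points (base_space B1)"
    and f_base: "f ` Y \<subseteq> points (base_space B2)"
    and f_inj: "inj_on f Y"
    and F_linear: "fibrewise_linear B1 B2 Y f F"
    and proj1: "v \<in> points (tot_space B1) \<Longrightarrow> bproj B1 v \<in> points (base_space B1)"
    and proj2: "w \<in> points (tot_space B2) \<Longrightarrow> bproj B2 w \<in> points (base_space B2)"
    and add1: "v \<in> fibre B1 x \<Longrightarrow> v' \<in> fibre B1 x \<Longrightarrow> vadd B1 v v' \<in> fibre B1 x"
    and add2: "w \<in> fibre B2 y \<Longrightarrow> w' \<in> fibre B2 y \<Longrightarrow> vadd B2 w w' \<in> fibre B2 y"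
    and scale1: "v \<in> fibre B1 x \<Longrightarrow> vscale B1 r v \<in> fibre B1 x"
    and scale2: "w \<in> fibre B2 y \<Longrightarrow> vscale B2 r w \<in> fibre B2 y"
begin

abbreviation "G \<equiv> glue_bundle B1 B2 Y f F"
abbreviation "base_class \<equiv> glue_class (base_space B1) (base_space B2) Y f"
abbreviation "tot_class \<equiv> glue_class (tot_space B1) (tot_space B2) (over B1 Y) F"
abbreviation "base_pts \<equiv> points (base_space B1) <+> points (base_space B2)"
abbreviation "tot_pts \<equiv> points (tot_space B1) <+> points (tot_space B2)"

lemma G_simps:
  "tot_space G = glue (tot_space B1) (tot_space B2) (over B1 Y) F"
  "base_space G = glue (base_space B1) (base_space B2) Y f"
  by (simp_all add: glue_bundle_def Let_def)

lemma in_over_iff: "v \<in> fibre B1 x \<Longrightarrow> v \<in> over B1 Y \<longleftrightarrow> x \<in> Y"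
  by (auto simp: fibre_def over_def)

lemma F_fibre: "v \<in> fibre B1 x \<Longrightarrow> x \<in> Y \<Longrightarrow> F v \<in> fibre B2 (f x)"
  using fibrewise_linearD(1)[OF F_linear] .

lemma F_over: "v \<in> over B1 Y \<Longrightarrow> F v \<in> fibre B2 (f (bproj B1 v))"
  using F_fibre[OF fibreI] by (simp add: over_def)

lemma F_tot: "F ` over B1 Y \<subseteq> points (tot_space B2)"
proof
  fix w assume "w \<in> F ` over B1 Y"
  then obtain v where "v \<in> over B1 Y" "w = F v" by blast
  then show "w \<in> points (tot_space B2)" using fibreD(1)[OF F_over] by simp
qed

lemma over_tot: "v \<in> over B1 Y \<Longrightarrow> v \<in> points (tot_space B1)"
  by (simp add: over_def)

lemma tot_rep: "z \<in> tot_pts \<Longrightarrow> glue_rep (tot_class z) = glue_nf (over B1 Y) F z"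
  by (rule glue_rep_class[OF _ F_tot])

lemma base_rep: "z \<in> base_pts \<Longrightarrow> glue_rep (base_class z) = glue_nf Y f z"
  by (rule glue_rep_class[OF _ f_base])

lemma tot_class_over: "v \<in> over B1 Y \<Longrightarrow> tot_class (Inl v) = tot_class (Inr (F v))"
  using F_tot over_tot by (subst glue_class_eq_iff) auto

lemma base_class_glued: "y \<in> Y \<Longrightarrow> base_class (Inl y) = base_class (Inr (f y))"
  using f_base Y_base by (subst glue_class_eq_iff) auto

lemma base_class_eqD:
  assumes "base_class z = base_class z'" "z \<in> base_pts" "z' \<in> base_pts"
  shows "glue_nf Y f z = glue_nf Y f z'"
  using glue_class_eq_iff[OF assms(2,3)] assms(1) by blast

text \<open>The operations of the glued pseudo-bundle are defined at the normal form of a class. They may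
  be computed at any representative, because \<open>F\<close> covers \<open>f\<close> and is linear on the fibres over \<open>Y\<close>.\<close>

lemma bproj_class:
  assumes z: "z \<in> tot_pts"
  shows "bproj G (tot_class z) = base_class (map_sum (bproj B1) (bproj B2) z)"
proof -
  have "bproj G (tot_class z) =
      base_class (map_sum (bproj B1) (bproj B2) (glue_nf (over B1 Y) F z))"
    using tot_rep[OF z] by (simp add: glue_bundle_def Let_def)
  also have "\<dots> = base_class (map_sum (bproj B1) (bproj B2) z)"
  proof (cases z)
    case (Inl v)
    show ?thesis
    proof (cases "v \<in> over B1 Y")
      case True
      then have "bproj B1 v \<in> Y" "bproj B2 (F v) = f (bproj B1 v)"
        using fibreD(2)[OF F_over] by (auto simp: over_def)
      then show ?thesis using True Inl base_class_glued by simp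
    qed (simp add: Inl)
  qed simp
  finally show ?thesis .
qed

lemma add_Inr:
  assumes "v \<in> fibre B2 x" "w \<in> fibre B2 x"
  shows "vadd G (tot_class (Inr v)) (tot_class (Inr w)) = tot_class (Inr (vadd B2 v w))"
  using tot_rep[of "Inr v"] tot_rep[of "Inr w"] fibreD(1)[OF assms(1)] fibreD(1)[OF assms(2)]
  by (simp add: glue_bundle_def Let_def)

lemma scale_Inr:
  assumes "v \<in> fibre B2 x"
  shows "vscale G r (tot_class (Inr v)) = tot_class (Inr (vscale B2 r v))"
  using tot_rep[of "Inr v"] fibreD(1)[OF assms] by (simp add: glue_bundle_def Let_def)

lemma add_Inl:
  assumes v: "v \<in> fibre B1 x" and w: "w \<in> fibre B1 x"
  shows "vadd G (tot_class (Inl v)) (tot_class (Inl w)) = tot_class (Inl (vadd B1 v w))"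
proof (cases "x \<in> Y")
  case True
  then have "v \<in> over B1 Y" "w \<in> over B1 Y" "vadd B1 v w \<in> over B1 Y"
    using in_over_iff add1 v w by blast+
  then show ?thesis
    using add_Inr[OF F_fibre[OF v True] F_fibre[OF w True]] fibrewise_linearD(2)[OF F_linear True v w]
    by (simp add: tot_class_over)
next
  case False
  then have "v \<notin> over B1 Y" "w \<notin> over B1 Y" using in_over_iff v w by blast+
  then show ?thesis
    using tot_rep[of "Inl v"] tot_rep[of "Inl w"] fibreD(1)[OF v] fibreD(1)[OF w]
    by (simp add: glue_bundle_def Let_def)
qed

lemma scale_Inl:
  assumes v: "v \<in> fibre B1 x"
  shows "vscale G r (tot_class (Inl v)) = tot_class (Inl (vscale B1 r v))"
proof (cases "x \<in> Y")
  case True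
  then have "v \<in> over B1 Y" "vscale B1 r v \<in> over B1 Y"
    using in_over_iff scale1 v by blast+
  then show ?thesis
    using scale_Inr[OF F_fibre[OF v True]] fibrewise_linearD(3)[OF F_linear True v]
    by (simp add: tot_class_over)
next
  case False
  then have "v \<notin> over B1 Y" using in_over_iff v by blast
  then show ?thesis
    using tot_rep[of "Inl v"] fibreD(1)[OF v] by (simp add: glue_bundle_def Let_def)
qed

lemma base_of:
  assumes "c \<in> fibre G d"
  shows "d \<in> points (base_space G)"
proof -
  obtain z where z: "z \<in> tot_pts" "c = tot_class z"
    using fibreD(1)[OF assms] unfolding G_simps glue_points by blast
  have "map_sum (bproj B1) (bproj B2) z \<in> base_pts"
    using z(1) proj1 proj2 by auto
  with fibreD(2)[OF assms] bproj_class[OF z(1)] z(2) show ?thesis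
    unfolding G_simps by (metis glue_class_point)
qed

lemma tot_class_points: "z \<in> tot_pts \<Longrightarrow> tot_class z \<in> points (tot_space G)"
  by (simp add: G_simps glue_class_point)

lemma Inl_fibre:
  assumes "v \<in> fibre B1 x"
  shows "tot_class (Inl v) \<in> fibre G (base_class (Inl x))"
  using assms tot_class_points[of "Inl v"] bproj_class[of "Inl v"] fibreD[OF assms]
  by (auto simp: fibre_def[of G] over_def[of G])

lemma Inr_fibre:
  assumes "v \<in> fibre B2 x"
  shows "tot_class (Inr v) \<in> fibre G (base_class (Inr x))"
  using assms tot_class_points[of "Inr v"] bproj_class[of "Inr v"] fibreD[OF assms]
  by (auto simp: fibre_def[of G] over_def[of G])

lemma Inl_linear:
  "fibrewise_linear B1 G Z (\<lambda>x. base_class (Inl x)) (\<lambda>v. tot_class (Inl v))"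
  unfolding fibrewise_linear_def using Inl_fibre add_Inl scale_Inl by simp

lemma Inr_linear:
  "fibrewise_linear B2 G Z (\<lambda>x. base_class (Inr x)) (\<lambda>v. tot_class (Inr v))"
  unfolding fibrewise_linear_def using Inr_fibre add_Inr scale_Inr by simp

lemma fibre_cases:
  assumes "c \<in> fibre G (base_class z)" "z \<in> base_pts"
  obtains v where "v \<in> points (tot_space B1)" "c = tot_class (Inl v)"
      "glue_nf Y f (Inl (bproj B1 v)) = glue_nf Y f z"
    | v where "v \<in> points (tot_space B2)" "c = tot_class (Inr v)"
      "glue_nf Y f (Inr (bproj B2 v)) = glue_nf Y f z"
proof -
  obtain s where s: "s \<in> tot_pts" "c = tot_class s"
    using fibreD(1)[OF assms(1)] unfolding G_simps glue_points by blast
  have "base_class (map_sum (bproj B1) (bproj B2) s) = base_class z"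
    using fibreD(2)[OF assms(1)] bproj_class[OF s(1)] s(2) by simp
  moreover have "map_sum (bproj B1) (bproj B2) s \<in> base_pts"
    using s(1) proj1 proj2 by auto
  ultimately have "glue_nf Y f (map_sum (bproj B1) (bproj B2) s) = glue_nf Y f z"
    by (simp only: glue_class_eq_iff assms(2))
  with s that show ?thesis by (cases s) auto
qed

lemma fibre_Inr:
  assumes x: "x \<in> points (base_space B2)"
  shows "fibre G (base_class (Inr x)) = (\<lambda>v. tot_class (Inr v)) ` fibre B2 x"
proof (intro equalityI subsetI)
  fix c assume c: "c \<in> fibre G (base_class (Inr x))"
  have "Inr x \<in> base_pts" using x by simp
  with c show "c \<in> (\<lambda>v. tot_class (Inr v)) ` fibre B2 x"
  proof (cases rule: fibre_cases)
    case (1 v)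
    then have v: "bproj B1 v \<in> Y" "f (bproj B1 v) = x" by (auto split: if_splits)
    then have "v \<in> over B1 Y" using 1(1) by (simp add: over_def)
    then show ?thesis using 1(2) v F_over tot_class_over by auto
  next
    case (2 v)
    then have "v \<in> fibre B2 x" using fibreI[OF 2(1)] by simp
    with 2 show ?thesis by blast
  qed
qed (use Inr_fibre in blast)

lemma fibre_Inl:
  assumes x: "x \<in> points (base_space B1)" "x \<notin> Y"
  shows "fibre G (base_class (Inl x)) = (\<lambda>v. tot_class (Inl v)) ` fibre B1 x"
proof (intro equalityI subsetI)
  fix c assume c: "c \<in> fibre G (base_class (Inl x))"
  have "Inl x \<in> base_pts" using x by simp
  with c show "c \<in> (\<lambda>v. tot_class (Inl v)) ` fibre B1 x"
  proof (cases rule: fibre_cases)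
    case (1 v)
    then have "bproj B1 v = x" using x(2) by (auto split: if_splits)
    then have "v \<in> fibre B1 x" using fibreI[OF 1(1)] by simp
    with 1 show ?thesis by blast
  qed (use x in auto)
qed (use Inl_fibre in blast)

lemma Inr_inj: "inj_on (\<lambda>v. tot_class (Inr v)) (points (tot_space B2))"
  by (rule inj_onI) (simp add: glue_class_eq_iff)

lemma Inl_inj: "x \<notin> Y \<Longrightarrow> inj_on (\<lambda>v. tot_class (Inl v)) (fibre B1 x)"
proof (rule inj_onI)
  fix v w assume "x \<notin> Y" and v: "v \<in> fibre B1 x" and w: "w \<in> fibre B1 x"
    and eq: "tot_class (Inl v) = tot_class (Inl w)"
  then have "v \<notin> over B1 Y" "w \<notin> over B1 Y" using in_over_iff by blast+
  moreover have "glue_nf (over B1 Y) F (Inl v) = glue_nf (over B1 Y) F (Inl w)"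
    using eq fibreD(1)[OF v] fibreD(1)[OF w] by (subst (asm) glue_class_eq_iff) auto
  ultimately show "v = w" by simp
qed

text \<open>The two cases are disjoint, and in each of them the fibre is known from \<open>fibre_Inl\<close> or
  \<open>fibre_Inr\<close>.\<close>

lemma base_point_cases:
  assumes "c \<in> points (base_space G)"
  obtains x where "x \<in> points (base_space B1)" "x \<notin> Y" "c = base_class (Inl x)"
    | x where "x \<in> points (base_space B2)" "c = base_class (Inr x)"
proof -
  obtain z where z: "z \<in> base_pts" "c = base_class z"
    using assms unfolding G_simps glue_points by blast
  show ?thesis
  proof (cases z)
    case (Inl x)
    then show ?thesis using z that base_class_glued f_base by (cases "x \<in> Y") auto
  qed (use z that in auto)
qed

end

lemma fibre_subspaceI:
  assumes "S \<subseteq> fibre B x" "vzero B x \<in> S"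
    and "\<And>v w. v \<in> S \<Longrightarrow> w \<in> S \<Longrightarrow> vadd B v w \<in> S" "\<And>r v. v \<in> S \<Longrightarrow> vscale B r v \<in> S"
  shows "fibre_subspace B x S"
  unfolding fibre_subspace_def using assms by simp

text \<open>Subspaces pull back to subspaces along \<open>j\<close>, so the image of a spanning set spans.\<close>

lemma finite_dim_fibre_image:
  assumes fin: "finite C" "C \<subseteq> fibre B x" "fibre_subspace B x hull C = fibre B x"
    and vs: "real_vector_space_on (fibre B x) (vadd B) (vscale B) (vzero B x)"
    and im: "fibre B' x' = j ` fibre B x"
    and j: "\<And>v w. v \<in> fibre B x \<Longrightarrow> w \<in> fibre B x \<Longrightarrow> vadd B' (j v) (j w) = j (vadd B v w)"
      "\<And>r v. v \<in> fibre B x \<Longrightarrow> vscale B' r (j v) = j (vscale B r v)" "vzero B' x' = j (vzero B x)"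
  shows "\<exists>C. finite C \<and> C \<subseteq> fibre B' x' \<and> fibre_subspace B' x' hull C = fibre B' x'"
proof (intro exI conjI)
  interpret real_vector_space_on "fibre B x" "vadd B" "vscale B" "vzero B x" by (rule vs)
  show "finite (j ` C)" using fin(1) by simp
  show "j ` C \<subseteq> fibre B' x'" using fin(2) im by blast
  show "fibre_subspace B' x' hull j ` C = fibre B' x'"
  proof (rule hull_unique)
    show "j ` C \<subseteq> fibre B' x'" using fin(2) im by blast
    show "fibre_subspace B' x' (fibre B' x')"
    proof (intro fibre_subspaceI subset_refl)
      show "vzero B' x' \<in> fibre B' x'" unfolding im j(3) using zero_closed by (rule imageI)
    next
      fix s t assume "s \<in> fibre B' x'" "t \<in> fibre B' x'"
      then obtain v w where "v \<in> fibre B x" "s = j v" "w \<in> fibre B x" "t = j w"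
        unfolding im by blast
      then show "vadd B' s t \<in> fibre B' x'" unfolding im using j(1) add_closed by simp
    next
      fix r s assume "s \<in> fibre B' x'"
      then obtain v where "v \<in> fibre B x" "s = j v" unfolding im by blast
      then show "vscale B' r s \<in> fibre B' x'" unfolding im using j(2) scale_closed by simp
    qed
    fix T assume T: "j ` C \<subseteq> T" "fibre_subspace B' x' T"
    let ?K = "{v \<in> fibre B x. j v \<in> T}"
    have T_ops: "vzero B' x' \<in> T" "\<And>s t. s \<in> T \<Longrightarrow> t \<in> T \<Longrightarrow> vadd B' s t \<in> T"
      "\<And>r s. s \<in> T \<Longrightarrow> vscale B' r s \<in> T"
      using T(2) unfolding fibre_subspace_def by simp_all
    have "fibre_subspace B x ?K"
    proof (rule fibre_subspaceI)
      show "vzero B x \<in> ?K" using zero_closed T_ops(1) j(3) by simp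
      show "vadd B v w \<in> ?K" if "v \<in> ?K" "w \<in> ?K" for v w
        using T_ops(2)[of "j v" "j w"] j(1)[of v w] add_closed that by simp
      show "vscale B r v \<in> ?K" if "v \<in> ?K" for r v
        using T_ops(3)[of "j v" r] j(2)[of v r] scale_closed that by simp
    qed simp
    moreover have "C \<subseteq> ?K" using T(1) fin(2) by blast
    ultimately have "fibre B x \<subseteq> ?K" using fin(3) hull_minimal by metis
    then show "fibre B' x' \<subseteq> T" unfolding im by blast
  qed
qed

lemma gluing_dataD:
  assumes "gluing_data B1 B2 Y f F"
  shows "Y \<subseteq> points (base_space B1)" "f ` Y \<subseteq> points (base_space B2)" "inj_on f Y"
    "fibrewise_linear B1 B2 Y f F"
    "\<And>n U q. q \<in> plots (tot_space B1) n U \<Longrightarrow> q ` U \<subseteq> over B1 Y \<Longrightarrow>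
      (\<lambda>u. F (q u)) \<in> plots (tot_space B2) n U"
proof -
  note g = assms[unfolded gluing_data_def]
  show "Y \<subseteq> points (base_space B1)" "f ` Y \<subseteq> points (base_space B2)" "fibrewise_linear B1 B2 Y f F"
    using g by auto
  from g have "inj_on f (points (base_space B1) \<inter> Y)"
    by (auto simp: diffeomorphism_def bij_betw_def subset_diffeology_def)
  moreover have "points (base_space B1) \<inter> Y = Y" using g by blast
  ultimately show "inj_on f Y" by simp
  fix n U q assume "q \<in> plots (tot_space B1) n U" "q ` U \<subseteq> over B1 Y"
  then have "q \<in> plots (subset_diffeology (tot_space B1) (over B1 Y)) n U"
    by (simp add: subset_diffeology_def)
  with g have "(\<lambda>u. F (q u)) \<in> plots (subset_diffeology (tot_space B2) (over B2 (f ` Y))) n U"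
    by (elim conjE) (rule smooth_mapD(2))
  then show "(\<lambda>u. F (q u)) \<in> plots (tot_space B2) n U" by (simp add: subset_diffeology_def)
qed

lemma (in vector_pseudo_bundle) fibre_closed:
  shows "v \<in> fibre B x \<Longrightarrow> w \<in> fibre B x \<Longrightarrow> vadd B v w \<in> fibre B x"
    and "v \<in> fibre B x \<Longrightarrow> vscale B r v \<in> fibre B x"
    and "v \<in> points (tot_space B) \<Longrightarrow> bproj B v \<in> points (base_space B)"
proof -
  show p: "v \<in> points (tot_space B) \<Longrightarrow> bproj B v \<in> points (base_space B)" for v
    using proj_surj by blast
  have x: "x \<in> points (base_space B)" if "v \<in> fibre B x" for v
    using p[OF fibreD(1)[OF that]] fibreD(2)[OF that] by simp
  show "v \<in> fibre B x \<Longrightarrow> w \<in> fibre B x \<Longrightarrow> vadd B v w \<in> fibre B x"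
    using real_vector_space_on.add_closed[OF fibre_vector_space[OF x]] .
  show "v \<in> fibre B x \<Longrightarrow> vscale B r v \<in> fibre B x"
    using real_vector_space_on.scale_closed[OF fibre_vector_space[OF x]] .
qed

lemma bundle_gluing_of_gluing_data:
  assumes "vector_pseudo_bundle B1" "vector_pseudo_bundle B2" "gluing_data B1 B2 Y f F"
  shows "bundle_gluing B1 B2 Y f F"
  using gluing_dataD[OF assms(3)] vector_pseudo_bundle.fibre_closed[OF assms(1)]
    vector_pseudo_bundle.fibre_closed[OF assms(2)]
  by (intro bundle_gluing.intro) auto

text \<open>
  Fibrewise, the glued pseudo-bundle is one of the given ones. Projection, zero section and scalar
  multiplication involve one plot at a time and are smooth because they are so on each part;
  addition takes two plots, which may come from different parts.
\<close>

lemma glue_bundle_finite_dim: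
  assumes B1: "finite_dim_pseudo_bundle B1" and B2: "finite_dim_pseudo_bundle B2"
    and gl: "gluing_data B1 B2 Y f F"
  shows "finite_dim_pseudo_bundle (glue_bundle B1 B2 Y f F)"
proof -
  interpret B1: finite_dim_pseudo_bundle B1 by (rule B1)
  interpret B2: finite_dim_pseudo_bundle B2 by (rule B2)
  interpret bundle_gluing B1 B2 Y f F
    by (rule bundle_gluing_of_gluing_data[OF B1.vector_pseudo_bundle_axioms
          B2.vector_pseudo_bundle_axioms gl])
  note F_smooth = gluing_dataD(5)[OF gl]
  interpret t1: diffeological_space "tot_space B1" by (rule B1.tot_diffeological)
  interpret t2: diffeological_space "tot_space B2" by (rule B2.tot_diffeological)
  interpret b1: diffeological_space "base_space B1" by (rule B1.base_diffeological)
  interpret b2: diffeological_space "base_space B2" by (rule B2.base_diffeological)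
  have totG: "diffeological_space (tot_space G)"
    unfolding G_simps by (rule glue_diffeological_space[OF B1.tot_diffeological B2.tot_diffeological])
  interpret tG: diffeological_space "tot_space G" by (rule totG)
  have baseG: "diffeological_space (base_space G)"
    unfolding G_simps by (rule glue_diffeological_space[OF B1.base_diffeological B2.base_diffeological])
  interpret bG: diffeological_space "base_space G" by (rule baseG)
  have base_Inl: "smooth_map (base_space B1) (base_space G) (\<lambda>x. base_class (Inl x))"
    unfolding G_simps by (rule glue_Inl_smooth[OF b1.plot_domain])
  have base_Inr: "smooth_map (base_space B2) (base_space G) (\<lambda>x. base_class (Inr x))"
    unfolding G_simps by (rule glue_Inr_smooth[OF b2.plot_domain])
  have tot_Inl: "smooth_map (tot_space B1) (tot_space G) (\<lambda>v. tot_class (Inl v))"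
    unfolding G_simps by (rule glue_Inl_smooth[OF t1.plot_domain])
  have tot_Inr: "smooth_map (tot_space B2) (tot_space G) (\<lambda>v. tot_class (Inr v))"
    unfolding G_simps by (rule glue_Inr_smooth[OF t2.plot_domain])
  \<comment> \<open>\<open>F\<close> is additive, so the image of zero is idempotent, and only zero is.\<close>
  have F_zero: "F (vzero B1 y) = vzero B2 (f y)" if y: "y \<in> Y" for y
  proof -
    interpret v1: real_vector_space_on "fibre B1 y" "vadd B1" "vscale B1" "vzero B1 y"
      by (rule B1.fibre_vector_space) (use Y_base y in blast)
    interpret v2: real_vector_space_on "fibre B2 (f y)" "vadd B2" "vscale B2" "vzero B2 (f y)"
      by (rule B2.fibre_vector_space) (use f_base y in blast)
    let ?z = "F (vzero B1 y)"
    have z: "?z \<in> fibre B2 (f y)" using F_fibre[OF v1.zero_closed y] .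
    have "vadd B2 ?z ?z = ?z"
      using fibrewise_linearD(2)[OF F_linear y v1.zero_closed v1.zero_closed]
        v1.add_zero[OF v1.zero_closed] by simp
    moreover obtain w where w: "w \<in> fibre B2 (f y)" "vadd B2 ?z w = vzero B2 (f y)"
      using v2.add_inverse[OF z] by blast
    ultimately have "vadd B2 ?z (vzero B2 (f y)) = vzero B2 (f y)"
      using v2.add_assoc[OF z z w(1)] by simp
    then show ?thesis
      using v2.add_zero[OF z] v2.add_commute[OF z v2.zero_closed] by simp
  qed
  have zero1: "vzero B1 x \<in> fibre B1 x" if "x \<in> points (base_space B1)" for x
    using real_vector_space_on.zero_closed[OF B1.fibre_vector_space[OF that]] .
  have zero2: "vzero B2 x \<in> fibre B2 x" if "x \<in> points (base_space B2)" for x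
    using real_vector_space_on.zero_closed[OF B2.fibre_vector_space[OF that]] .
  have vzero_Inl: "vzero G (base_class (Inl x)) = tot_class (Inl (vzero B1 x))"
    if x: "x \<in> points (base_space B1)" for x
  proof -
    have "vzero G (base_class (Inl x)) = tot_class (map_sum (vzero B1) (vzero B2) (glue_nf Y f (Inl x)))"
      using base_rep[of "Inl x"] x by (simp add: glue_bundle_def Let_def)
    moreover have "vzero B1 x \<in> over B1 Y" if "x \<in> Y" using in_over_iff[OF zero1[OF x]] that by blast
    ultimately show ?thesis using F_zero by (cases "x \<in> Y") (simp_all add: tot_class_over)
  qed
  have vzero_Inr: "vzero G (base_class (Inr x)) = tot_class (Inr (vzero B2 x))"
    if x: "x \<in> points (base_space B2)" for x
    using base_rep[of "Inr x"] x by (simp add: glue_bundle_def Let_def)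
  have "vector_pseudo_bundle G"
  proof (rule vector_pseudo_bundle.intro)
    show "diffeological_space (tot_space G)" "diffeological_space (base_space G)"
      by (rule totG baseG)+
    show "smooth_map (tot_space G) (base_space G) (bproj G)"
      unfolding G_simps(1)
    proof (rule smooth_map_from_glue[OF bG.local_plots])
      show "smooth_map (tot_space B1) (base_space G) (\<lambda>v. bproj G (tot_class (Inl v)))"
        by (rule smooth_map_cong[OF B1.tot_diffeological bG.local_plots
              smooth_map_comp[OF B1.proj_smooth base_Inl]]) (simp add: bproj_class)
      show "smooth_map (tot_space B2) (base_space G) (\<lambda>v. bproj G (tot_class (Inr v)))"
        by (rule smooth_map_cong[OF B2.tot_diffeological bG.local_plots
              smooth_map_comp[OF B2.proj_smooth base_Inr]]) (simp add: bproj_class)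
    qed
    show "bproj G ` points (tot_space G) = points (base_space G)"
    proof (intro equalityI subsetI)
      fix c assume "c \<in> bproj G ` points (tot_space G)"
      then obtain t where t: "t \<in> points (tot_space G)" "c = bproj G t" by (rule imageE) (rule that)
      show "c \<in> points (base_space G)" unfolding t(2) by (rule base_of[OF fibreI[OF t(1)]])
    next
      fix c assume "c \<in> points (base_space G)"
      then have ex: "\<exists>t. t \<in> fibre G c"
      proof (cases rule: base_point_cases)
        case (1 x)
        then show ?thesis using Inl_fibre[OF zero1] by blast
      next
        case (2 x)
        then show ?thesis using Inr_fibre[OF zero2] by blast
      qed
      from ex obtain t where t: "t \<in> fibre G c" by (rule exE)
      show "c \<in> bproj G ` points (tot_space G)"
        by (rule image_eqI[of _ "bproj G" t, OF fibreD(2)[OF t, symmetric] fibreD(1)[OF t]])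
    qed
    show "real_vector_space_on (fibre G c) (vadd G) (vscale G) (vzero G c)"
      if "c \<in> points (base_space G)" for c
      using that
    proof (cases rule: base_point_cases)
      case (1 x)
      show ?thesis
        unfolding 1(3) fibre_Inl[OF 1(1,2)]
        by (rule real_vector_space_on_image[OF B1.fibre_vector_space[OF 1(1)]])
          (simp_all add: add_Inl scale_Inl vzero_Inl 1)
    next
      case (2 x)
      show ?thesis
        unfolding 2(2) fibre_Inr[OF 2(1)]
        by (rule real_vector_space_on_image[OF B2.fibre_vector_space[OF 2(1)]])
          (simp_all add: add_Inr scale_Inr vzero_Inr 2)
    qed
    have add_RR: "(\<lambda>w. vadd G (s w) (t w)) \<in> plots (tot_space G) n W"
      if q: "q \<in> plots (tot_space B2) n W" "q' \<in> plots (tot_space B2) n W"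
        and s: "\<And>w. w \<in> W \<Longrightarrow> s w = tot_class (Inr (q w))"
        and t: "\<And>w. w \<in> W \<Longrightarrow> t w = tot_class (Inr (q' w))"
        and eq: "\<And>w. w \<in> W \<Longrightarrow> bproj G (s w) = bproj G (t w)" for n W s t q q'
    proof -
      have pts: "q w \<in> points (tot_space B2)" "q' w \<in> points (tot_space B2)" if "w \<in> W" for w
        using that t2.plot_range[OF q(1)] t2.plot_range[OF q(2)] by auto
      have base_eq: "base_class (Inr (bproj B2 (q w))) = base_class (Inr (bproj B2 (q' w)))"
        if "w \<in> W" for w
        using eq[OF that] pts[OF that] by (simp add: s[OF that] t[OF that] bproj_class)
      have proj: "bproj B2 (q w) = bproj B2 (q' w)" if "w \<in> W" for w
        using base_class_eqD[OF base_eq[OF that]] proj2[OF pts(1)[OF that]] proj2[OF pts(2)[OF that]]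
        by simp
      have "(\<lambda>w. (q w, q' w)) \<in> plots (fibre_product B2 B2) n W"
        using q proj by (simp add: fibre_product_plots)
      from smooth_mapD(2)[OF B2.add_smooth this]
      have "(\<lambda>w. vadd B2 (q w) (q' w)) \<in> plots (tot_space B2) n W" by simp
      then show ?thesis
        unfolding G_simps
      proof (rule glue_plot_Inr[OF t2.plot_domain[OF q(1)]])
        fix w assume w: "w \<in> W"
        show "vadd G (s w) (t w) = tot_class (Inr (vadd B2 (q w) (q' w)))"
          unfolding s[OF w] t[OF w]
          by (rule add_Inr[OF fibreI[OF pts(1)[OF w]]]) (simp add: proj[OF w] fibreI[OF pts(2)[OF w]])
      qed
    qed
    have add_LL: "(\<lambda>w. vadd G (s w) (t w)) \<in> plots (tot_space G) n W"
      if q: "q \<in> plots (tot_space B1) n W" "q' \<in> plots (tot_space B1) n W"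
        and s: "\<And>w. w \<in> W \<Longrightarrow> s w = tot_class (Inl (q w))"
        and t: "\<And>w. w \<in> W \<Longrightarrow> t w = tot_class (Inl (q' w))"
        and eq: "\<And>w. w \<in> W \<Longrightarrow> bproj G (s w) = bproj G (t w)" for n W s t q q'
    proof -
      have pts: "q w \<in> points (tot_space B1)" "q' w \<in> points (tot_space B1)" if "w \<in> W" for w
        using that t1.plot_range[OF q(1)] t1.plot_range[OF q(2)] by auto
      have base_eq: "base_class (Inl (bproj B1 (q w))) = base_class (Inl (bproj B1 (q' w)))"
        if "w \<in> W" for w
        using eq[OF that] pts[OF that] by (simp add: s[OF that] t[OF that] bproj_class)
      have proj: "bproj B1 (q w) = bproj B1 (q' w)" if "w \<in> W" for w
        using base_class_eqD[OF base_eq[OF that]] proj1[OF pts(1)[OF that]] proj1[OF pts(2)[OF that]]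
          f_inj by (auto dest: inj_onD split: if_splits)
      have "(\<lambda>w. (q w, q' w)) \<in> plots (fibre_product B1 B1) n W"
        using q proj by (simp add: fibre_product_plots)
      from smooth_mapD(2)[OF B1.add_smooth this]
      have "(\<lambda>w. vadd B1 (q w) (q' w)) \<in> plots (tot_space B1) n W" by simp
      then show ?thesis
        unfolding G_simps
      proof (rule glue_plot_Inl[OF t1.plot_domain[OF q(1)]])
        fix w assume w: "w \<in> W"
        show "vadd G (s w) (t w) = tot_class (Inl (vadd B1 (q w) (q' w)))"
          unfolding s[OF w] t[OF w]
          by (rule add_Inl[OF fibreI[OF pts(1)[OF w]]]) (simp add: proj[OF w] fibreI[OF pts(2)[OF w]])
      qed
    qed
    \<comment> \<open>Where a plot of the first space meets one of the second over the same base points, it runs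
      over \<open>Y\<close>, so \<open>F\<close> moves it to the second space.\<close>
    have mixed: "(\<lambda>w. F (q w)) \<in> plots (tot_space B2) n W \<and>
        (\<forall>w\<in>W. tot_class (Inl (q w)) = tot_class (Inr (F (q w))))"
      if q: "q \<in> plots (tot_space B1) n W" "q' \<in> plots (tot_space B2) n W"
        and eq: "\<And>w. w \<in> W \<Longrightarrow> bproj G (tot_class (Inl (q w))) = bproj G (tot_class (Inr (q' w)))"
      for n W q q'
    proof -
      have "q w \<in> over B1 Y" if w: "w \<in> W" for w
      proof -
        have pts: "q w \<in> points (tot_space B1)" "q' w \<in> points (tot_space B2)"
          using w t1.plot_range[OF q(1)] t2.plot_range[OF q(2)] by auto
        then have "base_class (Inl (bproj B1 (q w))) = base_class (Inr (bproj B2 (q' w)))"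
          using eq[OF w] by (simp add: bproj_class)
        from base_class_eqD[OF this] have "bproj B1 (q w) \<in> Y"
          using proj1[OF pts(1)] proj2[OF pts(2)] by (auto split: if_splits)
        then show ?thesis using pts by (simp add: over_def)
      qed
      then show ?thesis using F_smooth[OF q(1)] tot_class_over by blast
    qed
    show "smooth_map (fibre_product G G) (tot_space G) (\<lambda>(v, w). vadd G v w)"
    proof (rule smooth_mapI)
      fix z assume "z \<in> points (fibre_product G G)"
      then have z: "fst z \<in> fibre G (bproj G (fst z))" "snd z \<in> fibre G (bproj G (fst z))"
        using fibreI by (fastforce simp: fibre_product_points)+
      have "vadd G (fst z) (snd z) \<in> points (tot_space G)"
        using base_of[OF z(1)]
      proof (cases rule: base_point_cases)
        case (1 x)
        obtain v w where "v \<in> fibre B1 x" "w \<in> fibre B1 x" "fst z = tot_class (Inl v)"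
          "snd z = tot_class (Inl w)"
          using z unfolding 1(3) fibre_Inl[OF 1(1,2)] by blast
        then show ?thesis using add_Inl fibreD(1)[OF add1] by (simp add: tot_class_points)
      next
        case (2 x)
        obtain v w where "v \<in> fibre B2 x" "w \<in> fibre B2 x" "fst z = tot_class (Inr v)"
          "snd z = tot_class (Inr w)"
          using z unfolding 2(2) fibre_Inr[OF 2(1)] by blast
        then show ?thesis using add_Inr fibreD(1)[OF add2] by (simp add: tot_class_points)
      qed
      then show "(\<lambda>(v, w). vadd G v w) z \<in> points (tot_space G)" by (simp add: case_prod_unfold)
    next
      fix n U p assume "p \<in> plots (fibre_product G G) n U"
      then have p: "(\<lambda>u. fst (p u)) \<in> plots (tot_space G) n U" "(\<lambda>u. snd (p u)) \<in> plots (tot_space G) n U"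
        and eq: "\<And>u. u \<in> U \<Longrightarrow> bproj G (fst (p u)) = bproj G (snd (p u))"
        by (simp_all add: fibre_product_plots)
      have "(\<lambda>u. vadd G (fst (p u)) (snd (p u))) \<in> plots (tot_space G) n U"
      proof (rule tG.plot_sheaf[OF tG.plot_domain[OF p(1)]])
        fix u assume u: "u \<in> U"
        let ?goal = "\<exists>W. u \<in> W \<and> W \<subseteq> U \<and>
          (\<lambda>u. vadd G (fst (p u)) (snd (p u))) \<in> plots (tot_space G) n W"
        show ?goal
          using p(1)[unfolded G_simps] u
        proof (cases rule: glue_plot_cases)
          case (1 W q)
          note 11 = this
          show ?goal
            using p(2)[unfolded G_simps] u
          proof (cases rule: glue_plot_cases)
            case (1 W' q')
            have I: "openin (Euclidean_space n) (W \<inter> W')"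
              using t1.plot_domain[OF 11(3)] t1.plot_domain[OF 1(3)] by (rule openin_Int)
            have "(\<lambda>u. vadd G (fst (p u)) (snd (p u))) \<in> plots (tot_space G) n (W \<inter> W')"
              by (rule add_LL[OF t1.plot_restrict[OF 11(3) I Int_lower1] t1.plot_restrict[OF 1(3) I Int_lower2]])
                (simp add: 11(4), simp add: 1(4), rule eq, use 11(2) in blast)
            then show ?goal using 11 1 by blast
          next
            case (2 W' q')
            have I: "openin (Euclidean_space n) (W \<inter> W')"
              using t1.plot_domain[OF 11(3)] t2.plot_domain[OF 2(3)] by (rule openin_Int)
            have q: "q \<in> plots (tot_space B1) n (W \<inter> W')" "q' \<in> plots (tot_space B2) n (W \<inter> W')"
              using t1.plot_restrict[OF 11(3) I] t2.plot_restrict[OF 2(3) I] by simp_all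
            have m: "(\<lambda>w. F (q w)) \<in> plots (tot_space B2) n (W \<inter> W') \<and>
                (\<forall>w\<in>W \<inter> W'. tot_class (Inl (q w)) = tot_class (Inr (F (q w))))"
              
            proof (rule mixed[OF q])
              fix w assume w: "w \<in> W \<inter> W'"
              then show "bproj G (tot_class (Inl (q w))) = bproj G (tot_class (Inr (q' w)))"
                using eq[of w] 11(2) 11(4)[of w] 2(4)[of w] by auto
            qed
            have "(\<lambda>u. vadd G (fst (p u)) (snd (p u))) \<in> plots (tot_space G) n (W \<inter> W')"
              by (rule add_RR[OF conjunct1[OF m] q(2)])
                (simp add: 11(4) m, simp add: 2(4), rule eq, use 11(2) in blast)
            then show ?goal using 11 2 by blast
          qed
        next
          case (2 W q)
          note 22 = this
          show ?goal
            using p(2)[unfolded G_simps] u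
          proof (cases rule: glue_plot_cases)
            case (1 W' q')
            have I: "openin (Euclidean_space n) (W \<inter> W')"
              using t2.plot_domain[OF 22(3)] t1.plot_domain[OF 1(3)] by (rule openin_Int)
            have q: "q' \<in> plots (tot_space B1) n (W \<inter> W')" "q \<in> plots (tot_space B2) n (W \<inter> W')"
              using t1.plot_restrict[OF 1(3) I] t2.plot_restrict[OF 22(3) I] by simp_all
            have m: "(\<lambda>w. F (q' w)) \<in> plots (tot_space B2) n (W \<inter> W') \<and>
                (\<forall>w\<in>W \<inter> W'. tot_class (Inl (q' w)) = tot_class (Inr (F (q' w))))"
              
            proof (rule mixed[OF q])
              fix w assume w: "w \<in> W \<inter> W'"
              then show "bproj G (tot_class (Inl (q' w))) = bproj G (tot_class (Inr (q w)))"
                using eq[of w] 22(2) 22(4)[of w] 1(4)[of w] by auto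
            qed
            have "(\<lambda>u. vadd G (fst (p u)) (snd (p u))) \<in> plots (tot_space G) n (W \<inter> W')"
              by (rule add_RR[OF q(2) conjunct1[OF m]])
                (simp add: 22(4), simp add: 1(4) m, rule eq, use 22(2) in blast)
            then show ?goal using 22 1 by blast
          next
            case (2 W' q')
            have I: "openin (Euclidean_space n) (W \<inter> W')"
              using t2.plot_domain[OF 22(3)] t2.plot_domain[OF 2(3)] by (rule openin_Int)
            have "(\<lambda>u. vadd G (fst (p u)) (snd (p u))) \<in> plots (tot_space G) n (W \<inter> W')"
              by (rule add_RR[OF t2.plot_restrict[OF 22(3) I Int_lower1] t2.plot_restrict[OF 2(3) I Int_lower2]])
                (simp add: 22(4), simp add: 2(4), rule eq, use 22(2) in blast)
            then show ?goal using 22 2 by blast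
          qed
        qed
      qed
      then show "(\<lambda>u. (\<lambda>(v, w). vadd G v w) (p u)) \<in> plots (tot_space G) n U"
        by (simp add: case_prod_unfold)
    qed
    show "smooth_map (prod_diffeology real_diffeology (tot_space G)) (tot_space G) (\<lambda>(r, v). vscale G r v)"
    proof (rule smooth_mapI)
      fix z assume "z \<in> points (prod_diffeology real_diffeology (tot_space G))"
      then have "snd z \<in> points (tot_space G)" by (auto simp: prod_diffeology_def)
      then have z: "snd z \<in> fibre G (bproj G (snd z))" by (rule fibreI)
      have "vscale G (fst z) (snd z) \<in> points (tot_space G)"
        using base_of[OF z]
      proof (cases rule: base_point_cases)
        case (1 x)
        obtain v where "v \<in> fibre B1 x" "snd z = tot_class (Inl v)"
          using z unfolding 1(3) fibre_Inl[OF 1(1,2)] by blast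
        then show ?thesis using scale_Inl fibreD(1)[OF scale1] by (simp add: tot_class_points)
      next
        case (2 x)
        obtain v where "v \<in> fibre B2 x" "snd z = tot_class (Inr v)"
          using z unfolding 2(2) fibre_Inr[OF 2(1)] by blast
        then show ?thesis using scale_Inr fibreD(1)[OF scale2] by (simp add: tot_class_points)
      qed
      then show "(\<lambda>(r, v). vscale G r v) z \<in> points (tot_space G)" by (simp add: case_prod_unfold)
    next
      fix n U p assume "p \<in> plots (prod_diffeology real_diffeology (tot_space G)) n U"
      then have r: "Cinf_real n U (\<lambda>u. fst (p u))" and p: "(\<lambda>u. snd (p u)) \<in> plots (tot_space G) n U"
        by (simp_all add: scale_plots)
      have "(\<lambda>u. vscale G (fst (p u)) (snd (p u))) \<in> plots (tot_space G) n U"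
      proof (rule tG.plot_sheaf[OF tG.plot_domain[OF p]])
        fix u assume "u \<in> U"
        with p[unfolded G_simps]
        show "\<exists>W. u \<in> W \<and> W \<subseteq> U \<and>
          (\<lambda>u. vscale G (fst (p u)) (snd (p u))) \<in> plots (tot_space G) n W"
        proof (cases rule: glue_plot_cases)
          case (1 W q)
          have W: "openin (Euclidean_space n) W" by (rule t1.plot_domain[OF 1(3)])
          have pts: "q w \<in> points (tot_space B1)" if "w \<in> W" for w
            using that t1.plot_range[OF 1(3)] by blast
          have "(\<lambda>w. (fst (p w), q w)) \<in> plots (prod_diffeology real_diffeology (tot_space B1)) n W"
            using W Cinf_real_subset[OF r 1(2)] 1(3) by (simp add: scale_plots)
          from smooth_mapD(2)[OF B1.scale_smooth this]
          have "(\<lambda>w. vscale B1 (fst (p w)) (q w)) \<in> plots (tot_space B1) n W" by simp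
          then have "(\<lambda>u. vscale G (fst (p u)) (snd (p u))) \<in> plots (tot_space G) n W"
            unfolding G_simps
            by (rule glue_plot_Inl[OF W]) (simp add: 1(4) scale_Inl[OF fibreI[OF pts]])
          with 1 show ?thesis by blast
        next
          case (2 W q)
          have W: "openin (Euclidean_space n) W" by (rule t2.plot_domain[OF 2(3)])
          have pts: "q w \<in> points (tot_space B2)" if "w \<in> W" for w
            using that t2.plot_range[OF 2(3)] by blast
          have "(\<lambda>w. (fst (p w), q w)) \<in> plots (prod_diffeology real_diffeology (tot_space B2)) n W"
            using W Cinf_real_subset[OF r 2(2)] 2(3) by (simp add: scale_plots)
          from smooth_mapD(2)[OF B2.scale_smooth this]
          have "(\<lambda>w. vscale B2 (fst (p w)) (q w)) \<in> plots (tot_space B2) n W" by simp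
          then have "(\<lambda>u. vscale G (fst (p u)) (snd (p u))) \<in> plots (tot_space G) n W"
            unfolding G_simps
            by (rule glue_plot_Inr[OF W]) (simp add: 2(4) scale_Inr[OF fibreI[OF pts]])
          with 2 show ?thesis by blast
        qed
      qed
      then show "(\<lambda>u. (\<lambda>(r, v). vscale G r v) (p u)) \<in> plots (tot_space G) n U"
        by (simp add: case_prod_unfold)
    qed
    show "smooth_map (base_space G) (tot_space G) (vzero G)"
      unfolding G_simps(2)
    proof (rule smooth_map_from_glue[OF tG.local_plots])
      show "smooth_map (base_space B1) (tot_space G) (\<lambda>x. vzero G (base_class (Inl x)))"
        by (rule smooth_map_cong[OF B1.base_diffeological tG.local_plots
              smooth_map_comp[OF B1.zero_smooth tot_Inl]]) (rule vzero_Inl)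
      show "smooth_map (base_space B2) (tot_space G) (\<lambda>x. vzero G (base_class (Inr x)))"
        by (rule smooth_map_cong[OF B2.base_diffeological tG.local_plots
              smooth_map_comp[OF B2.zero_smooth tot_Inr]]) (rule vzero_Inr)
    qed
  qed
  moreover have "\<exists>C. finite C \<and> C \<subseteq> fibre G c \<and> fibre_subspace G c hull C = fibre G c"
    if "c \<in> points (base_space G)" for c
    using that
  proof (cases rule: base_point_cases)
    case (1 x)
    obtain C where C: "finite C" "C \<subseteq> fibre B1 x" "fibre_subspace B1 x hull C = fibre B1 x"
      using B1.fibre_finite_dim[OF 1(1)] by blast
    show ?thesis
      unfolding 1(3)
      by (rule finite_dim_fibre_image[OF C B1.fibre_vector_space[OF 1(1)] fibre_Inl[OF 1(1,2)]])
        (simp_all add: add_Inl scale_Inl vzero_Inl 1)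
  next
    case (2 x)
    obtain C where C: "finite C" "C \<subseteq> fibre B2 x" "fibre_subspace B2 x hull C = fibre B2 x"
      using B2.fibre_finite_dim[OF 2(1)] by blast
    show ?thesis
      unfolding 2(2)
      by (rule finite_dim_fibre_image[OF C B2.fibre_vector_space[OF 2(1)] fibre_Inr[OF 2(1)]])
        (simp_all add: add_Inr scale_Inr vzero_Inr 2)
  qed
  ultimately show ?thesis
    by (intro finite_dim_pseudo_bundle.intro finite_dim_pseudo_bundle_axioms.intro)
qed

section \<open>The reversed gluing of the duals\<close>

lemma dual_plotsD:
  assumes B: "diffeological_space (base_space B)" and p: "p \<in> plots (tot_space (dual_bundle B)) n U"
  shows "(\<lambda>u. fst (p u)) \<in> plots (base_space B) n U" "openin (Euclidean_space n) U"
    "p ` U \<subseteq> points (tot_space (dual_bundle B))"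
proof -
  interpret diffeological_space "base_space B" by (rule B)
  show fst: "(\<lambda>u. fst (p u)) \<in> plots (base_space B) n U"
    using p by (simp add: dual_bundle_simps dual_plots_def comp_def)
  show "openin (Euclidean_space n) U" by (rule plot_domain[OF fst])
  show "p ` U \<subseteq> points (tot_space (dual_bundle B))"
    using p plot_range[OF fst] by (auto simp: dual_bundle_simps dual_plots_def dual_points)
qed

lemma dual_proj_smooth:
  assumes "diffeological_space (base_space B)"
  shows "smooth_map (tot_space (dual_bundle B)) (base_space (dual_bundle B)) (bproj (dual_bundle B))"
  by (rule smooth_mapI) (simp_all add: dual_bundle_simps(1,2) dual_points dual_plotsD[OF assms])

text \<open>Precomposition with the smooth map \<open>F\<close> preserves smoothness of functionals. The extension by
  zero changes a functional along a plot only outside the domain of the plot.\<close>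

lemma dual_map_linear:
  assumes B1: "vector_pseudo_bundle B1" and gl: "gluing_data B1 B2 Y f F"
  shows "fibrewise_linear (dual_bundle B2) (dual_bundle B1) (f ` Y) (inv_into Y f) (dual_map B1 Y f F)"
proof -
  interpret B1: vector_pseudo_bundle B1 by (rule B1)
  interpret t1: diffeological_space "tot_space B1" by (rule B1.tot_diffeological)
  note g = gluing_dataD[OF gl]
  have pull: "(\<lambda>v. if v \<in> fibre B1 y then l (F v) else 0) \<in> dual_fibre B1 y"
    if y: "y \<in> Y" and l: "l \<in> dual_fibre B2 (f y)" for y l
  proof -
    let ?l = "\<lambda>v. if v \<in> fibre B1 y then l (F v) else 0"
    have "smooth_map (subset_diffeology (tot_space B1) (fibre B1 y)) real_diffeology ?l"
    proof (rule smooth_mapI)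
      fix n U p assume "p \<in> plots (subset_diffeology (tot_space B1) (fibre B1 y)) n U"
      then have p: "p \<in> plots (tot_space B1) n U" "p ` U \<subseteq> fibre B1 y"
        by (auto simp: subset_diffeology_def)
      have "p ` U \<subseteq> over B1 Y" using p(2) y by (auto simp: fibre_def over_def)
      from g(5)[OF p(1) this] have "(\<lambda>u. F (p u)) \<in> plots (tot_space B2) n U" .
      moreover have "(\<lambda>u. F (p u)) ` U \<subseteq> fibre B2 (f y)"
        using p(2) fibrewise_linearD(1)[OF g(4) y] by blast
      ultimately have "(\<lambda>u. F (p u)) \<in> plots (subset_diffeology (tot_space B2) (fibre B2 (f y))) n U"
        by (simp add: subset_diffeology_def)
      moreover have "smooth_map (subset_diffeology (tot_space B2) (fibre B2 (f y))) real_diffeology l"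
        using l by (simp add: dual_fibre_def)
      ultimately have "(\<lambda>u. l (F (p u))) \<in> plots real_diffeology n U" by (rule smooth_mapD(2)[rotated])
      then have U: "openin (Euclidean_space n) U" and c: "\<And>k. Ck_on k n U (\<lambda>u. l (F (p u)))"
        by (auto simp: real_diffeology_def Cinf_real_def)
      have "Ck_on k n U (\<lambda>u. ?l (p u))" for k
        using c by (rule Ck_on_cong[OF U]) (use p(2) in auto)
      with U show "(\<lambda>u. ?l (p u)) \<in> plots real_diffeology n U"
        by (simp add: real_diffeology_def Cinf_real_def)
    qed (simp add: real_diffeology_def)
    moreover have "?l (vadd B1 v w) = ?l v + ?l w" if "v \<in> fibre B1 y" "w \<in> fibre B1 y" for v w
      using that B1.fibre_closed(1)[OF that] fibrewise_linearD[OF g(4) y] dual_fibreD(1)[OF l] by simp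
    moreover have "?l (vscale B1 r v) = r * ?l v" if "v \<in> fibre B1 y" for r v
      using that B1.fibre_closed(2)[OF that] fibrewise_linearD[OF g(4) y] dual_fibreD(2)[OF l] by simp
    ultimately show ?thesis unfolding dual_fibre_def by simp
  qed
  show ?thesis
    unfolding fibrewise_linear_def
  proof (intro ballI conjI allI)
    fix x s assume "x \<in> f ` Y" and s: "s \<in> fibre (dual_bundle B2) x"
    then obtain y where y: "y \<in> Y" "x = f y" "inv_into Y f x = y"
      using g(3) by auto
    obtain l where l: "s = (x, l)" "l \<in> dual_fibre B2 (f y)"
      using s y by (cases s) (auto simp: fibre_dual)
    show "dual_map B1 Y f F s \<in> fibre (dual_bundle B1) (inv_into Y f x)"
      using pull[OF y(1) l(2)] g(1) y by (auto simp: fibre_dual dual_map_def Let_def l(1))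
    show "dual_map B1 Y f F (vadd (dual_bundle B2) s t) =
        vadd (dual_bundle B1) (dual_map B1 Y f F s) (dual_map B1 Y f F t)"
      if "t \<in> fibre (dual_bundle B2) x" for t
      using that by (cases t) (auto simp: fibre_dual l(1) dual_bundle_simps dual_map_def Let_def)
    show "dual_map B1 Y f F (vscale (dual_bundle B2) r s) =
        vscale (dual_bundle B1) r (dual_map B1 Y f F s)" for r
      by (auto simp: l(1) dual_bundle_simps dual_map_def Let_def)
  qed
qed

lemma dual_bundle_gluing:
  assumes B1: "vector_pseudo_bundle B1" and gl: "gluing_data B1 B2 Y f F"
  shows "bundle_gluing (dual_bundle B2) (dual_bundle B1) (f ` Y) (inv_into Y f) (dual_map B1 Y f F)"
proof (rule bundle_gluing.intro)
  note g = gluing_dataD[OF gl]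
  show "f ` Y \<subseteq> points (base_space (dual_bundle B2))" using g(2) by (simp add: dual_bundle_simps)
  show "inv_into Y f ` f ` Y \<subseteq> points (base_space (dual_bundle B1))"
    using g(1,3) by (simp add: dual_bundle_simps)
  show "inj_on (inv_into Y f) (f ` Y)" by (rule inj_on_inv_into) simp
  show "fibrewise_linear (dual_bundle B2) (dual_bundle B1) (f ` Y) (inv_into Y f) (dual_map B1 Y f F)"
    by (rule dual_map_linear[OF B1 gl])
qed (simp_all add: dual_points dual_bundle_simps(1,2) fibre_dual_add fibre_dual_scale)

text \<open>Injectivity of \<open>s\<close> is what forces the preimage of a vector over \<open>s x\<close> to lie over \<open>x\<close>.\<close>

lemma fibrewise_linear_inverse:
  assumes bij: "bij_betw \<psi> (points (tot_space A)) (points (tot_space E))"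
    and lin: "fibrewise_linear A E (points (base_space A)) s \<psi>"
    and s: "inj_on s (points (base_space A))"
    and proj: "\<And>v. v \<in> points (tot_space A) \<Longrightarrow> bproj A v \<in> points (base_space A)"
    and add: "\<And>x v w. v \<in> fibre A x \<Longrightarrow> w \<in> fibre A x \<Longrightarrow> vadd A v w \<in> fibre A x"
    and scale: "\<And>x r v. v \<in> fibre A x \<Longrightarrow> vscale A r v \<in> fibre A x"
  shows "fibrewise_linear E A (s ` points (base_space A)) (inv_into (points (base_space A)) s)
      (inv_into (points (tot_space A)) \<psi>)"
    and "x \<in> points (base_space A) \<Longrightarrow>
      bij_betw (inv_into (points (tot_space A)) \<psi>) (fibre E (s x)) (fibre A x)"
proof -
  let ?i = "inv_into (points (tot_space A)) \<psi>"
  note inj = bij_betw_imp_inj_on[OF bij]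
  have i: "?i (\<psi> v) = v" if "v \<in> fibre A x" for v x
    using inv_into_f_f[OF inj fibreD(1)[OF that]] .
  have lift: "\<exists>v\<in>fibre A x. e = \<psi> v" if x: "x \<in> points (base_space A)" and e: "e \<in> fibre E (s x)" for x e
  proof -
    obtain v where v: "v \<in> points (tot_space A)" "e = \<psi> v"
      using fibreD(1)[OF e] bij unfolding bij_betw_def by blast
    have "\<psi> v \<in> fibre E (s (bproj A v))"
      by (rule fibrewise_linearD(1)[OF lin proj[OF v(1)] fibreI[OF v(1)]])
    then have "s (bproj A v) = s x" using fibreD(2)[OF e] fibreD(2) v(2) by metis
    then have "bproj A v = x" using s proj[OF v(1)] x by (auto dest: inj_onD)
    then show ?thesis using v fibreI[OF v(1)] by auto
  qed
  show "fibrewise_linear E A (s ` points (base_space A)) (inv_into (points (base_space A)) s) ?i"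
    unfolding fibrewise_linear_def
  proof (intro ballI conjI allI)
    fix z e assume "z \<in> s ` points (base_space A)" and e: "e \<in> fibre E z"
    then obtain x where x: "x \<in> points (base_space A)" "z = s x" by blast
    have z: "inv_into (points (base_space A)) s z = x" unfolding x(2) by (rule inv_into_f_f[OF s x(1)])
    obtain v where v: "v \<in> fibre A x" "e = \<psi> v" using lift[OF x(1)] e x(2) by blast
    show "?i e \<in> fibre A (inv_into (points (base_space A)) s z)"
      unfolding z v(2) i[OF v(1)] by (rule v(1))
    show "?i (vadd E e e') = vadd A (?i e) (?i e')" if e': "e' \<in> fibre E z" for e'
    proof -
      obtain w where w: "w \<in> fibre A x" "e' = \<psi> w" using lift[OF x(1)] e' x(2) by blast
      have "vadd E e e' = \<psi> (vadd A v w)"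
        using fibrewise_linearD(2)[OF lin x(1) v(1) w(1)] v(2) w(2) by simp
      then show ?thesis using i[OF add[OF v(1) w(1)]] i[OF v(1)] i[OF w(1)] v(2) w(2) by simp
    qed
    show "?i (vscale E r e) = vscale A r (?i e)" for r
    proof -
      have "vscale E r e = \<psi> (vscale A r v)"
        using fibrewise_linearD(3)[OF lin x(1) v(1)] v(2) by simp
      then show ?thesis using i[OF scale[OF v(1)]] i[OF v(1)] v(2) by simp
    qed
  qed
  assume x: "x \<in> points (base_space A)"
  have "\<psi> ` fibre A x = fibre E (s x)"
    using lift[OF x] fibrewise_linearD(1)[OF lin x] by blast
  moreover have "fibre A x \<subseteq> points (tot_space A)" using fibreD(1) by (rule subsetI)
  ultimately have "bij_betw \<psi> (fibre A x) (fibre E (s x))"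
    using inj_on_subset[OF inj] by (simp add: bij_betw_def)
  from bij_betw_inv_into_subset[OF bij \<open>fibre A x \<subseteq> points (tot_space A)\<close> \<open>\<psi> ` fibre A x = fibre E (s x)\<close>]
  show "bij_betw ?i (fibre E (s x)) (fibre A x)" .
qed

section \<open>The glued pseudo-metric\<close>

theorem theorem6p4:
  fixes B1 :: "('v, 'a) bundle_data" and B2 :: "('w, 'b) bundle_data"
    and Y :: "'a set" and f :: "'a \<Rightarrow> 'b" and F :: "'v \<Rightarrow> 'w"
  assumes "finite_dim_pseudo_bundle B1" and "finite_dim_pseudo_bundle B2"
    and "gluing_data B1 B2 Y f F"
    and "gluing_dual_commutativity B1 B2 Y f F \<psi>"
    and "fibrewise_diffeomorphic (dual_bundle (restrict_bundle B2 (f ` Y)))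
           (dual_bundle (restrict_bundle B1 Y))"
    and "pseudo_metric B1 g1" and "pseudo_metric B2 g2"
    and "compatible_metrics B1 Y f F g1 g2"
  shows "pseudo_metric (glue_bundle B1 B2 Y f F)
           (Psi_map B1 B2 Y f F \<psi> \<circ> glued_section B1 B2 Y f F g1 g2 \<circ> switch_map)"
proof -
  interpret m1: pseudo_metric B1 g1 by (rule assms(6))
  interpret m2: pseudo_metric B2 g2 by (rule assms(7))
  note gl = assms(3)
  note B1 = m1.vector_pseudo_bundle_axioms and B2 = m2.vector_pseudo_bundle_axioms
  interpret g: bundle_gluing B1 B2 Y f F by (rule bundle_gluing_of_gluing_data[OF B1 B2 gl])
  define V where "V = glue_bundle B1 B2 Y f F"
  interpret V: finite_dim_pseudo_bundle V
    unfolding V_def by (rule glue_bundle_finite_dim[OF assms(1,2) gl])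
  define f' D where "f' = inv_into Y f" and "D = dual_map B1 Y f F"
  define D1 D2 DV E where "D1 = dual_bundle B1" and "D2 = dual_bundle B2" and "DV = dual_bundle V"
    and "E = glue_bundle D2 D1 (f ` Y) f' D"
  interpret e: bundle_gluing D2 D1 "f ` Y" f' D
    unfolding f'_def D_def D1_def D2_def by (rule dual_bundle_gluing[OF B1 gl])
  have E_duals: "glued_duals B1 B2 Y f F = E"
    by (simp add: glued_duals_def E_def D1_def D2_def D_def f'_def)
  have bases: "base_space D1 = base_space B1" "base_space D2 = base_space B2"
    "base_space DV = base_space V" "bproj D1 = fst" "bproj D2 = fst" "bproj DV = fst"
    by (simp_all add: D1_def D2_def DV_def dual_bundle_simps(1,2))
  have f'f: "f' (f y) = y" if "y \<in> Y" for y unfolding f'_def by (rule inv_into_f_f[OF g.f_inj that])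

  \<comment> \<open>The inclusions of the two bases into the glued base.\<close>
  define h1 h2 where "h1 x = g.base_class (Inl x)" and "h2 y = g.base_class (Inr y)" for x y
  have h1_pt: "h1 x \<in> points (base_space V)" if "x \<in> points (base_space B1)" for x
    unfolding h1_def V_def g.G_simps using that by (intro glue_class_point) simp
  have h2_pt: "h2 x \<in> points (base_space V)" if "x \<in> points (base_space B2)" for x
    unfolding h2_def V_def g.G_simps using that by (intro glue_class_point) simp
  have h1_smooth: "smooth_map (base_space B1) (base_space V) h1"
    unfolding h1_def V_def g.G_simps
    by (rule glue_Inl_smooth) (rule diffeological_space.plot_domain[OF m1.base_diffeological])
  have h2_smooth: "smooth_map (base_space B2) (base_space V) h2"
    unfolding h2_def V_def g.G_simps
    by (rule glue_Inr_smooth) (rule diffeological_space.plot_domain[OF m2.base_diffeological])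
  have h12: "h1 y = h2 (f y)" if "y \<in> Y" for y
    unfolding h1_def h2_def by (rule g.base_class_glued[OF that])

  \<comment> \<open>Since \<open>f\<close> is reversed, \<open>X1\<close> is the second summand in the gluing \<open>e\<close> of the duals.\<close>
  let ?sw = "switch_map :: ('a + 'b) set \<Rightarrow> ('b + 'a) set"
  have sw1: "?sw (h1 x) = e.base_class (Inr x)" if "x \<in> points (base_space B1)" for x
    using switch_map_class[OF g.f_base g.f_inj, of "Inl x" "base_space B1"] that
    by (simp add: h1_def bases f'_def)
  have sw2: "?sw (h2 x) = e.base_class (Inl x)" if "x \<in> points (base_space B2)" for x
    using switch_map_class[OF g.f_base g.f_inj, of "Inr x" "base_space B1"] that
    by (simp add: h2_def bases f'_def)

  define i where "i = inv_into (points (tot_space DV)) \<psi>"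
  define \<phi> where "\<phi> = inv_into (points (base_space V)) ?sw"
  have \<phi>: "\<phi> (?sw c) = c" if "c \<in> points (base_space V)" for c
    unfolding \<phi>_def by (rule inv_into_f_f[OF inj_switch_map that])
  have psi: "diffeomorphism (tot_space DV) (tot_space E) \<psi>"
    "fibrewise_linear DV E (points (base_space DV)) ?sw \<psi>"
    using assms(4) unfolding gluing_dual_commutativity_def E_duals V_def[symmetric] DV_def[symmetric] bases
    by simp_all
  have bij: "bij_betw \<psi> (points (tot_space DV)) (points (tot_space E))"
    using psi(1) by (simp add: diffeomorphism_def)
  have i_smooth: "smooth_map (tot_space E) (tot_space DV) i"
    using psi(1) unfolding diffeomorphism_def i_def by simp
  have DV_proj: "bproj DV t \<in> points (base_space DV)" if "t \<in> points (tot_space DV)" for t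
    using that by (simp add: DV_def dual_points dual_bundle_simps(1,2))
  have DV_add: "vadd DV s t \<in> fibre DV x" if "s \<in> fibre DV x" "t \<in> fibre DV x" for s t x
    using fibre_dual_add that unfolding DV_def .
  have DV_scale: "vscale DV r s \<in> fibre DV x" if "s \<in> fibre DV x" for r s x
    using fibre_dual_scale that unfolding DV_def .
  have i_linear: "fibrewise_linear E DV (?sw ` points (base_space V)) \<phi> i"
    unfolding i_def \<phi>_def bases(3)[symmetric]
    by (rule fibrewise_linear_inverse(1)[OF bij psi(2) inj_switch_map]) (fact DV_proj DV_add DV_scale)+
  have i_bij: "bij_betw i (fibre E (?sw c)) (fibre DV c)" if "c \<in> points (base_space V)" for c
    unfolding i_def
    by (rule fibrewise_linear_inverse(2)[OF bij psi(2) inj_switch_map])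
      (fact DV_proj DV_add DV_scale that[folded bases(3)])+

  define k1 k2 where "k1 t = i (e.tot_class (Inr t))" and "k2 s = i (e.tot_class (Inl s))" for t s
  have lin1: "fibrewise_linear D1 DV (points (base_space B1)) h1 k1"
    unfolding k1_def
    by (rule fibrewise_linear_comp[OF e.Inr_linear[folded E_def] i_linear])
      (use sw1 h1_pt \<phi> in \<open>metis imageI\<close>)+
  have lin2: "fibrewise_linear D2 DV (points (base_space B2)) h2 k2"
    unfolding k2_def
    by (rule fibrewise_linear_comp[OF e.Inl_linear[folded E_def] i_linear])
      (use sw2 h2_pt \<phi> in \<open>metis imageI\<close>)+
  have k1_smooth: "smooth_map (tot_space D1) (tot_space DV) k1"
  proof -
    have "smooth_map (tot_space D1) (tot_space E) (\<lambda>t. e.tot_class (Inr t))"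
      unfolding E_def e.G_simps
      by (rule glue_Inr_smooth) (unfold D1_def, rule dual_plotsD(2)[OF m1.base_diffeological])
    from smooth_map_comp[OF this i_smooth] show ?thesis unfolding k1_def .
  qed
  have k2_smooth: "smooth_map (tot_space D2) (tot_space DV) k2"
  proof -
    have "smooth_map (tot_space D2) (tot_space E) (\<lambda>t. e.tot_class (Inl t))"
      unfolding E_def e.G_simps
      by (rule glue_Inl_smooth) (unfold D2_def, rule dual_plotsD(2)[OF m2.base_diffeological])
    from smooth_map_comp[OF this i_smooth] show ?thesis unfolding k2_def .
  qed
  \<comment> \<open>In the gluing of the duals a functional over \<open>f ` Y\<close> is identified with its image under \<open>D\<close>.\<close>
  have k12: "k2 s = k1 (D s)" if "s \<in> fibre D2 (f y)" "y \<in> Y" for s y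
    unfolding k1_def k2_def using e.tot_class_over[of s] e.in_over_iff[OF that(1)] that(2) by simp

  define T1 T2 where "T1 = tensor_map DV DV h1 k1 k1" and "T2 = tensor_map DV DV h2 k2 k2"
  have T1_smooth: "smooth_map (tot_space (tensor_bundle D1 D1)) (tot_space (tensor_bundle DV DV)) T1"
    unfolding T1_def
    by (rule tensor_map_smooth)
      (use m1.base_diffeological h1_smooth k1_smooth lin1 dual_proj_smooth[OF m1.base_diffeological]
        dual_plotsD(3)[OF m1.base_diffeological] in \<open>simp_all add: bases(1-3) D1_def[symmetric]\<close>)
  have T2_smooth: "smooth_map (tot_space (tensor_bundle D2 D2)) (tot_space (tensor_bundle DV DV)) T2"
    unfolding T2_def
    by (rule tensor_map_smooth)
      (use m2.base_diffeological h2_smooth k2_smooth lin2 dual_proj_smooth[OF m2.base_diffeological]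
        dual_plotsD(3)[OF m2.base_diffeological] in \<open>simp_all add: bases(1-3) D2_def[symmetric]\<close>)

  have g1_rep: "\<exists>u. g1 x = (x, tensor_class D1 D1 x u) \<and> Poly_Mapping.keys u \<subseteq> fibre D1 x \<times> fibre D1 x"
    if "x \<in> points (base_space B1)" for x
    using m1.metric_rep[OF that] unfolding D1_def by blast
  have g2_rep: "\<exists>u. g2 x = (x, tensor_class D2 D2 x u) \<and> Poly_Mapping.keys u \<subseteq> fibre D2 x \<times> fibre D2 x"
    if "x \<in> points (base_space B2)" for x
    using m2.metric_rep[OF that] unfolding D2_def by blast

  \<comment> \<open>The gluing map of the cotensor bundles has its values in the second one, so that \<open>glue_rep\<close>
    of a class of their gluing is the normal form of any of its members.\<close>
  define TD where "TD = tensor_map D1 D1 f' D D"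
  define tclass where "tclass = glue_class (tot_space (tensor_bundle D2 D2))
    (tot_space (tensor_bundle D1 D1)) (over (tensor_bundle D2 D2) (f ` Y)) TD"
  have D_linear: "fibrewise_linear D2 D1 (f ` Y) f' D" by (rule e.F_linear)
  have TD_points: "TD ` over (tensor_bundle D2 D2) (f ` Y) \<subseteq> points (tot_space (tensor_bundle D1 D1))"
  proof
    fix s assume "s \<in> TD ` over (tensor_bundle D2 D2) (f ` Y)"
    then obtain t where t: "s = TD t" "t \<in> tensor_points D2 D2" "fst t \<in> f ` Y"
      by (auto simp: over_def tensor_bundle_def tensor_with_simps)
    obtain x u where u: "t = (x, tensor_class D2 D2 x u)"
      "Poly_Mapping.keys u \<subseteq> fibre D2 x \<times> fibre D2 x"
      using t(2) by (rule tensor_points_cases)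
    have x: "x \<in> f ` Y" using t(3) u(1) by simp
    have "f' x \<in> points (base_space D1)" using x e.f_base by blast
    then have "TD t \<in> tensor_points D1 D1"
      unfolding TD_def u(1) tensor_map_class[OF D_linear D_linear x]
      by (rule tensor_pointsI[OF _ free_map_keys_fibre[OF D_linear D_linear x u(2)]])
    then show "s \<in> points (tot_space (tensor_bundle D1 D1))"
      by (simp add: t(1) tensor_bundle_def tensor_with_simps)
  qed

  define gt where "gt = Psi_map B1 B2 Y f F \<psi> \<circ> glued_section B1 B2 Y f F g1 g2 \<circ> ?sw"
  have Psi: "Psi_map B1 B2 Y f F \<psi> c = tensor_map DV DV \<phi> i i (case glue_rep c of
      Inl t \<Rightarrow> tensor_map E E (\<lambda>x. e.base_class (Inl x)) (\<lambda>l. e.tot_class (Inl l)) (\<lambda>l. e.tot_class (Inl l)) t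
    | Inr t \<Rightarrow> tensor_map E E (\<lambda>x. e.base_class (Inr x)) (\<lambda>l. e.tot_class (Inr l)) (\<lambda>l. e.tot_class (Inr l)) t)"
    for c
    by (simp add: Psi_map_def Let_def cotensor_gluing_id_def E_duals V_def[symmetric]
        DV_def[symmetric] i_def[symmetric] \<phi>_def[symmetric] D1_def[symmetric] D2_def[symmetric]
        D_def[symmetric] f'_def[symmetric] bases cong: sum.case_cong)
  have glued: "glued_section B1 B2 Y f F g1 g2 c = tclass (map_sum g2 g1 (glue_rep c))" for c
    by (simp add: glued_section_def tclass_def TD_def D1_def D2_def D_def f'_def)
  have g1_pt: "g1 x \<in> points (tot_space (tensor_bundle D1 D1))" if "x \<in> points (base_space B1)" for x
    using smooth_mapD(1)[OF m1.metric_smooth that] unfolding D1_def .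
  have g2_pt: "g2 x \<in> points (tot_space (tensor_bundle D2 D2))" if "x \<in> points (base_space B2)" for x
    using smooth_mapD(1)[OF m2.metric_smooth that] unfolding D2_def .

  have gt1: "gt (h1 x) = T1 (g1 x)" if x: "x \<in> points (base_space B1)" for x
  proof -
    have "glue_rep (?sw (h1 x)) = Inr x"
      using e.base_rep[of "Inr x"] x by (simp add: sw1[OF x] bases)
    moreover have "glue_rep (tclass (Inr (g1 x))) = Inr (g1 x)"
      using glue_rep_class[OF _ TD_points, of "Inr (g1 x)" "tot_space (tensor_bundle D2 D2)"] g1_pt[OF x]
      by (simp add: tclass_def)
    ultimately have "gt (h1 x) = tensor_map DV DV \<phi> i i
        (tensor_map E E (\<lambda>x. e.base_class (Inr x)) (\<lambda>l. e.tot_class (Inr l)) (\<lambda>l. e.tot_class (Inr l)) (g1 x))"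
      by (simp add: gt_def glued Psi)
    moreover obtain u where u: "g1 x = (x, tensor_class D1 D1 x u)" using g1_rep[OF x] by blast
    have "e.base_class (Inr x) \<in> ?sw ` points (base_space V)"
      unfolding sw1[OF x, symmetric] by (rule imageI[OF h1_pt[OF x]])
    from tensor_map_comp[OF e.Inr_linear[folded E_def, of "points (base_space B1)"] i_linear x this, of u]
    have "tensor_map DV DV \<phi> i i
        (tensor_map E E (\<lambda>x. e.base_class (Inr x)) (\<lambda>l. e.tot_class (Inr l)) (\<lambda>l. e.tot_class (Inr l)) (g1 x))
        = (h1 x, tensor_class DV DV (h1 x) (free_map (map_prod k1 k1) u))"
      unfolding u k1_def by (simp only: sw1[OF x, symmetric] \<phi>[OF h1_pt[OF x]])
    ultimately show ?thesis
      unfolding T1_def u by (simp only: tensor_map_class[OF lin1 lin1 x])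
  qed
  have gt2: "gt (h2 x) = T2 (g2 x)" if x: "x \<in> points (base_space B2)" for x
  proof (cases "x \<in> f ` Y")
    case False
    have "glue_rep (?sw (h2 x)) = Inl x"
      using e.base_rep[of "Inl x"] x False by (simp add: sw2[OF x] bases)
    moreover have "g2 x \<notin> over (tensor_bundle D2 D2) (f ` Y)"
      using g2_rep[OF x] False by (auto simp: over_def tensor_bundle_def tensor_with_simps)
    then have "glue_rep (tclass (Inl (g2 x))) = Inl (g2 x)"
      using glue_rep_class[OF _ TD_points, of "Inl (g2 x)" "tot_space (tensor_bundle D2 D2)"] g2_pt[OF x]
      by (simp add: tclass_def)
    ultimately have "gt (h2 x) = tensor_map DV DV \<phi> i i
        (tensor_map E E (\<lambda>x. e.base_class (Inl x)) (\<lambda>l. e.tot_class (Inl l)) (\<lambda>l. e.tot_class (Inl l)) (g2 x))"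
      by (simp add: gt_def glued Psi)
    moreover obtain u where u: "g2 x = (x, tensor_class D2 D2 x u)" using g2_rep[OF x] by blast
    have "e.base_class (Inl x) \<in> ?sw ` points (base_space V)"
      unfolding sw2[OF x, symmetric] by (rule imageI[OF h2_pt[OF x]])
    from tensor_map_comp[OF e.Inl_linear[folded E_def, of "points (base_space B2)"] i_linear x this, of u]
    have "tensor_map DV DV \<phi> i i
        (tensor_map E E (\<lambda>x. e.base_class (Inl x)) (\<lambda>l. e.tot_class (Inl l)) (\<lambda>l. e.tot_class (Inl l)) (g2 x))
        = (h2 x, tensor_class DV DV (h2 x) (free_map (map_prod k2 k2) u))"
      unfolding u k2_def by (simp only: sw2[OF x, symmetric] \<phi>[OF h2_pt[OF x]])
    ultimately show ?thesis
      unfolding T2_def u by (simp only: tensor_map_class[OF lin2 lin2 x])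
  next
    case True
    \<comment> \<open>The class of \<open>x\<close> is now represented by \<open>y\<close>, and the map was computed from \<open>g1 y\<close>.
      Compatibility equates the forms of \<open>g1 y\<close> and of the image of \<open>g2 x\<close> under \<open>D \<otimes> D\<close>.\<close>
    then obtain y where y: "y \<in> Y" "x = f y" by blast
    have y1: "y \<in> points (base_space B1)" using y(1) g.Y_base by blast
    obtain u1 where u1: "g1 y = (y, tensor_class D1 D1 y u1)"
      "Poly_Mapping.keys u1 \<subseteq> fibre D1 y \<times> fibre D1 y" using g1_rep[OF y1] by blast
    obtain u2 where u2: "g2 x = (x, tensor_class D2 D2 x u2)"
      "Poly_Mapping.keys u2 \<subseteq> fibre D2 x \<times> fibre D2 x" using g2_rep[OF x] by blast
    let ?u = "free_map (map_prod D D) u2"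
    have keys: "Poly_Mapping.keys ?u \<subseteq> fibre D1 y \<times> fibre D1 y"
      using free_map_keys_fibre[OF D_linear D_linear True u2(2)] y f'f by simp
    have "tensor_class D1 D1 y u1 = tensor_class D1 D1 y ?u"
      unfolding D1_def
    proof (rule m1.tensor_class_eqI_bilinear_form[OF y1 u1(2)[unfolded D1_def] keys[unfolded D1_def]])
      fix v w assume vw: "v \<in> fibre B1 y" "w \<in> fibre B1 y"
      have "free_form (eval_pair v w) u1 = bilinear_form (g1 y) v w"
        unfolding u1(1) D1_def by (rule bilinear_form_class[symmetric])
      also have "\<dots> = bilinear_form (g2 x) (F v) (F w)"
        using assms(8) y vw unfolding compatible_metrics_def by blast
      also have "\<dots> = free_form (eval_pair (F v) (F w)) u2"
        unfolding u2(1) D2_def by (rule bilinear_form_class)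
      also have "\<dots> = free_form (eval_pair v w) ?u"
        unfolding free_form_map
      proof (rule free_form_cong)
        fix t assume "t \<in> Poly_Mapping.keys u2"
        then have "fst (fst t) = x" "fst (snd t) = x" using u2(2) by (auto simp: D2_def fibre_dual)
        then show "eval_pair (F v) (F w) t = eval_pair v w (map_prod D D t)"
          using vw f'f[OF y(1)] y(2)
          by (cases t) (auto simp: D_def dual_map_def Let_def f'_def[symmetric])
      qed
      finally show "free_form (eval_pair v w) u1 = free_form (eval_pair v w) ?u" .
    qed
    then have "T1 (g1 y) = (h1 y, tensor_class DV DV (h1 y) (free_map (map_prod k1 k1) ?u))"
      unfolding T1_def u1(1) by (simp only: tensor_map_class[OF lin1 lin1 y1])
    moreover have "free_map (map_prod k1 k1) ?u = free_map (map_prod k2 k2) u2"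
      unfolding free_map_comp
    proof (rule free_map_cong)
      fix t assume "t \<in> Poly_Mapping.keys u2"
      then have "fst t \<in> fibre D2 (f y)" "snd t \<in> fibre D2 (f y)" using u2(2) y(2) by auto
      then show "(map_prod k1 k1 \<circ> map_prod D D) t = map_prod k2 k2 t"
        using k12 y(1) by (cases t) simp
    qed
    moreover have "T2 (g2 x) = (h2 x, tensor_class DV DV (h2 x) (free_map (map_prod k2 k2) u2))"
      unfolding T2_def u2(1) by (rule tensor_map_class[OF lin2 lin2 x])
    ultimately show ?thesis using gt1[OF y1] h12[OF y(1)] y(2) by simp
  qed

  have cot: "cotensor_bundle B1 = tensor_bundle D1 D1" "cotensor_bundle B2 = tensor_bundle D2 D2"
    "cotensor_bundle V = tensor_bundle DV DV"
    by (simp_all add: D1_def D2_def DV_def)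
  have V_cases: "(\<exists>x\<in>points (base_space B1). c = h1 x) \<or> (\<exists>x\<in>points (base_space B2) - f ` Y. c = h2 x)"
    if "c \<in> points (base_space V)" for c
    using that unfolding V_def
  proof (cases rule: g.base_point_cases)
    case (2 x)
    show ?thesis
    proof (cases "x \<in> f ` Y")
      case True
      then obtain y where "y \<in> Y" "x = f y" by blast
      then show ?thesis using 2 h12 g.Y_base unfolding h2_def by auto
    qed (use 2 in \<open>auto simp: h2_def\<close>)
  qed (auto simp: h1_def)
  have gt_smooth: "smooth_map (base_space V) (tot_space (tensor_bundle DV DV)) gt"
    unfolding V_def g.G_simps
  proof (rule smooth_map_from_glue[OF tensor_local_plots])
    show "smooth_map (base_space B1) (tot_space (tensor_bundle DV DV)) (\<lambda>x. gt (g.base_class (Inl x)))"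
      by (rule smooth_map_cong[OF m1.base_diffeological tensor_local_plots
            smooth_map_comp[OF m1.metric_smooth[unfolded cot] T1_smooth]]) (rule gt1[unfolded h1_def])
    show "smooth_map (base_space B2) (tot_space (tensor_bundle DV DV)) (\<lambda>x. gt (g.base_class (Inr x)))"
      by (rule smooth_map_cong[OF m2.base_diffeological tensor_local_plots
            smooth_map_comp[OF m2.metric_smooth[unfolded cot] T2_smooth]]) (rule gt2[unfolded h2_def])
  qed

  let ?ok = "\<lambda>c. fst (gt c) = c \<and>
    (\<forall>v\<in>fibre V c. \<forall>w\<in>fibre V c. bilinear_form (gt c) v w = bilinear_form (gt c) w v) \<and>
    (\<forall>v\<in>fibre V c. 0 \<le> bilinear_form (gt c) v v) \<and>
    form_rank (fibre V c) (bilinear_form (gt c)) = functional.dim (dual_fibre V c)"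
  have ok: "?ok c" if c: "c \<in> points (base_space V)" for c
    using V_cases[OF c]
  proof (elim disjE bexE)
    fix x assume x: "x \<in> points (base_space B1)" and cx: "c = h1 x"
    have "fibre D1 x \<subseteq> points (tot_space D1)" by (rule subsetI) (rule fibreD(1))
    then have "inj_on (\<lambda>t. e.tot_class (Inr t)) (fibre D1 x)" by (rule inj_on_subset[OF e.Inr_inj])
    then have "bij_betw (\<lambda>t. e.tot_class (Inr t)) (fibre D1 x) (fibre E (?sw (h1 x)))"
      unfolding sw1[OF x] E_def bij_betw_def using e.fibre_Inr[of x] x by (simp add: bases)
    from bij_betw_trans[OF this i_bij[OF h1_pt[OF x]]]
    have bij: "bij_betw k1 (fibre D1 x) (fibre DV (h1 x))"
      unfolding k1_def comp_def .
    have lin: "fibrewise_linear D1 DV {x} h1 k1" using lin1 x unfolding fibrewise_linear_def by blast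
    note metric = transported_metric[OF assms(6) V.finite_dim_pseudo_bundle_axioms x h1_pt[OF x]
        bij[unfolded D1_def DV_def] lin[unfolded D1_def DV_def] gt1[OF x, unfolded T1_def DV_def]]
    show "?ok c" unfolding cx using metric by blast
  next
    fix x assume "x \<in> points (base_space B2) - f ` Y" and cx: "c = h2 x"
    then have x: "x \<in> points (base_space B2)" "x \<notin> f ` Y" by simp_all
    have "bij_betw (\<lambda>t. e.tot_class (Inl t)) (fibre D2 x) (fibre E (?sw (h2 x)))"
      unfolding sw2[OF x(1)] E_def bij_betw_def
      using e.fibre_Inl[of x] x e.Inl_inj[OF x(2)] by (simp add: bases)
    from bij_betw_trans[OF this i_bij[OF h2_pt[OF x(1)]]]
    have bij: "bij_betw k2 (fibre D2 x) (fibre DV (h2 x))"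
      unfolding k2_def comp_def .
    have lin: "fibrewise_linear D2 DV {x} h2 k2" using lin2 x unfolding fibrewise_linear_def by blast
    note metric = transported_metric[OF assms(7) V.finite_dim_pseudo_bundle_axioms x(1) h2_pt[OF x(1)]
        bij[unfolded D2_def DV_def] lin[unfolded D2_def DV_def] gt2[OF x(1), unfolded T2_def DV_def]]
    show "?ok c" unfolding cx using metric by blast
  qed
  have "pseudo_metric V gt"
  proof (intro pseudo_metric.intro pseudo_metric_axioms.intro)
    show "finite_dim_pseudo_bundle V" by (rule V.finite_dim_pseudo_bundle_axioms)
    show "smooth_map (base_space V) (tot_space (cotensor_bundle V)) gt"
      unfolding cot by (rule gt_smooth)
  qed (use ok in \<open>simp_all add: tensor_bundle_def tensor_with_simps\<close>)
  then show ?thesis unfolding V_def gt_def .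
qed

end
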